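(* Let $M$ be a capped Dade $kG$-module. If $U$ and $V$ are two components of $M$ whose vertices are Sylow $p$-subgroups of $G$, then $U\cong V$.
   Context: $G$ is a finite group, $p$ a prime, $S$ a Sylow $p$-subgroup of $G$, $k$ an algebraically closed field of characteristic $p$. All $kG$-modules are finitely generated. A component of a module is an indecomposable direct summand. A $p$-permutation $kG$-module is a direct summand of a permutation $kG$-module. A $kG$-module $M$ is a Dade $kG$-module if $\mathrm{End}_k(M)\cong k^n\oplus W$ for some integer $n\ge 0$ and some $p$-permutation module $W$ all of whose components have vertices that are non-Sylow $p$-subgroups of $G$. A Dade module is capped if it has a component with vertex $S$. *)

theory Defs
  imports
    "HOL-Algebra.Group"
    "HOL-Computational_Algebra.Computational_Algebra"
    "HOL-Library.Function_Algebras"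
    "HOL-Library.Product_Plus"
begin

text \<open>
  A \<open>kG\<close>-module is encoded as a \<open>k\<close>-linear action of the group \<open>G\<close> on a subspace
  \<open>carrier M\<close> of an ambient vector space \<open>'v\<close> over the field \<open>'k\<close>.  The value of
  \<open>act M g v\<close> is only relevant for \<open>g\<close> in \<open>carrier G\<close> and \<open>v\<close> in \<open>carrier M\<close>.
\<close>

record ('g, 'k, 'v) kG_mod = "'v partial_object" +
  scal :: "'k \<Rightarrow> 'v \<Rightarrow> 'v"
  act :: "'g \<Rightarrow> 'v \<Rightarrow> 'v"

text \<open>Modules are finitely generated over \<open>kG\<close> throughout; this is part of the locale.\<close>

locale kG_module = group G + vector_space "scal M"
  for G :: "'g monoid" and M :: "('g, 'k::field, 'v::ab_group_add) kG_mod" +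
  assumes carrier_subspace: "subspace (carrier M)"
    and act_closed: "\<lbrakk>g \<in> carrier G; v \<in> carrier M\<rbrakk> \<Longrightarrow> act M g v \<in> carrier M"
    and act_add: "\<lbrakk>g \<in> carrier G; v \<in> carrier M; w \<in> carrier M\<rbrakk> \<Longrightarrow>
      act M g (v + w) = act M g v + act M g w"
    and act_scal: "\<lbrakk>g \<in> carrier G; v \<in> carrier M\<rbrakk> \<Longrightarrow>
      act M g (scal M c v) = scal M c (act M g v)"
    and act_one: "v \<in> carrier M \<Longrightarrow> act M \<one>\<^bsub>G\<^esub> v = v"
    and act_mult: "\<lbrakk>g \<in> carrier G; h \<in> carrier G; v \<in> carrier M\<rbrakk> \<Longrightarrow>
      act M (g \<otimes>\<^bsub>G\<^esub> h) v = act M g (act M h v)"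
    and finitely_generated: "\<exists>B. finite B \<and> B \<subseteq> carrier M \<and>
      carrier M = span {act M g b |g b. g \<in> carrier G \<and> b \<in> B}"

definition kG_hom ::
  "'g monoid \<Rightarrow> ('g, 'k::field, 'v::ab_group_add) kG_mod \<Rightarrow>
   ('g, 'k, 'w::ab_group_add) kG_mod \<Rightarrow> ('v \<Rightarrow> 'w) set" where
  "kG_hom G M N = {f. f ` carrier M \<subseteq> carrier N \<and>
     (\<forall>u\<in>carrier M. \<forall>v\<in>carrier M. f (u + v) = f u + f v) \<and>
     (\<forall>c. \<forall>v\<in>carrier M. f (scal M c v) = scal N c (f v)) \<and>
     (\<forall>g\<in>carrier G. \<forall>v\<in>carrier M. f (act M g v) = act N g (f v))}"

definition kG_isomorphic ::
  "'g monoid \<Rightarrow> ('g, 'k::field, 'v::ab_group_add) kG_mod \<Rightarrow>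
   ('g, 'k, 'w::ab_group_add) kG_mod \<Rightarrow> bool" where
  "kG_isomorphic G M N \<longleftrightarrow> (\<exists>f\<in>kG_hom G M N. bij_betw f (carrier M) (carrier N))"

definition kG_sum ::
  "('g, 'k::field, 'v::ab_group_add) kG_mod \<Rightarrow> ('g, 'k, 'w::ab_group_add) kG_mod \<Rightarrow>
   ('g, 'k, 'v \<times> 'w) kG_mod" where
  "kG_sum M N = \<lparr>carrier = carrier M \<times> carrier N,
     scal = (\<lambda>c x. (scal M c (fst x), scal N c (snd x))),
     act = (\<lambda>g x. (act M g (fst x), act N g (snd x)))\<rparr>"

text \<open>
  Direct summands are taken up to isomorphism.  A complement of a summand of \<open>M\<close> is isomorphic
  to a submodule of \<open>M\<close>, so quantifying over complements with the same ambient type as \<open>M\<close>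
  loses nothing; likewise for the decompositions in \<open>indecomposable\<close>.
\<close>

definition direct_summand ::
  "'g monoid \<Rightarrow> ('g, 'k::field, 'u::ab_group_add) kG_mod \<Rightarrow>
   ('g, 'k, 'v::ab_group_add) kG_mod \<Rightarrow> bool" where
  "direct_summand G U M \<longleftrightarrow> kG_module G U \<and>
     (\<exists>N :: ('g, 'k, 'v) kG_mod. kG_module G N \<and> kG_isomorphic G M (kG_sum U N))"

definition indecomposable ::
  "'g monoid \<Rightarrow> ('g, 'k::field, 'v::ab_group_add) kG_mod \<Rightarrow> bool" where
  "indecomposable G M \<longleftrightarrow> kG_module G M \<and> carrier M \<noteq> {0} \<and>
     (\<forall>(A :: ('g, 'k, 'v) kG_mod) (B :: ('g, 'k, 'v) kG_mod). kG_module G A \<and> kG_module G B \<and>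
        kG_isomorphic G M (kG_sum A B) \<longrightarrow>
        carrier A = {0} \<or> carrier B = {0})"

definition component ::
  "'g monoid \<Rightarrow> ('g, 'k::field, 'u::ab_group_add) kG_mod \<Rightarrow>
   ('g, 'k, 'v::ab_group_add) kG_mod \<Rightarrow> bool" where
  "component G U M \<longleftrightarrow> direct_summand G U M \<and> indecomposable G U"

text \<open>
  \<open>Ind\<^sub>H\<^sup>G(V) = kG \<otimes>\<^bsub>kH\<^esub> V\<close> for finite \<open>G\<close>, in the function model: the elements are the
  functions \<open>f : G \<rightarrow> V\<close> with \<open>f (x h) = h\<^sup>-\<^sup>1 f x\<close>, where \<open>f\<close> stands for the sum of
  \<open>x \<otimes> f x\<close> over representatives \<open>x\<close> of the left cosets of \<open>H\<close>.  The tensor \<open>g \<otimes> v\<close> is the function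
  supported on \<open>g H\<close> with value \<open>h\<^sup>-\<^sup>1 v\<close> at \<open>g h\<close>.
\<close>

definition induced ::
  "'g monoid \<Rightarrow> 'g set \<Rightarrow> ('g, 'k::field, 'v::ab_group_add) kG_mod \<Rightarrow>
   ('g, 'k, 'g \<Rightarrow> 'v) kG_mod" where
  "induced G H V = \<lparr>carrier = {f.
       (\<forall>x\<in>carrier G. f x \<in> carrier V) \<and> (\<forall>x. x \<notin> carrier G \<longrightarrow> f x = 0) \<and>
       (\<forall>x\<in>carrier G. \<forall>h\<in>H. f (x \<otimes>\<^bsub>G\<^esub> h) = act V (inv\<^bsub>G\<^esub> h) (f x))},
     scal = (\<lambda>c f x. scal V c (f x)),
     act = (\<lambda>g f x. if x \<in> carrier G then f (inv\<^bsub>G\<^esub> g \<otimes>\<^bsub>G\<^esub> x) else 0)\<rparr>"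

text \<open>
  Finitely generated modules are finite-dimensional (\<open>G\<close> being finite), so each of them is
  isomorphic to one with ambient space \<open>nat \<Rightarrow> 'k\<close>.  This type is used below wherever a
  module is quantified inside a definition.
\<close>

definition relatively_projective ::
  "'g monoid \<Rightarrow> 'g set \<Rightarrow> ('g, 'k::field, 'v::ab_group_add) kG_mod \<Rightarrow> bool" where
  "relatively_projective G H M \<longleftrightarrow>
     (\<exists>V :: ('g, 'k, nat \<Rightarrow> 'k) kG_mod.
        kG_module (G\<lparr>carrier := H\<rparr>) V \<and> direct_summand G M (induced G H V))"

text \<open>The vertex of an indecomposable module is determined only up to \<open>G\<close>-conjugacy.\<close>

definition is_vertex ::
  "'g monoid \<Rightarrow> ('g, 'k::field, 'v::ab_group_add) kG_mod \<Rightarrow> 'g set \<Rightarrow> bool" where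
  "is_vertex G U Q \<longleftrightarrow> indecomposable G U \<and> subgroup Q G \<and> relatively_projective G Q U \<and>
     (\<forall>R. subgroup R G \<and> R \<subset> Q \<longrightarrow> \<not> relatively_projective G R U)"

definition p_subgroup :: "'g monoid \<Rightarrow> nat \<Rightarrow> 'g set \<Rightarrow> bool" where
  "p_subgroup G p Q \<longleftrightarrow> subgroup Q G \<and> (\<exists>n. card Q = p ^ n)"

definition sylow_subgroup :: "'g monoid \<Rightarrow> nat \<Rightarrow> 'g set \<Rightarrow> bool" where
  "sylow_subgroup G p Q \<longleftrightarrow> subgroup Q G \<and> card Q = p ^ multiplicity p (card (carrier G))"

definition permutation_module ::
  "'g monoid \<Rightarrow> ('g, 'k::field, 'v::ab_group_add) kG_mod \<Rightarrow> bool" where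
  "permutation_module G P \<longleftrightarrow> kG_module G P \<and>
     (\<exists>X. \<not> module.dependent (scal P) X \<and> module.span (scal P) X = carrier P \<and>
        (\<forall>g\<in>carrier G. \<forall>x\<in>X. act P g x \<in> X))"

definition p_permutation_module ::
  "'g monoid \<Rightarrow> ('g, 'k::field, 'v::ab_group_add) kG_mod \<Rightarrow> bool" where
  "p_permutation_module G W \<longleftrightarrow>
     (\<exists>P :: ('g, 'k, nat \<Rightarrow> 'k) kG_mod. permutation_module G P \<and> direct_summand G W P)"

text \<open>The module \<open>k\<^sup>n\<close>: the direct sum of \<open>n\<close> copies of the trivial module.\<close>

definition trivial_power :: "nat \<Rightarrow> ('g, 'k::field, nat \<Rightarrow> 'k) kG_mod" where
  "trivial_power n = \<lparr>carrier = {f. \<forall>i\<ge>n. f i = 0}, scal = (\<lambda>c f i. c * f i), act = (\<lambda>g f. f)\<rparr>"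

text \<open>
  \<open>End\<^sub>k(M)\<close> with the conjugation action.  An endomorphism of \<open>carrier M\<close> is represented by
  its extension by zero to the ambient type.
\<close>

definition End_mod ::
  "'g monoid \<Rightarrow> ('g, 'k::field, 'v::ab_group_add) kG_mod \<Rightarrow> ('g, 'k, 'v \<Rightarrow> 'v) kG_mod" where
  "End_mod G M = \<lparr>carrier = {f.
       (\<forall>v\<in>carrier M. f v \<in> carrier M) \<and> (\<forall>v. v \<notin> carrier M \<longrightarrow> f v = 0) \<and>
       (\<forall>u\<in>carrier M. \<forall>v\<in>carrier M. f (u + v) = f u + f v) \<and>
       (\<forall>c. \<forall>v\<in>carrier M. f (scal M c v) = scal M c (f v))},
     scal = (\<lambda>c f v. scal M c (f v)),
     act = (\<lambda>g f v. if v \<in> carrier M then act M g (f (act M (inv\<^bsub>G\<^esub> g) v)) else 0)\<rparr>"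

definition dade_module ::
  "'g monoid \<Rightarrow> nat \<Rightarrow> ('g, 'k::field, 'v::ab_group_add) kG_mod \<Rightarrow> bool" where
  "dade_module G p M \<longleftrightarrow> kG_module G M \<and>
     (\<exists>n. \<exists>W :: ('g, 'k, nat \<Rightarrow> 'k) kG_mod.
        p_permutation_module G W \<and>
        (\<forall>C :: ('g, 'k, nat \<Rightarrow> 'k) kG_mod. component G C W \<longrightarrow>
           (\<exists>Q. is_vertex G C Q \<and> p_subgroup G p Q \<and> \<not> sylow_subgroup G p Q)) \<and>
        kG_isomorphic G (End_mod G M) (kG_sum (trivial_power n) W))"

definition capped ::
  "'g monoid \<Rightarrow> 'g set \<Rightarrow> ('g, 'k::field, 'v::ab_group_add) kG_mod \<Rightarrow> bool" where
  "capped G S M \<longleftrightarrow> (\<exists>U :: ('g, 'k, 'v) kG_mod. component G U M \<and> is_vertex G U S)"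

end

theory Submission
  imports Defs "HOL-Algebra.Coset" "HOL-Algebra.Group_Action"
begin

text \<open>
  Let \<open>J\<close> be the span of the relative traces from non-Sylow \<open>p\<close>-subgroups.  An indecomposable
  module with a Sylow vertex does not have \<open>id \<in> J\<close>.  The module \<open>X = Hom(U, V)\<close> is a summand of
  \<open>End(M) = k\<^sup>n \<oplus> W\<close>, so either \<open>id\<^sub>X \<in> J\<close>, or there are a fixed point \<open>f\<close> of \<open>X\<close> and an invariant
  functional \<open>l\<close> with \<open>l f \<noteq> 0\<close>.  In the second case \<open>l f\<close> is the trace of \<open>h f\<close> for a homomorphism
  \<open>h : V \<rightarrow> U\<close>; hence \<open>h f\<close> is not nilpotent, and Fitting's lemma makes it bijective, so \<open>U \<cong> V\<close>.
  The first case is impossible.  Indeed \<open>id \<in> J\<close> on \<open>End(V)\<close> would, evaluated at \<open>id\<^sub>V\<close>, give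
  \<open>id\<^sub>V \<in> J\<close>; so \<open>End(V)\<close> has a trivial summand, \<open>U\<close> is a summand of \<open>Hom(X, V)\<close>, and \<open>id\<^sub>X \<in> J\<close>
  would give \<open>id\<^sub>U \<in> J\<close>.
\<close>

section \<open>Sums over left cosets\<close>

text \<open>The vertex condition speaks of summands of induced modules, the Dade condition of a
  decomposition of End(M); both are turned into identities between maps. Higman's criterion rewrites
  relative projectivity as an equation between a relative trace and the identity, and summands are
  handled as retracts, so that membership in J can be moved by composition. A Sylow vertex keeps the
  identity out of J because the endomorphism ring is local: otherwise a single trace would be
  invertible, and the module would be relatively projective to one non-Sylow p-subgroup, a conjugate
  of which is properly contained in the vertex. The splitting of End(M) is kept as a formula: e is
  the sum of the \<alpha> i (e) a i plus j(e), with invariant functionals \<alpha> i, fixed vectors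
  a i and j in J. In this form it descends to the retract Hom(U, V). The map h comes from the trace
  form (h, f) \<mapsto> tr(h f), which identifies Hom(V, U) equivariantly with the dual of Hom(U,
  V).\<close>

text \<open>Representatives are taken by choice, so the value is meaningful only when
  \<open>coset_invariant G H F\<close> holds. Summing over all of \<open>G\<close> instead would
  introduce the factor \<open>card H\<close>, which is zero in k whenever p divides it.\<close>

definition coset_sum :: "('g, 'm) monoid_scheme \<Rightarrow> 'g set \<Rightarrow> ('g \<Rightarrow> 'a::comm_monoid_add) \<Rightarrow> 'a" where
  "coset_sum G H F = (\<Sum>C\<in>(\<lambda>x. x <#\<^bsub>G\<^esub> H) ` carrier G. F (SOME x. x \<in> C))"

definition coset_invariant :: "('g, 'm) monoid_scheme \<Rightarrow> 'g set \<Rightarrow> ('g \<Rightarrow> 'a) \<Rightarrow> bool" where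
  "coset_invariant G H F \<longleftrightarrow> (\<forall>x\<in>carrier G. \<forall>h\<in>H. F (x \<otimes>\<^bsub>G\<^esub> h) = F x)"

context group
begin

lemma some_in_coset:
  assumes "subgroup H G" "x \<in> carrier G"
  shows "\<exists>h\<in>H. (SOME y. y \<in> x <# H) = x \<otimes> h"
proof -
  have "x \<otimes> \<one> \<in> x <# H"
    using subgroup.one_closed[OF assms(1)] unfolding l_coset_def by blast
  then have "(SOME y. y \<in> x <# H) \<in> x <# H" by (rule someI)
  then show ?thesis unfolding l_coset_def by blast
qed

lemma some_coset_closed:
  assumes "subgroup H G" "C \<in> (\<lambda>x. x <# H) ` carrier G"
  shows "(SOME x. x \<in> C) \<in> carrier G"
proof -
  obtain x where "x \<in> carrier G" "C = x <# H" using assms(2) by blast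
  then show ?thesis
    using some_in_coset[OF assms(1)] subgroup.mem_carrier[OF assms(1)] by (metis m_closed)
qed

lemma coset_invariant_some:
  assumes "subgroup H G" "coset_invariant G H F" "x \<in> carrier G"
  shows "F (SOME y. y \<in> x <# H) = F x"
  using some_in_coset[OF assms(1,3)] assms(2,3) unfolding coset_invariant_def by metis

lemma coset_sum_cong:
  assumes "subgroup H G" "\<And>x. x \<in> carrier G \<Longrightarrow> F x = F' x"
  shows "coset_sum G H F = coset_sum G H F'"
  unfolding coset_sum_def by (intro sum.cong refl assms(2) some_coset_closed[OF assms(1)])

text \<open>Left multiplication by \<open>g\<close> permutes the left cosets of \<open>H\<close>.
  This is the change of variables behind the equivariance of relative traces.\<close>

lemma coset_sum_translate:
  assumes H: "subgroup H G" and F: "coset_invariant G H F" and g: "g \<in> carrier G"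
  shows "coset_sum G H (\<lambda>x. F (g \<otimes> x)) = coset_sum G H F"
proof -
  have HG: "H \<subseteq> carrier G" using H by (rule subgroup.subset)
  have tr: "y <# (x <# H) = (y \<otimes> x) <# H" if "x \<in> carrier G" "y \<in> carrier G" for x y
    using that HG by (simp add: lcos_m_assoc)
  have F': "coset_invariant G H (\<lambda>x. F (g \<otimes> x))"
    unfolding coset_invariant_def
  proof (intro ballI)
    fix x h assume xh: "x \<in> carrier G" "h \<in> H"
    then have "h \<in> carrier G" using HG by blast
    then have "g \<otimes> (x \<otimes> h) = (g \<otimes> x) \<otimes> h" using xh g by (simp add: m_assoc)
    then show "F (g \<otimes> (x \<otimes> h)) = F (g \<otimes> x)"
      using F xh g unfolding coset_invariant_def by simp
  qed
  show ?thesis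
    unfolding coset_sum_def
  proof (rule sum.reindex_bij_witness[where i = "\<lambda>C. inv g <# C" and j = "\<lambda>C. g <# C"])
    fix C assume "C \<in> (\<lambda>x. x <# H) ` carrier G"
    then obtain x where x: "x \<in> carrier G" "C = x <# H" by blast
    show "inv g <# (g <# C) = C" "g <# (inv g <# C) = C"
      using x g HG by (simp_all add: tr m_assoc[symmetric])
    have a: "g <# C = (g \<otimes> x) <# H" "inv g <# C = (inv g \<otimes> x) <# H" using x g by (simp_all add: tr)
    show "g <# C \<in> (\<lambda>x. x <# H) ` carrier G" using a(1) x(1) g by blast
    show "inv g <# C \<in> (\<lambda>x. x <# H) ` carrier G" using a(2) x(1) g by blast
    show "F (SOME x. x \<in> g <# C) = F (g \<otimes> (SOME x. x \<in> C))"
      using coset_invariant_some[OF H F' x(1)] coset_invariant_some[OF H F, of "g \<otimes> x"] x g a by simp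
  qed
qed

lemma conj_subgroup:
  assumes H: "subgroup H G" and g: "g \<in> carrier G"
  shows "subgroup ((\<lambda>h. g \<otimes> h \<otimes> inv g) ` H) G"
proof
  have HG: "H \<subseteq> carrier G" using H by (rule subgroup.subset)
  then show "(\<lambda>h. g \<otimes> h \<otimes> inv g) ` H \<subseteq> carrier G" using g by auto
  show "\<one> \<in> (\<lambda>h. g \<otimes> h \<otimes> inv g) ` H"
    using subgroup.one_closed[OF H] g by (intro image_eqI[of _ _ \<one>]) auto
  fix x y assume "x \<in> (\<lambda>h. g \<otimes> h \<otimes> inv g) ` H"
  then obtain h where h: "h \<in> H" "x = g \<otimes> h \<otimes> inv g" by blast
  then have hc: "h \<in> carrier G" using HG by blast
  have "inv x = g \<otimes> inv h \<otimes> inv g" using h hc g by (simp add: inv_mult_group m_assoc)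
  then show "inv x \<in> (\<lambda>h. g \<otimes> h \<otimes> inv g) ` H"
    using subgroup.m_inv_closed[OF H h(1)] by blast
  assume "y \<in> (\<lambda>h. g \<otimes> h \<otimes> inv g) ` H"
  then obtain k where k: "k \<in> H" "y = g \<otimes> k \<otimes> inv g" by blast
  then have kc: "k \<in> carrier G" using HG by blast
  have "inv g \<otimes> (g \<otimes> (k \<otimes> inv g)) = k \<otimes> inv g"
    using g kc by (simp add: m_assoc[symmetric])
  then have "x \<otimes> y = g \<otimes> (h \<otimes> k) \<otimes> inv g" using h k hc kc g by (simp add: m_assoc)
  then show "x \<otimes> y \<in> (\<lambda>h. g \<otimes> h \<otimes> inv g) ` H"
    using subgroup.m_closed[OF H h(1) k(1)] by blast
qed

text \<open>With K = g H g^-1, right multiplication by g sends the left coset xK to (xg)H, a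
  bijection from the cosets of K to those of H. It makes traces from conjugate subgroups
  comparable.\<close>

lemma coset_sum_conj:
  assumes H: "subgroup H G" and F: "coset_invariant G H F" and g: "g \<in> carrier G"
  shows "coset_sum G ((\<lambda>h. g \<otimes> h \<otimes> inv g) ` H) (\<lambda>x. F (x \<otimes> g)) = coset_sum G H F"
proof -
  define K where "K = (\<lambda>h. g \<otimes> h \<otimes> inv g) ` H"
  have K: "subgroup K G" unfolding K_def by (rule conj_subgroup[OF H g])
  have HG: "H \<subseteq> carrier G" using H by (rule subgroup.subset)
  have cancel: "x \<otimes> (g \<otimes> h \<otimes> inv g) \<otimes> g = x \<otimes> g \<otimes> h" if "x \<in> carrier G" "h \<in> H" for x h
  proof -
    have "h \<in> carrier G" using that HG by blast
    then show ?thesis using that(1) g by (simp add: m_assoc)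
  qed
  have F': "coset_invariant G K (\<lambda>x. F (x \<otimes> g))"
    using F g cancel unfolding coset_invariant_def K_def by simp
  have KH: "(x <# K) #> g = (x \<otimes> g) <# H" if "x \<in> carrier G" for x
    using cancel[OF that] unfolding l_coset_def r_coset_def K_def by auto
  have HK: "(x <# H) #> inv g = (x \<otimes> inv g) <# K" if x: "x \<in> carrier G" for x
  proof -
    have "x \<otimes> inv g \<otimes> (g \<otimes> h \<otimes> inv g) = x \<otimes> h \<otimes> inv g" if "h \<in> H" for h
    proof -
      have hc: "h \<in> carrier G" using that HG by blast
      have "inv g \<otimes> (g \<otimes> (h \<otimes> inv g)) = h \<otimes> inv g"
        using g hc by (simp add: m_assoc[symmetric])
      then show ?thesis using x g hc by (simp add: m_assoc)
    qed
    then show ?thesis unfolding l_coset_def r_coset_def K_def by auto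
  qed
  show ?thesis
    unfolding K_def[symmetric] coset_sum_def
  proof (rule sum.reindex_bij_witness[where i = "\<lambda>C. C #> inv g" and j = "\<lambda>C. C #> g"])
    fix C assume "C \<in> (\<lambda>x. x <# K) ` carrier G"
    then obtain x where x: "x \<in> carrier G" "C = x <# K" by blast
    show "C #> g #> inv g = C" using x g by (simp add: KH HK m_assoc)
    show "C #> g \<in> (\<lambda>x. x <# H) ` carrier G" using x g by (simp add: KH)
    show "F (SOME x. x \<in> C #> g) = F ((SOME x. x \<in> C) \<otimes> g)"
      using coset_invariant_some[OF K F' x(1)] coset_invariant_some[OF H F, of "x \<otimes> g"] x g
      by (simp add: KH)
  next
    fix C assume "C \<in> (\<lambda>x. x <# H) ` carrier G"
    then obtain x where x: "x \<in> carrier G" "C = x <# H" by blast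
    show "C #> inv g #> g = C" using x g by (simp add: KH HK m_assoc)
    show "C #> inv g \<in> (\<lambda>x. x <# K) ` carrier G" using x g by (simp add: HK)
  qed
qed

end

section \<open>Representations and equivariant maps\<close>

text \<open>\<open>kG_module\<close> without finite generation, so that \<open>Hom\<close> spaces qualify at once.\<close>

locale kG_rep = group G + vector_space "scal M"
  for G :: "'g monoid" and M :: "('g, 'k::field, 'v::ab_group_add) kG_mod" +
  assumes carrier_subspace: "subspace (carrier M)"
    and act_closed: "\<lbrakk>g \<in> carrier G; v \<in> carrier M\<rbrakk> \<Longrightarrow> act M g v \<in> carrier M"
    and act_add: "\<lbrakk>g \<in> carrier G; v \<in> carrier M; w \<in> carrier M\<rbrakk> \<Longrightarrow>
      act M g (v + w) = act M g v + act M g w"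
    and act_scal: "\<lbrakk>g \<in> carrier G; v \<in> carrier M\<rbrakk> \<Longrightarrow>
      act M g (scal M c v) = scal M c (act M g v)"
    and act_one: "v \<in> carrier M \<Longrightarrow> act M \<one>\<^bsub>G\<^esub> v = v"
    and act_mult: "\<lbrakk>g \<in> carrier G; h \<in> carrier G; v \<in> carrier M\<rbrakk> \<Longrightarrow>
      act M (g \<otimes>\<^bsub>G\<^esub> h) v = act M g (act M h v)"

sublocale kG_module \<subseteq> kG_rep
  using carrier_subspace act_closed act_add act_scal act_one act_mult by unfold_locales

context kG_rep
begin

lemmas zero_mem = subspace_0[OF carrier_subspace]
  and add_mem = subspace_add[OF carrier_subspace]
  and scal_mem = subspace_scale[OF carrier_subspace]
  and diff_mem = subspace_diff[OF carrier_subspace]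
  and sum_mem = subspace_sum[OF carrier_subspace]

lemma act_inv_cancel:
  assumes "g \<in> carrier G" "v \<in> carrier M"
  shows "act M (inv\<^bsub>G\<^esub> g) (act M g v) = v" "act M g (act M (inv\<^bsub>G\<^esub> g) v) = v"
  using act_mult[of "inv\<^bsub>G\<^esub> g" g v] act_mult[of g "inv\<^bsub>G\<^esub> g" v] assms act_one by simp_all

lemma act_zero: "g \<in> carrier G \<Longrightarrow> act M g 0 = 0"
  using act_add[of g 0 0] zero_mem by simp

lemma act_sum:
  assumes "g \<in> carrier G" "\<And>i. i \<in> I \<Longrightarrow> x i \<in> carrier M"
  shows "act M g (sum x I) = (\<Sum>i\<in>I. act M g (x i))"
  using assms(2)
proof (induction I rule: infinite_finite_induct)
  case (insert i I)
  have "act M g (x i + sum x I) = act M g (x i) + act M g (sum x I)"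
    by (intro act_add sum_mem assms(1)) (simp_all add: insert.prems)
  then show ?case using insert by simp
qed (use act_zero assms(1) in auto)

lemma act_diff:
  assumes "g \<in> carrier G" "v \<in> carrier M" "w \<in> carrier M"
  shows "act M g (v - w) = act M g v - act M g w"
proof -
  have "act M g ((v - w) + w) = act M g (v - w) + act M g w"
    by (rule act_add[OF assms(1) diff_mem[OF assms(2,3)] assms(3)])
  then show ?thesis by simp
qed

lemma coset_sum_mem:
  assumes "subgroup H G" "\<And>x. x \<in> carrier G \<Longrightarrow> F x \<in> carrier M"
  shows "coset_sum G H F \<in> carrier M"
  unfolding coset_sum_def by (intro sum_mem assms(2) some_coset_closed[OF assms(1)])

lemma kG_rep_restrict:
  assumes "subgroup H G" shows "kG_rep (G\<lparr>carrier := H\<rparr>) M"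
proof -
  have "H \<subseteq> carrier G" using assms by (rule subgroup.subset)
  moreover have "group (G\<lparr>carrier := H\<rparr>)" using assms subgroup.subgroup_is_group is_group by blast
  ultimately show ?thesis
    unfolding kG_rep_def kG_rep_axioms_def
    using carrier_subspace act_closed act_add act_scal act_one act_mult vector_space_axioms
    by (auto simp: subset_iff)
qed

end

section \<open>Equivariant maps: composition, linear combinations, compatibility with sums\<close>

lemma kG_homI:
  assumes "\<And>v. v \<in> carrier M \<Longrightarrow> f v \<in> carrier N"
    and "\<And>u v. \<lbrakk>u \<in> carrier M; v \<in> carrier M\<rbrakk> \<Longrightarrow> f (u + v) = f u + f v"
    and "\<And>c v. v \<in> carrier M \<Longrightarrow> f (scal M c v) = scal N c (f v)"
    and "\<And>g v. \<lbrakk>g \<in> carrier G; v \<in> carrier M\<rbrakk> \<Longrightarrow> f (act M g v) = act N g (f v)"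
  shows "f \<in> kG_hom G M N"
  unfolding kG_hom_def using assms by blast

lemma kG_homD:
  assumes "f \<in> kG_hom G M N"
  shows kG_hom_mem: "\<And>v. v \<in> carrier M \<Longrightarrow> f v \<in> carrier N"
    and kG_hom_add: "\<And>u v. \<lbrakk>u \<in> carrier M; v \<in> carrier M\<rbrakk> \<Longrightarrow> f (u + v) = f u + f v"
    and kG_hom_scal: "\<And>c v. v \<in> carrier M \<Longrightarrow> f (scal M c v) = scal N c (f v)"
    and kG_hom_act: "\<And>g v. \<lbrakk>g \<in> carrier G; v \<in> carrier M\<rbrakk> \<Longrightarrow> f (act M g v) = act N g (f v)"
  using assms unfolding kG_hom_def by blast+

lemma kG_hom_restrict: "f \<in> kG_hom G M N \<Longrightarrow> H \<subseteq> carrier G \<Longrightarrow> f \<in> kG_hom (G\<lparr>carrier := H\<rparr>) M N"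
  unfolding kG_hom_def by auto

lemma kG_hom_comp:
  assumes "f \<in> kG_hom G L M" "h \<in> kG_hom G M N"
  shows "(\<lambda>x. h (f x)) \<in> kG_hom G L N"
  by (rule kG_homI) (simp_all add: kG_homD[OF assms(1)] kG_homD[OF assms(2)])

lemma kG_hom_id: "(\<lambda>x. x) \<in> kG_hom G M M"
  by (rule kG_homI) simp_all

lemma kG_hom_zero_map:
  assumes "kG_rep G N" shows "(\<lambda>x. 0) \<in> kG_hom G M N"
proof -
  interpret kG_rep G N by fact
  show ?thesis by (rule kG_homI) (simp_all add: zero_mem act_zero)
qed

lemma kG_hom_add_map:
  assumes "kG_rep G N" "f \<in> kG_hom G M N" "h \<in> kG_hom G M N"
  shows "(\<lambda>x. f x + h x) \<in> kG_hom G M N"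
proof -
  interpret kG_rep G N by fact
  show ?thesis
    by (rule kG_homI)
      (simp_all add: kG_homD[OF assms(2)] kG_homD[OF assms(3)] add_mem scale_right_distrib act_add algebra_simps)
qed

lemma kG_hom_scal_map:
  assumes "kG_rep G N" "f \<in> kG_hom G M N"
  shows "(\<lambda>x. scal N c (f x)) \<in> kG_hom G M N"
proof -
  interpret kG_rep G N by fact
  show ?thesis
    by (rule kG_homI)
      (simp_all add: kG_homD[OF assms(2)] scal_mem scale_right_distrib act_scal mult.commute)
qed

lemma kG_hom_sum_map:
  assumes "kG_rep G N" "\<And>i. i \<in> I \<Longrightarrow> f i \<in> kG_hom G M N"
  shows "(\<lambda>x. \<Sum>i\<in>I. f i x) \<in> kG_hom G M N"
  using assms(2)
proof (induction I rule: infinite_finite_induct)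
  case (insert i I)
  then show ?case using kG_hom_add_map[OF assms(1), of "f i" M "\<lambda>x. \<Sum>i\<in>I. f i x"] by simp
qed (simp_all add: kG_hom_zero_map[OF assms(1)])

text \<open>Here and below the group \<open>L\<close> of equivariance is unrelated to
  \<open>G\<close>: only linearity is used, so the facts also serve for maps equivariant under a
  subgroup and for merely linear maps, encoded with an empty group carrier.\<close>

lemma kG_hom_0:
  assumes "kG_rep G M" "f \<in> kG_hom L M N" shows "f 0 = 0"
  using kG_hom_add[OF assms(2), of 0 0] kG_rep.zero_mem[OF assms(1)] by simp

lemma kG_hom_sum:
  assumes "kG_rep G M" "f \<in> kG_hom L M N" "\<And>i. i \<in> I \<Longrightarrow> x i \<in> carrier M"
  shows "f (sum x I) = (\<Sum>i\<in>I. f (x i))"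
  using assms(3)
proof (induction I rule: infinite_finite_induct)
  case (insert i I)
  have "f (x i + sum x I) = f (x i) + f (sum x I)"
    by (intro kG_hom_add[OF assms(2)] kG_rep.sum_mem[OF assms(1)]) (simp_all add: insert.prems)
  then show ?case using insert by simp
qed (use kG_hom_0[OF assms(1,2)] in auto)

lemma kG_hom_diff:
  assumes "kG_rep G M" "f \<in> kG_hom L M N" "x \<in> carrier M" "y \<in> carrier M"
  shows "f (x - y) = f x - f y"
proof -
  have "f ((x - y) + y) = f (x - y) + f y"
    by (rule kG_hom_add[OF assms(2) kG_rep.diff_mem[OF assms(1,3,4)] assms(4)])
  then show ?thesis by simp
qed

lemma kG_hom_coset_sum:
  assumes "kG_rep G M" "f \<in> kG_hom L M N" "subgroup H G"
    "\<And>x. x \<in> carrier G \<Longrightarrow> F x \<in> carrier M"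
  shows "f (coset_sum G H F) = coset_sum G H (\<lambda>x. f (F x))"
  unfolding coset_sum_def
  using assms(4) group.some_coset_closed[OF kG_rep.axioms(1)[OF assms(1)] assms(3)]
  by (intro kG_hom_sum[OF assms(1,2)]) auto

section \<open>Relative traces\<close>

text \<open>The transfer from \<open>H\<close>-homomorphisms to \<open>G\<close>-homomorphisms,
  Tr_H^G in the usual notation.\<close>

definition rel_trace ::
  "'g monoid \<Rightarrow> 'g set \<Rightarrow> ('g, 'k::field, 'v::ab_group_add) kG_mod \<Rightarrow>
   ('g, 'k, 'w::ab_group_add) kG_mod \<Rightarrow> ('v \<Rightarrow> 'w) \<Rightarrow> 'v \<Rightarrow> 'w" where
  "rel_trace G H A B \<theta> a = coset_sum G H (\<lambda>x. act B x (\<theta> (act A (inv\<^bsub>G\<^esub> x) a)))"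

text \<open>One \<open>\<theta>\<close> per subgroup suffices, since traces from the same subgroup
  add up to a trace. Maps are compared only on \<open>carrier A\<close>, because
  \<open>kG_hom\<close> constrains nothing outside it.\<close>

definition trace_ideal ::
  "'g monoid \<Rightarrow> 'g set set \<Rightarrow> ('g, 'k::field, 'v::ab_group_add) kG_mod \<Rightarrow>
   ('g, 'k, 'w::ab_group_add) kG_mod \<Rightarrow> ('v \<Rightarrow> 'w) set" where
  "trace_ideal G F A B = {f. \<exists>\<theta>. (\<forall>Q\<in>F. \<theta> Q \<in> kG_hom (G\<lparr>carrier := Q\<rparr>) A B) \<and>
     (\<forall>a\<in>carrier A. f a = (\<Sum>Q\<in>F. rel_trace G Q A B (\<theta> Q) a))}"

lemma trace_idealI:
  assumes "\<And>Q. Q \<in> F \<Longrightarrow> \<theta> Q \<in> kG_hom (G\<lparr>carrier := Q\<rparr>) A B"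
    and "\<And>a. a \<in> carrier A \<Longrightarrow> f a = (\<Sum>Q\<in>F. rel_trace G Q A B (\<theta> Q) a)"
  shows "f \<in> trace_ideal G F A B"
  unfolding trace_ideal_def using assms by blast

lemma trace_idealE:
  assumes "f \<in> trace_ideal G F A B"
  obtains \<theta> where "\<And>Q. Q \<in> F \<Longrightarrow> \<theta> Q \<in> kG_hom (G\<lparr>carrier := Q\<rparr>) A B"
    and "\<And>a. a \<in> carrier A \<Longrightarrow> f a = (\<Sum>Q\<in>F. rel_trace G Q A B (\<theta> Q) a)"
  using assms unfolding trace_ideal_def by blast

lemma trace_ideal_cong:
  "f \<in> trace_ideal G F A B \<Longrightarrow> (\<And>a. a \<in> carrier A \<Longrightarrow> f' a = f a) \<Longrightarrow> f' \<in> trace_ideal G F A B"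
  unfolding trace_ideal_def by auto

lemma trace_summand_mem:
  assumes A: "kG_rep G A" and B: "kG_rep G B" and \<theta>: "\<theta> \<in> kG_hom L A B"
    and "a \<in> carrier A" "x \<in> carrier G"
  shows "act B x (\<theta> (act A (inv\<^bsub>G\<^esub> x) a)) \<in> carrier B"
proof -
  interpret A: kG_rep G A by fact
  interpret B: kG_rep G B by fact
  show ?thesis using assms by (intro B.act_closed kG_hom_mem[OF \<theta>] A.act_closed) auto
qed

text \<open>Replacing x by xh puts h after \<open>\<theta>\<close> and h^-1 before it, and these
  cancel since \<open>\<theta>\<close> commutes with \<open>H\<close>. So a relative trace does not
  depend on the chosen representatives.\<close>

lemma trace_summand_invariant:
  assumes A: "kG_rep G A" and B: "kG_rep G B" and H: "subgroup H G"
    and \<theta>: "\<theta> \<in> kG_hom (G\<lparr>carrier := H\<rparr>) A B" and a: "a \<in> carrier A"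
  shows "coset_invariant G H (\<lambda>x. act B x (\<theta> (act A (inv\<^bsub>G\<^esub> x) a)))"
  unfolding coset_invariant_def
proof (intro ballI)
  interpret A: kG_rep G A by fact
  interpret B: kG_rep G B by fact
  fix x h assume x: "x \<in> carrier G" and h: "h \<in> H"
  have hc: "h \<in> carrier G" and hi: "inv\<^bsub>G\<^esub> h \<in> H"
    using h H subgroup.mem_carrier[OF H] subgroup.m_inv_closed[OF H] by blast+
  have xa: "act A (inv\<^bsub>G\<^esub> x) a \<in> carrier A" using x a by (intro A.act_closed) auto
  have "\<theta> (act A (inv\<^bsub>G\<^esub> (x \<otimes>\<^bsub>G\<^esub> h)) a) = \<theta> (act A (inv\<^bsub>G\<^esub> h) (act A (inv\<^bsub>G\<^esub> x) a))"
    using x hc a by (simp add: A.inv_mult_group A.act_mult)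
  also have "\<dots> = act B (inv\<^bsub>G\<^esub> h) (\<theta> (act A (inv\<^bsub>G\<^esub> x) a))"
    using kG_hom_act[OF \<theta>, of "inv\<^bsub>G\<^esub> h"] hi xa by simp
  finally show "act B (x \<otimes>\<^bsub>G\<^esub> h) (\<theta> (act A (inv\<^bsub>G\<^esub> (x \<otimes>\<^bsub>G\<^esub> h)) a)) =
      act B x (\<theta> (act A (inv\<^bsub>G\<^esub> x) a))"
    using x hc xa kG_hom_mem[OF \<theta> xa] by (simp add: B.act_mult B.act_closed B.act_inv_cancel)
qed

text \<open>Additivity and homogeneity hold summand by summand; equivariance does not, since g
  permutes the summands. It is the substitution of gx for x.\<close>

lemma rel_trace_hom:
  assumes A: "kG_rep G A" and B: "kG_rep G B" and H: "subgroup H G"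
    and \<theta>: "\<theta> \<in> kG_hom (G\<lparr>carrier := H\<rparr>) A B"
  shows "rel_trace G H A B \<theta> \<in> kG_hom G A B"
proof (rule kG_homI)
  interpret A: kG_rep G A by fact
  interpret B: kG_rep G B by fact
  note mem = trace_summand_mem[OF A B \<theta>]
  fix a assume a: "a \<in> carrier A"
  show "rel_trace G H A B \<theta> a \<in> carrier B"
    unfolding rel_trace_def by (intro B.coset_sum_mem[OF H] mem a)
  show "rel_trace G H A B \<theta> (scal A c a) = scal B c (rel_trace G H A B \<theta> a)" for c
  proof -
    have "act B x (\<theta> (act A (inv\<^bsub>G\<^esub> x) (scal A c a))) = scal B c (act B x (\<theta> (act A (inv\<^bsub>G\<^esub> x) a)))"
      if "x \<in> carrier G" for x
      using that a by (simp add: A.act_scal A.act_closed kG_homD[OF \<theta>] B.act_scal)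
    then have "rel_trace G H A B \<theta> (scal A c a) =
        coset_sum G H (\<lambda>x. scal B c (act B x (\<theta> (act A (inv\<^bsub>G\<^esub> x) a))))"
      unfolding rel_trace_def by (rule A.coset_sum_cong[OF H])
    then show ?thesis unfolding rel_trace_def coset_sum_def by (simp add: B.scale_sum_right)
  qed
  show "rel_trace G H A B \<theta> (a + b) = rel_trace G H A B \<theta> a + rel_trace G H A B \<theta> b"
    if b: "b \<in> carrier A" for b
  proof -
    have "act B x (\<theta> (act A (inv\<^bsub>G\<^esub> x) (a + b))) =
        act B x (\<theta> (act A (inv\<^bsub>G\<^esub> x) a)) + act B x (\<theta> (act A (inv\<^bsub>G\<^esub> x) b))"
      if "x \<in> carrier G" for x
      using that a b by (simp add: A.act_add A.act_closed kG_homD[OF \<theta>] B.act_add)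
    then have "rel_trace G H A B \<theta> (a + b) = coset_sum G H (\<lambda>x.
        act B x (\<theta> (act A (inv\<^bsub>G\<^esub> x) a)) + act B x (\<theta> (act A (inv\<^bsub>G\<^esub> x) b)))"
      unfolding rel_trace_def by (rule A.coset_sum_cong[OF H])
    then show ?thesis unfolding rel_trace_def coset_sum_def by (simp add: sum.distrib)
  qed
  fix g assume g: "g \<in> carrier G"
  have inv: "coset_invariant G H (\<lambda>x. act B x (\<theta> (act A (inv\<^bsub>G\<^esub> x) (act A g a))))"
    by (rule trace_summand_invariant[OF A B H \<theta> A.act_closed[OF g a]])
  have "act B (g \<otimes>\<^bsub>G\<^esub> x) (\<theta> (act A (inv\<^bsub>G\<^esub> (g \<otimes>\<^bsub>G\<^esub> x)) (act A g a))) =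
      act B g (act B x (\<theta> (act A (inv\<^bsub>G\<^esub> x) a)))" if x: "x \<in> carrier G" for x
  proof -
    have "act A (inv\<^bsub>G\<^esub> (g \<otimes>\<^bsub>G\<^esub> x)) (act A g a) = act A (inv\<^bsub>G\<^esub> x) a"
      using g x a by (simp add: A.inv_mult_group A.act_mult A.act_closed A.act_inv_cancel)
    then show ?thesis
      using g x a by (simp add: B.act_mult kG_hom_mem[OF \<theta>] A.act_closed)
  qed
  then have "rel_trace G H A B \<theta> (act A g a) =
      coset_sum G H (\<lambda>x. act B g (act B x (\<theta> (act A (inv\<^bsub>G\<^esub> x) a))))"
    unfolding rel_trace_def A.coset_sum_translate[OF H inv g, symmetric]
    by (rule A.coset_sum_cong[OF H])
  also have "\<dots> = act B g (rel_trace G H A B \<theta> a)"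
    unfolding rel_trace_def coset_sum_def
    by (rule B.act_sum[symmetric]) (auto intro!: mem a g A.some_coset_closed[OF H])
  finally show "rel_trace G H A B \<theta> (act A g a) = act B g (rel_trace G H A B \<theta> a)" .
qed

text \<open>The outer maps commute with every x in G and so pass through each conjugate. This is why
  traces form a two-sided ideal under composition with \<open>G\<close>-homomorphisms.\<close>

lemma rel_trace_comp:
  assumes A: "kG_rep G A" and B: "kG_rep G B" and H: "subgroup H G"
    and \<theta>: "\<theta> \<in> kG_hom (G\<lparr>carrier := H\<rparr>) A B"
    and \<alpha>: "\<alpha> \<in> kG_hom G A' A" and \<beta>: "\<beta> \<in> kG_hom G B B'" and a: "a \<in> carrier A'"
  shows "\<beta> (rel_trace G H A B \<theta> (\<alpha> a)) = rel_trace G H A' B' (\<lambda>x. \<beta> (\<theta> (\<alpha> x))) a"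
proof -
  interpret A: kG_rep G A by fact
  interpret B: kG_rep G B by fact
  have "\<beta> (rel_trace G H A B \<theta> (\<alpha> a)) =
      coset_sum G H (\<lambda>x. \<beta> (act B x (\<theta> (act A (inv\<^bsub>G\<^esub> x) (\<alpha> a)))))"
    unfolding rel_trace_def
    by (rule kG_hom_coset_sum[OF B \<beta> H trace_summand_mem[OF A B \<theta> kG_hom_mem[OF \<alpha> a]]])
  also have "\<dots> = rel_trace G H A' B' (\<lambda>x. \<beta> (\<theta> (\<alpha> x))) a"
    unfolding rel_trace_def
  proof (rule A.coset_sum_cong[OF H])
    fix x assume x: "x \<in> carrier G"
    then have "act A (inv\<^bsub>G\<^esub> x) (\<alpha> a) = \<alpha> (act A' (inv\<^bsub>G\<^esub> x) a)"
      using kG_hom_act[OF \<alpha> _ a] by simp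
    moreover have "\<theta> (act A (inv\<^bsub>G\<^esub> x) (\<alpha> a)) \<in> carrier B"
      using x by (intro kG_hom_mem[OF \<theta>] A.act_closed kG_hom_mem[OF \<alpha> a]) simp
    ultimately show "\<beta> (act B x (\<theta> (act A (inv\<^bsub>G\<^esub> x) (\<alpha> a)))) =
        act B' x (\<beta> (\<theta> (\<alpha> (act A' (inv\<^bsub>G\<^esub> x) a))))"
      using kG_hom_act[OF \<beta> x] by simp
  qed
  finally show ?thesis .
qed

text \<open>The device for moving between modules: with \<open>\<alpha>\<close>,
  \<open>\<beta>\<close> the inclusion and projection of a retract and \<open>f\<close> the
  identity, it puts the identity of the retract into its trace ideal.\<close>

lemma trace_ideal_comp:
  assumes A: "kG_rep G A" and B: "kG_rep G B" and F: "\<And>Q. Q \<in> F \<Longrightarrow> subgroup Q G"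
    and f: "f \<in> trace_ideal G F A B"
    and \<alpha>: "\<alpha> \<in> kG_hom G A' A" and \<beta>: "\<beta> \<in> kG_hom G B B'"
  shows "(\<lambda>x. \<beta> (f (\<alpha> x))) \<in> trace_ideal G F A' B'"
proof -
  obtain \<theta> where \<theta>: "\<And>Q. Q \<in> F \<Longrightarrow> \<theta> Q \<in> kG_hom (G\<lparr>carrier := Q\<rparr>) A B"
    and f: "\<And>a. a \<in> carrier A \<Longrightarrow> f a = (\<Sum>Q\<in>F. rel_trace G Q A B (\<theta> Q) a)"
    by (rule trace_idealE[OF f]) (rule that; simp)
  show ?thesis
  proof (rule trace_idealI[where \<theta> = "\<lambda>Q x. \<beta> (\<theta> Q (\<alpha> x))"])
    fix Q assume Q: "Q \<in> F"
    have "Q \<subseteq> carrier G" using F[OF Q] by (rule subgroup.subset)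
    then have \<alpha>Q: "\<alpha> \<in> kG_hom (G\<lparr>carrier := Q\<rparr>) A' A" and \<beta>Q: "\<beta> \<in> kG_hom (G\<lparr>carrier := Q\<rparr>) B B'"
      using kG_hom_restrict[OF \<alpha>] kG_hom_restrict[OF \<beta>] by blast+
    show "(\<lambda>x. \<beta> (\<theta> Q (\<alpha> x))) \<in> kG_hom (G\<lparr>carrier := Q\<rparr>) A' B'"
      by (rule kG_hom_comp[OF kG_hom_comp[OF \<alpha>Q \<theta>[OF Q]] \<beta>Q])
  next
    fix a assume a: "a \<in> carrier A'"
    have "\<beta> (f (\<alpha> a)) = (\<Sum>Q\<in>F. \<beta> (rel_trace G Q A B (\<theta> Q) (\<alpha> a)))"
      unfolding f[OF kG_hom_mem[OF \<alpha> a]]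
    proof (rule kG_hom_sum[OF B \<beta>])
      show "rel_trace G Q A B (\<theta> Q) (\<alpha> a) \<in> carrier B" if "Q \<in> F" for Q
        by (rule kG_hom_mem[OF rel_trace_hom[OF A B F[OF that] \<theta>[OF that]] kG_hom_mem[OF \<alpha> a]])
    qed
    also have "\<dots> = (\<Sum>Q\<in>F. rel_trace G Q A' B' (\<lambda>x. \<beta> (\<theta> Q (\<alpha> x))) a)"
      by (rule sum.cong[OF refl]) (rule rel_trace_comp[OF A B F \<theta> \<alpha> \<beta> a])
    finally show "\<beta> (f (\<alpha> a)) = (\<Sum>Q\<in>F. rel_trace G Q A' B' (\<lambda>x. \<beta> (\<theta> Q (\<alpha> x))) a)" .
  qed
qed

lemma trace_ideal_add:
  assumes A: "kG_rep G A" and B: "kG_rep G B" and F: "\<And>Q. Q \<in> F \<Longrightarrow> subgroup Q G"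
    and f: "f \<in> trace_ideal G F A B" and f': "f' \<in> trace_ideal G F A B"
  shows "(\<lambda>x. f x + f' x) \<in> trace_ideal G F A B"
proof -
  interpret A: kG_rep G A by fact
  interpret B: kG_rep G B by fact
  obtain \<theta> where \<theta>: "\<And>Q. Q \<in> F \<Longrightarrow> \<theta> Q \<in> kG_hom (G\<lparr>carrier := Q\<rparr>) A B"
    and f: "\<And>a. a \<in> carrier A \<Longrightarrow> f a = (\<Sum>Q\<in>F. rel_trace G Q A B (\<theta> Q) a)"
    by (rule trace_idealE[OF f]) (rule that; simp)
  obtain \<theta>' where \<theta>': "\<And>Q. Q \<in> F \<Longrightarrow> \<theta>' Q \<in> kG_hom (G\<lparr>carrier := Q\<rparr>) A B"
    and f': "\<And>a. a \<in> carrier A \<Longrightarrow> f' a = (\<Sum>Q\<in>F. rel_trace G Q A B (\<theta>' Q) a)"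
    by (rule trace_idealE[OF f']) (rule that; simp)
  show ?thesis
  proof (rule trace_idealI[where \<theta> = "\<lambda>Q x. \<theta> Q x + \<theta>' Q x"])
    show "(\<lambda>x. \<theta> Q x + \<theta>' Q x) \<in> kG_hom (G\<lparr>carrier := Q\<rparr>) A B" if "Q \<in> F" for Q
      by (rule kG_hom_add_map[OF B.kG_rep_restrict[OF F[OF that]] \<theta>[OF that] \<theta>'[OF that]])
  next
    fix a assume a: "a \<in> carrier A"
    have "rel_trace G Q A B (\<theta> Q) a + rel_trace G Q A B (\<theta>' Q) a =
        rel_trace G Q A B (\<lambda>x. \<theta> Q x + \<theta>' Q x) a" if Q: "Q \<in> F" for Q
    proof -
      have "act B x (\<theta> Q (act A (inv\<^bsub>G\<^esub> x) a) + \<theta>' Q (act A (inv\<^bsub>G\<^esub> x) a)) =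
          act B x (\<theta> Q (act A (inv\<^bsub>G\<^esub> x) a)) + act B x (\<theta>' Q (act A (inv\<^bsub>G\<^esub> x) a))"
        if "x \<in> carrier G" for x
        using that a by (intro B.act_add kG_hom_mem[OF \<theta>[OF Q]] kG_hom_mem[OF \<theta>'[OF Q]] A.act_closed) auto
      then have "rel_trace G Q A B (\<lambda>x. \<theta> Q x + \<theta>' Q x) a = coset_sum G Q (\<lambda>x.
          act B x (\<theta> Q (act A (inv\<^bsub>G\<^esub> x) a)) + act B x (\<theta>' Q (act A (inv\<^bsub>G\<^esub> x) a)))"
        unfolding rel_trace_def by (rule A.coset_sum_cong[OF F[OF Q]])
      then show ?thesis unfolding rel_trace_def coset_sum_def by (simp add: sum.distrib)
    qed
    then show "f a + f' a = (\<Sum>Q\<in>F. rel_trace G Q A B (\<lambda>x. \<theta> Q x + \<theta>' Q x) a)"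
      using f[OF a] f'[OF a] by (simp add: sum.distrib[symmetric])
  qed
qed

lemma rel_trace_zero:
  assumes "kG_rep G B" "subgroup H G"
  shows "rel_trace G H A B (\<lambda>x. 0) a = 0"
proof -
  interpret B: kG_rep G B by fact
  have "rel_trace G H A B (\<lambda>x. 0) a = coset_sum G H (\<lambda>x. 0)"
    unfolding rel_trace_def by (rule B.coset_sum_cong[OF assms(2)]) (rule B.act_zero)
  then show ?thesis by (simp add: coset_sum_def)
qed

lemma rel_trace_mem_trace_ideal:
  assumes A: "kG_rep G A" and B: "kG_rep G B" and F: "\<And>R. R \<in> F \<Longrightarrow> subgroup R G" "finite F"
    and Q: "Q \<in> F" and \<theta>: "\<theta> \<in> kG_hom (G\<lparr>carrier := Q\<rparr>) A B"
  shows "rel_trace G Q A B \<theta> \<in> trace_ideal G F A B"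
proof -
  interpret A: kG_rep G A by fact
  interpret B: kG_rep G B by fact
  show ?thesis
  \<comment> \<open>Padding by zero: the members of \<open>F\<close> other than \<open>Q\<close>
    contribute the trace of the zero map.\<close>
  proof (rule trace_idealI[where \<theta> = "\<lambda>R. if R = Q then \<theta> else (\<lambda>x. 0)"])
    show "(if R = Q then \<theta> else (\<lambda>x. 0)) \<in> kG_hom (G\<lparr>carrier := R\<rparr>) A B" if "R \<in> F" for R
    proof (cases "R = Q")
      case True
      then show ?thesis using \<theta> by (simp only: if_True simp_thms)
    next
      case False
      then show ?thesis
        by (simp only: if_False) (rule kG_hom_zero_map[OF B.kG_rep_restrict[OF F(1)[OF that]]])
    qed
    have zero: "rel_trace G R A B (\<lambda>x. 0) a = 0" if "R \<in> F" for R a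
      by (rule rel_trace_zero[OF B F(1)[OF that]])
    show "rel_trace G Q A B \<theta> a =
        (\<Sum>R\<in>F. rel_trace G R A B (if R = Q then \<theta> else (\<lambda>x. 0)) a)" for a
    proof -
      have "(\<Sum>R\<in>F. rel_trace G R A B (if R = Q then \<theta> else (\<lambda>x. 0)) a) =
          (\<Sum>R\<in>F. if R = Q then rel_trace G Q A B \<theta> a else 0)"
        by (intro sum.cong refl) (auto simp: zero)
      then show ?thesis using Q F(2) by simp
    qed
  qed
qed

lemma trace_ideal_zero:
  assumes "kG_rep G A" "kG_rep G B" "\<And>R. R \<in> F \<Longrightarrow> subgroup R G"
  shows "(\<lambda>x. 0) \<in> trace_ideal G F A B"
proof (rule trace_idealI[where \<theta> = "\<lambda>R x. 0"])
  interpret B: kG_rep G B by fact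
  show "(\<lambda>x. 0) \<in> kG_hom (G\<lparr>carrier := R\<rparr>) A B" if "R \<in> F" for R
    by (rule kG_hom_zero_map[OF B.kG_rep_restrict[OF assms(3)[OF that]]])
  show "0 = (\<Sum>R\<in>F. rel_trace G R A B (\<lambda>x. 0) a)" for a
    using rel_trace_zero[OF assms(2,3)] by (metis (mono_tags, lifting) sum.neutral)
qed

text \<open>Take \<eta> = g \<theta> g^-1, which commutes with K = g H g^-1. The summand of \<eta>
  at x is the summand of \<theta> at xg, and \<open>coset_sum_conj\<close> matches the two
  sums.\<close>

lemma rel_trace_conj:
  assumes A: "kG_rep G A" and H: "subgroup H G" and g: "g \<in> carrier G"
    and \<theta>: "\<theta> \<in> kG_hom (G\<lparr>carrier := H\<rparr>) A A"
  defines "K \<equiv> (\<lambda>h. g \<otimes>\<^bsub>G\<^esub> h \<otimes>\<^bsub>G\<^esub> inv\<^bsub>G\<^esub> g) ` H"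
  shows "\<exists>\<eta>\<in>kG_hom (G\<lparr>carrier := K\<rparr>) A A. \<forall>a\<in>carrier A. rel_trace G K A A \<eta> a = rel_trace G H A A \<theta> a"
proof -
  interpret kG_rep G A by fact
  have HG: "H \<subseteq> carrier G" using H by (rule subgroup.subset)
  have K: "subgroup K G" unfolding K_def by (rule conj_subgroup[OF H g])
  define \<eta> where "\<eta> a = act A g (\<theta> (act A (inv\<^bsub>G\<^esub> g) a))" for a
  have ig: "inv\<^bsub>G\<^esub> g \<in> carrier G" using g by simp
  note c = act_closed[OF ig] kG_hom_mem[OF \<theta>] act_closed[OF g]
  have \<eta>: "\<eta> \<in> kG_hom (G\<lparr>carrier := K\<rparr>) A A"
  proof (rule kG_homI)
    fix a assume a: "a \<in> carrier A"
    show "\<eta> a \<in> carrier A" unfolding \<eta>_def using a c by blast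
    show "\<eta> (scal A r a) = scal A r (\<eta> a)" for r
      unfolding \<eta>_def using a c by (simp add: act_scal[OF ig] act_scal[OF g] kG_homD[OF \<theta>])
    show "\<eta> (a + b) = \<eta> a + \<eta> b" if "b \<in> carrier A" for b
      unfolding \<eta>_def using a c that by (simp add: act_add[OF ig] act_add[OF g] kG_homD[OF \<theta>])
    fix x assume "x \<in> carrier (G\<lparr>carrier := K\<rparr>)"
    then obtain h where h: "h \<in> H" "x = g \<otimes>\<^bsub>G\<^esub> h \<otimes>\<^bsub>G\<^esub> inv\<^bsub>G\<^esub> g" unfolding K_def by auto
    have hc: "h \<in> carrier G" using h HG by blast
    have "act A x a = act A g (act A h (act A (inv\<^bsub>G\<^esub> g) a))" if "a \<in> carrier A" for a
      using that h(2) hc g ig c by (simp add: act_mult act_closed)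
    then have "act A (inv\<^bsub>G\<^esub> g) (act A x a) = act A h (act A (inv\<^bsub>G\<^esub> g) a)"
      and "act A x (\<eta> a) = act A g (act A h (\<theta> (act A (inv\<^bsub>G\<^esub> g) a)))"
      using a hc g ig c unfolding \<eta>_def by (simp_all add: act_inv_cancel act_closed)
    then show "\<eta> (act A x a) = act A x (\<eta> a)"
      unfolding \<eta>_def using kG_hom_act[OF \<theta>, of h] h(1) c(1)[OF a] by simp
  qed
  moreover have "rel_trace G K A A \<eta> a = rel_trace G H A A \<theta> a" if a: "a \<in> carrier A" for a
  proof -
    have "act A x (\<eta> (act A (inv\<^bsub>G\<^esub> x) a)) =
        act A (x \<otimes>\<^bsub>G\<^esub> g) (\<theta> (act A (inv\<^bsub>G\<^esub> (x \<otimes>\<^bsub>G\<^esub> g)) a))" if x: "x \<in> carrier G" for x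
      unfolding \<eta>_def using x g ig a by (simp add: act_mult inv_mult_group act_closed kG_hom_mem[OF \<theta>])
    then have "rel_trace G K A A \<eta> a = coset_sum G K (\<lambda>x.
        act A (x \<otimes>\<^bsub>G\<^esub> g) (\<theta> (act A (inv\<^bsub>G\<^esub> (x \<otimes>\<^bsub>G\<^esub> g)) a)))"
      unfolding rel_trace_def by (rule coset_sum_cong[OF K])
    also have "\<dots> = rel_trace G H A A \<theta> a"
      unfolding rel_trace_def K_def
      by (rule coset_sum_conj[OF H trace_summand_invariant[OF A A H \<theta> a] g])
    finally show ?thesis .
  qed
  ultimately show ?thesis by blast
qed

section \<open>Hom spaces\<close>

text \<open>A group record with empty carrier imposes no equivariance, so
  \<open>kG_hom (G\<lparr>carrier := {}\<rparr>) A B\<close> consists of the linear maps and the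
  facts about \<open>kG_hom\<close> apply to them. Extension by zero makes equality on
  \<open>carrier A\<close> an equality of functions.\<close>

definition Hom_mod ::
  "'g monoid \<Rightarrow> ('g, 'k::field, 'v::ab_group_add) kG_mod \<Rightarrow>
   ('g, 'k, 'w::ab_group_add) kG_mod \<Rightarrow> ('g, 'k, 'v \<Rightarrow> 'w) kG_mod" where
  "Hom_mod G A B = \<lparr>carrier = {f \<in> kG_hom (G\<lparr>carrier := {}\<rparr>) A B. \<forall>v. v \<notin> carrier A \<longrightarrow> f v = 0},
     scal = (\<lambda>c f v. scal B c (f v)),
     act = (\<lambda>g f v. if v \<in> carrier A then act B g (f (act A (inv\<^bsub>G\<^esub> g) v)) else 0)\<rparr>"

lemma End_mod_eq_Hom_mod: "End_mod G M = Hom_mod G M M"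
  by (auto simp: End_mod_def Hom_mod_def kG_hom_def image_subset_iff)

definition zero_ext :: "('g, 'k, 'v) kG_mod \<Rightarrow> ('v \<Rightarrow> 'w::zero) \<Rightarrow> 'v \<Rightarrow> 'w" where
  "zero_ext A f v = (if v \<in> carrier A then f v else 0)"

lemma zero_ext_apply [simp]:
  "v \<in> carrier A \<Longrightarrow> zero_ext A f v = f v" "v \<notin> carrier A \<Longrightarrow> zero_ext A f v = 0"
  by (simp_all add: zero_ext_def)

lemma Hom_mod_sel [simp]:
  "scal (Hom_mod G A B) c f = (\<lambda>v. scal B c (f v))"
  "act (Hom_mod G A B) g f = zero_ext A (\<lambda>v. act B g (f (act A (inv\<^bsub>G\<^esub> g) v)))"
  by (simp_all add: Hom_mod_def zero_ext_def fun_eq_iff)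

lemma Hom_mod_outside: "f \<in> carrier (Hom_mod G A B) \<Longrightarrow> v \<notin> carrier A \<Longrightarrow> f v = 0"
  by (simp add: Hom_mod_def)

lemma Hom_mod_hom: "f \<in> carrier (Hom_mod G A B) \<Longrightarrow> f \<in> kG_hom (G\<lparr>carrier := {}\<rparr>) A B"
  by (simp add: Hom_mod_def)

lemma Hom_mod_eqI:
  assumes "f \<in> carrier (Hom_mod G A B)" "f' \<in> carrier (Hom_mod G A B)"
    "\<And>v. v \<in> carrier A \<Longrightarrow> f v = f' v"
  shows "f = f'"
  using assms Hom_mod_outside by (metis ext)

lemma zero_ext_mem_Hom_mod:
  assumes "kG_rep G A" "f \<in> kG_hom L A B"
  shows "zero_ext A f \<in> carrier (Hom_mod G A B)"
proof -
  interpret A: kG_rep G A by fact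
  show ?thesis
    using kG_homD[OF assms(2)] unfolding Hom_mod_def
    by (auto intro!: kG_homI simp: A.add_mem A.scal_mem)
qed

text \<open>Conjugation by g fixes f as soon as f commutes with the inverse of g, so
  \<open>L\<close> may be \<open>G\<close> or a subgroup. Together with
  \<open>Hom_mod_fixed_hom\<close> this identifies fixed points of Hom(A, B) with
  homomorphisms.\<close>

lemma zero_ext_fixed:
  assumes A: "kG_rep G A" and B: "kG_rep G B" and g: "g \<in> carrier G"
    and f: "f \<in> kG_hom L A B" and gL: "inv\<^bsub>G\<^esub> g \<in> carrier L"
  shows "act (Hom_mod G A B) g (zero_ext A f) = zero_ext A f"
proof
  interpret A: kG_rep G A by fact
  interpret B: kG_rep G B by fact
  have ig: "inv\<^bsub>G\<^esub> g \<in> carrier G" using g by simp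
  show "act (Hom_mod G A B) g (zero_ext A f) v = zero_ext A f v" for v
    using kG_hom_act[OF f gL, of v] g A.act_closed[OF ig] kG_hom_mem[OF f]
    by (cases "v \<in> carrier A") (simp_all add: B.act_inv_cancel)
qed

lemma Hom_mod_fixed_hom:
  assumes A: "kG_rep G A" and B: "kG_rep G B" and f: "f \<in> carrier (Hom_mod G A B)"
    and L: "carrier L \<subseteq> carrier G" "\<And>g. g \<in> carrier L \<Longrightarrow> act (Hom_mod G A B) g f = f"
  shows "f \<in> kG_hom L A B"
proof -
  interpret A: kG_rep G A by fact
  have "f (act A g v) = act B g (f v)" if "g \<in> carrier L" "v \<in> carrier A" for g v
  proof -
    have g: "g \<in> carrier G" using that L by blast
    have "f (act A g v) = act (Hom_mod G A B) g f (act A g v)" using L(2)[OF that(1)] by simp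
    then show ?thesis using that(2) g by (simp add: A.act_closed A.act_inv_cancel)
  qed
  then show ?thesis using kG_homD[OF Hom_mod_hom[OF f]] by (auto intro!: kG_homI)
qed

lemma kG_rep_Hom_mod:
  assumes A: "kG_rep G A" and B: "kG_rep G B"
  shows "kG_rep G (Hom_mod G A B)"
proof -
  interpret A: kG_rep G A by fact
  interpret B: kG_rep G B by fact
  have vs: "vector_space (scal (Hom_mod G A B))"
    by unfold_locales (simp_all add: fun_eq_iff B.scale_right_distrib B.scale_left_distrib)
  have zero: "0 \<in> carrier (Hom_mod G A B)"
    unfolding Hom_mod_def by (auto intro!: kG_homI simp: B.zero_mem)
  have scal: "scal (Hom_mod G A B) c f \<in> carrier (Hom_mod G A B)"
    if f: "f \<in> carrier (Hom_mod G A B)" for c f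
  proof -
    have "(\<lambda>v. scal B c (f v)) \<in> kG_hom (G\<lparr>carrier := {}\<rparr>) A B"
      by (rule kG_homI)
        (simp_all add: kG_homD[OF Hom_mod_hom[OF f]] B.scal_mem B.scale_right_distrib mult.commute)
    then show ?thesis using Hom_mod_outside[OF f] by (simp add: Hom_mod_def)
  qed
  have add: "f + h \<in> carrier (Hom_mod G A B)"
    if f: "f \<in> carrier (Hom_mod G A B)" and h: "h \<in> carrier (Hom_mod G A B)" for f h
  proof -
    have "f + h \<in> kG_hom (G\<lparr>carrier := {}\<rparr>) A B"
      by (rule kG_homI) (simp_all add: kG_homD[OF Hom_mod_hom[OF f]] kG_homD[OF Hom_mod_hom[OF h]]
          B.add_mem B.scale_right_distrib add_ac)
    then show ?thesis using Hom_mod_outside[OF f] Hom_mod_outside[OF h] by (simp add: Hom_mod_def)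
  qed
  have sub: "module.subspace (scal (Hom_mod G A B)) (carrier (Hom_mod G A B))"
    using zero add scal unfolding module.subspace_def[OF vs[folded module_iff_vector_space]] by blast
  have cl: "act (Hom_mod G A B) g f \<in> carrier (Hom_mod G A B)"
    if g: "g \<in> carrier G" and f: "f \<in> carrier (Hom_mod G A B)" for g f
  proof -
    note f = kG_homD[OF Hom_mod_hom[OF f]]
    have ig: "inv\<^bsub>G\<^esub> g \<in> carrier G" using g by simp
    have "(\<lambda>v. act B g (f (act A (inv\<^bsub>G\<^esub> g) v))) \<in> kG_hom (G\<lparr>carrier := {}\<rparr>) A B"
      using g ig by (intro kG_homI) (simp_all add: B.act_closed f A.act_closed A.act_add A.act_scal
          B.act_add B.act_scal)
    then show ?thesis unfolding Hom_mod_sel by (rule zero_ext_mem_Hom_mod[OF A])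
  qed
  have mem: "f (act A (inv\<^bsub>G\<^esub> g) v) \<in> carrier B"
    if "g \<in> carrier G" "v \<in> carrier A" "f \<in> carrier (Hom_mod G A B)" for f g v
    using that by (intro kG_hom_mem[OF Hom_mod_hom[OF that(3)]] A.act_closed) auto
  show ?thesis
    unfolding kG_rep_def kG_rep_axioms_def
  proof (intro conjI allI impI)
    show "Group.group G" by (rule A.is_group)
    show "act (Hom_mod G A B) \<one>\<^bsub>G\<^esub> f = f" if f: "f \<in> carrier (Hom_mod G A B)" for f
    proof
      fix v show "act (Hom_mod G A B) \<one>\<^bsub>G\<^esub> f v = f v"
        using Hom_mod_outside[OF f] kG_hom_mem[OF Hom_mod_hom[OF f]]
        by (cases "v \<in> carrier A") (simp_all add: A.act_one B.act_one)
    qed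
    fix g f assume g: "g \<in> carrier G" and f: "f \<in> carrier (Hom_mod G A B)"
    show "act (Hom_mod G A B) g (scal (Hom_mod G A B) c f) =
        scal (Hom_mod G A B) c (act (Hom_mod G A B) g f)" for c
      using g mem[OF g _ f] by (auto simp: fun_eq_iff zero_ext_def B.act_scal)
    show "act (Hom_mod G A B) g (f + h) = act (Hom_mod G A B) g f + act (Hom_mod G A B) g h"
      if h: "h \<in> carrier (Hom_mod G A B)" for h
      using g mem[OF g _ f] mem[OF g _ h] by (auto simp: fun_eq_iff zero_ext_def B.act_add)
    show "act (Hom_mod G A B) (g \<otimes>\<^bsub>G\<^esub> h) f = act (Hom_mod G A B) g (act (Hom_mod G A B) h f)"
      if h: "h \<in> carrier G" for h
      using g h f kG_hom_mem[OF Hom_mod_hom[OF f]]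
      by (auto simp: fun_eq_iff zero_ext_def B.act_mult A.act_mult A.inv_mult_group A.act_closed)
  qed (use vs sub cl in auto)
qed

section \<open>Trace ideals of Hom spaces\<close>

lemma sum_fun_apply: "(sum f I) x = (\<Sum>i\<in>I. f i x)"
  by (induction I rule: infinite_finite_induct) simp_all

lemma coset_sum_fun_apply: "coset_sum G H F x = coset_sum G H (\<lambda>g. F g x)"
  by (simp add: coset_sum_def sum_fun_apply)

text \<open>If \<open>id\<close> lies in the trace ideal of \<open>X\<close>, precomposition with the \<open>\<theta>\<close> realises \<open>id\<close> on \<open>Hom(X, Y)\<close>.\<close>

lemma trace_ideal_Hom_mod:
  assumes X: "kG_rep G X" and Y: "kG_rep G Y" and F: "\<And>Q. Q \<in> F \<Longrightarrow> subgroup Q G"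
    and id: "(\<lambda>x. x) \<in> trace_ideal G F X X"
  shows "(\<lambda>z. z) \<in> trace_ideal G F (Hom_mod G X Y) (Hom_mod G X Y)"
proof -
  interpret X: kG_rep G X by fact
  interpret Y: kG_rep G Y by fact
  interpret E: kG_rep G "Hom_mod G X Y" by (rule kG_rep_Hom_mod[OF X Y])
  obtain \<theta> where \<theta>: "\<And>Q. Q \<in> F \<Longrightarrow> \<theta> Q \<in> kG_hom (G\<lparr>carrier := Q\<rparr>) X X"
    and id: "\<And>x. x \<in> carrier X \<Longrightarrow> x = (\<Sum>Q\<in>F. rel_trace G Q X X (\<theta> Q) x)"
    using id unfolding trace_ideal_def by blast
  show ?thesis
  proof (rule trace_idealI[where \<theta> = "\<lambda>Q z. zero_ext X (\<lambda>x. z (\<theta> Q x))"])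
    fix Q assume Q: "Q \<in> F"
    note \<theta>Q = kG_homD[OF \<theta>[OF Q]]
    show "(\<lambda>z. zero_ext X (\<lambda>x. z (\<theta> Q x))) \<in> kG_hom (G\<lparr>carrier := Q\<rparr>) (Hom_mod G X Y) (Hom_mod G X Y)"
    proof (rule kG_homI)
      fix z assume z: "z \<in> carrier (Hom_mod G X Y)"
      note zz = kG_homD[OF Hom_mod_hom[OF z]]
      have "(\<lambda>x. z (\<theta> Q x)) \<in> kG_hom (G\<lparr>carrier := {}\<rparr>) X Y"
        by (rule kG_homI) (simp_all add: zz \<theta>Q)
      then show "zero_ext X (\<lambda>x. z (\<theta> Q x)) \<in> carrier (Hom_mod G X Y)"
        by (rule zero_ext_mem_Hom_mod[OF X])
      show "zero_ext X (\<lambda>x. (z + w) (\<theta> Q x)) = zero_ext X (\<lambda>x. z (\<theta> Q x)) + zero_ext X (\<lambda>x. w (\<theta> Q x))" for w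
        by (auto simp: fun_eq_iff zero_ext_def)
      show "zero_ext X (\<lambda>x. (scal (Hom_mod G X Y) c z) (\<theta> Q x)) =
          scal (Hom_mod G X Y) c (zero_ext X (\<lambda>x. z (\<theta> Q x)))" for c
        by (auto simp: fun_eq_iff zero_ext_def)
      fix g assume "g \<in> carrier (G\<lparr>carrier := Q\<rparr>)"
      then have g: "g \<in> carrier G" and ig: "inv\<^bsub>G\<^esub> g \<in> Q"
        using subgroup.mem_carrier[OF F[OF Q]] subgroup.m_inv_closed[OF F[OF Q]] by auto
      show "zero_ext X (\<lambda>x. (act (Hom_mod G X Y) g z) (\<theta> Q x)) =
          act (Hom_mod G X Y) g (zero_ext X (\<lambda>x. z (\<theta> Q x)))"
        using g ig \<theta>Q by (auto simp: fun_eq_iff zero_ext_def X.act_closed)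
    qed
  next
    fix z assume z: "z \<in> carrier (Hom_mod G X Y)"
    note zz = kG_homD[OF Hom_mod_hom[OF z]]
    show "z = (\<Sum>Q\<in>F. rel_trace G Q (Hom_mod G X Y) (Hom_mod G X Y) (\<lambda>z. zero_ext X (\<lambda>x. z (\<theta> Q x))) z)"
      (is "_ = (\<Sum>Q\<in>F. ?T Q)")
    proof
      fix x
      show "z x = (\<Sum>Q\<in>F. ?T Q) x"
      proof (cases "x \<in> carrier X")
        case True
        \<comment> \<open>\<open>z\<close> is only linear, so \<open>rel_trace_comp\<close> does not
          apply; additivity takes \<open>z\<close> inside the sums, and the twists by g are compared
          one by one.\<close>
        have "z x = (\<Sum>Q\<in>F. z (rel_trace G Q X X (\<theta> Q) x))"
        proof (subst id[OF True], rule kG_hom_sum[OF X Hom_mod_hom[OF z]])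
          show "rel_trace G Q X X (\<theta> Q) x \<in> carrier X" if "Q \<in> F" for Q
            by (rule kG_hom_mem[OF rel_trace_hom[OF X X F[OF that] \<theta>[OF that]] True])
        qed
        also have "\<dots> = (\<Sum>Q\<in>F. ?T Q x)"
        proof (intro sum.cong refl)
          fix Q assume Q: "Q \<in> F"
          have "z (rel_trace G Q X X (\<theta> Q) x) =
              coset_sum G Q (\<lambda>g. z (act X g (\<theta> Q (act X (inv\<^bsub>G\<^esub> g) x))))"
            unfolding rel_trace_def
            by (intro kG_hom_coset_sum[OF X Hom_mod_hom[OF z] F[OF Q]]
                trace_summand_mem[OF X X \<theta>[OF Q]] True)
          also have "\<dots> = ?T Q x"
            unfolding rel_trace_def coset_sum_fun_apply
          proof (rule X.coset_sum_cong[OF F[OF Q]])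
            \<comment> \<open>On the right, g acts on Y from outside, while the action of g^-1 on z
              brings in g^-1 on Y and g on X. The two actions on Y cancel, leaving z composed with g
              \<theta> g^-1.\<close>
            fix g assume g: "g \<in> carrier G"
            have "\<theta> Q (act X (inv\<^bsub>G\<^esub> g) x) \<in> carrier X"
              using g True by (intro kG_hom_mem[OF \<theta>[OF Q]] X.act_closed) auto
            then show "z (act X g (\<theta> Q (act X (inv\<^bsub>G\<^esub> g) x))) =
                act (Hom_mod G X Y) g (zero_ext X (\<lambda>x. act (Hom_mod G X Y) (inv\<^bsub>G\<^esub> g) z (\<theta> Q x))) x"
              using g True by (simp add: X.act_closed zz Y.act_inv_cancel)
          qed
          finally show "z (rel_trace G Q X X (\<theta> Q) x) = ?T Q x" .
        qed
        finally show ?thesis by (simp add: sum_fun_apply)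
      next
        case False
        then have "?T Q x = 0" for Q
          unfolding rel_trace_def coset_sum_def by (simp add: sum_fun_apply)
        then show ?thesis using False Hom_mod_outside[OF z] by (simp add: sum_fun_apply)
      qed
    qed
  qed
qed

text \<open>Evaluate the expression of the identity as a sum of traces at the fixed point e given by
  f. Since g^-1 e = e, the trace of \<open>\<theta> Q\<close> evaluated at e is the trace of the map
  \<open>\<theta> Q e\<close>, which is fixed by Q and hence a Q-homomorphism from U to V.\<close>

lemma trace_ideal_of_fixed:
  assumes U: "kG_rep G U" and V: "kG_rep G V" and F: "\<And>Q. Q \<in> F \<Longrightarrow> subgroup Q G"
    and id: "(\<lambda>x. x) \<in> trace_ideal G F (Hom_mod G U V) (Hom_mod G U V)"
    and f: "f \<in> kG_hom G U V"
  shows "f \<in> trace_ideal G F U V"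
proof -
  interpret U: kG_rep G U by fact
  interpret V: kG_rep G V by fact
  define X where "X = Hom_mod G U V"
  have X: "kG_rep G X" unfolding X_def by (rule kG_rep_Hom_mod[OF U V])
  interpret X: kG_rep G X by (rule X)
  define e where "e = zero_ext U f"
  have e: "e \<in> carrier X" unfolding e_def X_def by (rule zero_ext_mem_Hom_mod[OF U f])
  have fix_e: "act X g e = e" if "g \<in> carrier G" for g
    unfolding e_def X_def using that by (intro zero_ext_fixed[OF U V that f]) simp
  obtain \<theta> where \<theta>: "\<And>Q. Q \<in> F \<Longrightarrow> \<theta> Q \<in> kG_hom (G\<lparr>carrier := Q\<rparr>) X X"
    and id: "\<And>x. x \<in> carrier X \<Longrightarrow> x = (\<Sum>Q\<in>F. rel_trace G Q X X (\<theta> Q) x)"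
    using id unfolding trace_ideal_def X_def by blast
  show ?thesis
  proof (rule trace_idealI[where \<theta> = "\<lambda>Q. \<theta> Q e"])
    fix Q assume Q: "Q \<in> F"
    have QG: "Q \<subseteq> carrier G" using F[OF Q] by (rule subgroup.subset)
    have "act X g (\<theta> Q e) = \<theta> Q e" if "g \<in> Q" for g
      using kG_hom_act[OF \<theta>[OF Q], of g e] fix_e[of g] that QG e by auto
    then show "\<theta> Q e \<in> kG_hom (G\<lparr>carrier := Q\<rparr>) U V"
      using QG kG_hom_mem[OF \<theta>[OF Q] e] unfolding X_def by (intro Hom_mod_fixed_hom[OF U V]) auto
  next
    fix u assume u: "u \<in> carrier U"
    have "f u = e u" using u by (simp add: e_def)
    also have "\<dots> = (\<Sum>Q\<in>F. rel_trace G Q X X (\<theta> Q) e u)"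
      by (subst id[OF e]) (simp add: sum_fun_apply)
    also have "\<dots> = (\<Sum>Q\<in>F. rel_trace G Q U V (\<theta> Q e) u)"
    proof (intro sum.cong refl)
      fix Q assume Q: "Q \<in> F"
      show "rel_trace G Q X X (\<theta> Q) e u = rel_trace G Q U V (\<theta> Q e) u"
        unfolding rel_trace_def coset_sum_fun_apply
        by (rule U.coset_sum_cong[OF F[OF Q]]) (simp add: fix_e, simp add: X_def u)
    qed
    finally show "f u = (\<Sum>Q\<in>F. rel_trace G Q U V (\<theta> Q e) u)" .
  qed
qed

section \<open>Finite dimension and submodules\<close>

context vector_space
begin

lemma finite_basis_within:
  assumes "subspace A" "A \<subseteq> span T" "finite T" "independent C" "C \<subseteq> A"
  shows "\<exists>B. C \<subseteq> B \<and> B \<subseteq> A \<and> finite B \<and> independent B \<and> span B = A"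
proof -
  obtain B where B: "C \<subseteq> B" "B \<subseteq> A" "independent B" "A \<subseteq> span B"
    using maximal_independent_subset_extend[OF assms(5,4)] by blast
  moreover have "finite B"
    using independent_span_bound[OF assms(3) B(3)] B(2) assms(2) by blast
  moreover have "span B = A" using span_subspace[OF B(2,4) assms(1)] .
  ultimately show ?thesis by blast
qed

lemma dim_less_of_psubset:
  assumes "subspace A" "subspace B" "A \<subset> B" "B \<subseteq> span T" "finite T"
  shows "dim A < dim B"
proof -
  have AT: "A \<subseteq> span T" using assms by blast
  obtain C where C: "C \<subseteq> A" "finite C" "independent C" "span C = A"
    using finite_basis_within[OF assms(1) AT assms(5) independent_empty empty_subsetI] by blast
  have CB: "C \<subseteq> B" using C(1) assms(3) by blast
  obtain D where D: "C \<subseteq> D" "D \<subseteq> B" "finite D" "independent D" "span D = B"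
    using finite_basis_within[OF assms(2,4,5) C(3) CB] by blast
  have "C \<subset> D" using C(4) D(1,5) assms(3) by blast
  then have "card C < card D" using D(3) by (simp add: psubset_card_mono)
  then show ?thesis using dim_span_eq_card_independent C D by metis
qed

lemma subspace_eq_of_dim:
  assumes "subspace A" "subspace B" "A \<subseteq> B" "B \<subseteq> span T" "finite T" "dim B \<le> dim A"
  shows "A = B"
  using dim_less_of_psubset[OF assms(1,2) _ assms(4,5)] assms(3,6) by fastforce

end

definition fin_dim :: "('g, 'k::field, 'v::ab_group_add) kG_mod \<Rightarrow> bool" where
  "fin_dim A \<longleftrightarrow> (\<exists>T. finite T \<and> carrier A \<subseteq> module.span (scal A) T)"

text \<open>For finite \<open>G\<close> the translates of finitely many generators form a finite
  spanning set, and conversely a finite basis generates because the unit acts trivially. Finite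
  dimension passes to submodules at once, which is harder to see for generators.\<close>

lemma kG_module_iff:
  assumes "finite (carrier G)"
  shows "kG_module G A \<longleftrightarrow> kG_rep G A \<and> fin_dim A"
proof
  assume "kG_module G A"
  then interpret A: kG_module G A .
  obtain B where B: "finite B" "carrier A = A.span {act A g b |g b. g \<in> carrier G \<and> b \<in> B}"
    using A.finitely_generated by blast
  have "finite {act A g b |g b. g \<in> carrier G \<and> b \<in> B}"
    using assms B(1) by (simp add: finite_image_set2)
  then show "kG_rep G A \<and> fin_dim A"
    using B(2) A.kG_rep_axioms unfolding fin_dim_def by blast
next
  assume A: "kG_rep G A \<and> fin_dim A"
  then interpret A: kG_rep G A by blast
  obtain T where T: "finite T" "carrier A \<subseteq> A.span T" using A unfolding fin_dim_def by blast
  obtain B where B: "B \<subseteq> carrier A" "finite B" "A.span B = carrier A"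
    using A.finite_basis_within[OF A.carrier_subspace T(2,1) A.independent_empty empty_subsetI] by blast
  let ?S = "{act A g b |g b. g \<in> carrier G \<and> b \<in> B}"
  have "?S \<subseteq> carrier A" using B(1) A.act_closed by blast
  then have "A.span ?S \<subseteq> carrier A" using A.span_minimal A.carrier_subspace by blast
  moreover have "B \<subseteq> ?S"
  proof
    fix b assume b: "b \<in> B"
    have "act A \<one>\<^bsub>G\<^esub> b = b" using A.act_one b B(1) by blast
    then have "b = act A \<one>\<^bsub>G\<^esub> b" by simp
    then show "b \<in> ?S" using b A.one_closed by blast
  qed
  ultimately have "carrier A = A.span ?S" using A.span_mono B(3) by blast
  then have "\<exists>B. finite B \<and> B \<subseteq> carrier A \<and>
      carrier A = A.span {act A g b |g b. g \<in> carrier G \<and> b \<in> B}" using B(1,2) by blast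
  then show "kG_module G A"
    unfolding kG_module_def kG_module_axioms_def
    using A.is_group A.vector_space_axioms A.carrier_subspace A.act_closed A.act_add A.act_scal
      A.act_one A.act_mult by blast
qed

section \<open>Submodules, images and kernels\<close>

lemma kG_rep_sub:
  assumes "kG_rep G A" "module.subspace (scal A) N" "N \<subseteq> carrier A"
    "\<And>g v. \<lbrakk>g \<in> carrier G; v \<in> N\<rbrakk> \<Longrightarrow> act A g v \<in> N"
  shows "kG_rep G (A\<lparr>carrier := N\<rparr>)"
proof -
  interpret A: kG_rep G A by fact
  show ?thesis
    unfolding kG_rep_def kG_rep_axioms_def
    using A.is_group A.vector_space_axioms assms(2,3,4) A.act_add A.act_scal A.act_one A.act_mult
    by (simp add: subset_iff)
qed

lemma kG_module_sub:
  assumes "finite (carrier G)" "kG_module G A" "module.subspace (scal A) N" "N \<subseteq> carrier A"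
    "\<And>g v. \<lbrakk>g \<in> carrier G; v \<in> N\<rbrakk> \<Longrightarrow> act A g v \<in> N"
  shows "kG_module G (A\<lparr>carrier := N\<rparr>)"
proof -
  have "kG_rep G A" "fin_dim A" using assms(1,2) kG_module_iff by blast+
  moreover have "fin_dim (A\<lparr>carrier := N\<rparr>)"
    using \<open>fin_dim A\<close> assms(4) unfolding fin_dim_def by auto
  ultimately show ?thesis using kG_rep_sub assms kG_module_iff by blast
qed

lemma subspace_hom_image:
  assumes A: "kG_rep G A" and N: "kG_rep G B" and f: "f \<in> kG_hom L A B"
  shows "module.subspace (scal B) (f ` carrier A)"
proof -
  interpret A: kG_rep G A by fact
  interpret B: kG_rep G B by fact
  show ?thesis
  proof (rule B.subspaceI)
    show "0 \<in> f ` carrier A" using kG_hom_0[OF A f] A.zero_mem by force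
    show "x + y \<in> f ` carrier A" if "x \<in> f ` carrier A" "y \<in> f ` carrier A" for x y
      using that kG_hom_add[OF f] A.add_mem by (metis (no_types, lifting) image_iff)
    show "scal B c x \<in> f ` carrier A" if "x \<in> f ` carrier A" for c x
      using that kG_hom_scal[OF f] A.scal_mem by (metis (no_types, lifting) image_iff)
  qed
qed

lemma subspace_hom_kernel:
  assumes A: "kG_rep G A" and N: "kG_rep G B" and f: "f \<in> kG_hom L A B"
  shows "module.subspace (scal A) {a \<in> carrier A. f a = 0}"
proof -
  interpret A: kG_rep G A by fact
  interpret B: kG_rep G B by fact
  show ?thesis
    by (rule A.subspaceI)
      (auto simp: A.zero_mem A.add_mem A.scal_mem kG_hom_0[OF A f] kG_hom_add[OF f] kG_hom_scal[OF f])
qed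

lemma kG_module_hom_image:
  assumes "finite (carrier G)" "kG_rep G A" "kG_module G B" and f: "f \<in> kG_hom G A B"
  shows "kG_module G (B\<lparr>carrier := f ` carrier A\<rparr>)"
proof (rule kG_module_sub[OF assms(1,3)])
  interpret A: kG_rep G A by fact
  interpret B: kG_module G B by fact
  show "module.subspace (scal B) (f ` carrier A)"
    by (rule subspace_hom_image[OF A.kG_rep_axioms B.kG_rep_axioms f])
  show "f ` carrier A \<subseteq> carrier B" using kG_hom_mem[OF f] by blast
  show "act B g v \<in> f ` carrier A" if "g \<in> carrier G" "v \<in> f ` carrier A" for g v
    using that kG_hom_act[OF f] A.act_closed by (metis (no_types, lifting) image_iff)
qed

lemma kG_module_hom_kernel:
  assumes "finite (carrier G)" "kG_module G A" "kG_rep G B" and f: "f \<in> kG_hom G A B"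
  shows "kG_module G (A\<lparr>carrier := {a \<in> carrier A. f a = 0}\<rparr>)"
proof (rule kG_module_sub[OF assms(1,2)])
  interpret A: kG_module G A by fact
  interpret B: kG_rep G B by fact
  show "module.subspace (scal A) {a \<in> carrier A. f a = 0}"
    by (rule subspace_hom_kernel[OF A.kG_rep_axioms B.kG_rep_axioms f])
  show "act A g v \<in> {a \<in> carrier A. f a = 0}"
    if "g \<in> carrier G" "v \<in> {a \<in> carrier A. f a = 0}" for g v
    using that kG_hom_act[OF f] A.act_closed B.act_zero by auto
qed auto

section \<open>Direct sums, summands and retracts\<close>

lemma kG_sum_sel [simp]:
  "carrier (kG_sum A B) = carrier A \<times> carrier B"
  "scal (kG_sum A B) c x = (scal A c (fst x), scal B c (snd x))"
  "act (kG_sum A B) g x = (act A g (fst x), act B g (snd x))"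
  by (simp_all add: kG_sum_def)

lemma kG_rep_sum:
  assumes "kG_rep G A" "kG_rep G B"
  shows "kG_rep G (kG_sum A B)"
proof -
  interpret A: kG_rep G A by fact
  interpret B: kG_rep G B by fact
  have vs: "vector_space (scal (kG_sum A B))"
    by unfold_locales (simp_all add: A.scale_right_distrib B.scale_right_distrib
        A.scale_left_distrib B.scale_left_distrib)
  have "module.subspace (scal (kG_sum A B)) (carrier (kG_sum A B))"
    unfolding module.subspace_def[OF vs[folded module_iff_vector_space]]
    by (auto simp: A.zero_mem B.zero_mem A.add_mem B.add_mem A.scal_mem B.scal_mem zero_prod_def)
  then show ?thesis
    unfolding kG_rep_def kG_rep_axioms_def
    using A.is_group vs
    by (auto simp: A.act_closed B.act_closed A.act_add B.act_add A.act_scal B.act_scal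
        A.act_one B.act_one A.act_mult B.act_mult)
qed

lemma kG_hom_inv_into:
  assumes A: "kG_rep G A" and f: "f \<in> kG_hom G A B" and b: "bij_betw f (carrier A) (carrier B)"
  shows "inv_into (carrier A) f \<in> kG_hom G B A"
proof (rule kG_homI)
  interpret A: kG_rep G A by fact
  have inj: "inj_on f (carrier A)" and im: "f ` carrier A = carrier B"
    using b unfolding bij_betw_def by blast+
  have r: "f (inv_into (carrier A) f v) = v" and m: "inv_into (carrier A) f v \<in> carrier A"
    if "v \<in> carrier B" for v
    using that im by (simp_all add: f_inv_into_f inv_into_into)
  have eq: "inv_into (carrier A) f (f a) = a" if "a \<in> carrier A" for a
    using inj that by (rule inv_into_f_f)
  fix v assume v: "v \<in> carrier B"
  show "inv_into (carrier A) f v \<in> carrier A" using m[OF v] .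
  show "inv_into (carrier A) f (v + w) = inv_into (carrier A) f v + inv_into (carrier A) f w"
    if w: "w \<in> carrier B" for w
    using eq[OF A.add_mem[OF m[OF v] m[OF w]]] kG_hom_add[OF f m[OF v] m[OF w]] r v w by simp
  show "inv_into (carrier A) f (scal B c v) = scal A c (inv_into (carrier A) f v)" for c
    using eq[OF A.scal_mem[OF m[OF v]], of c] kG_hom_scal[OF f m[OF v], of c] r v by simp
  show "inv_into (carrier A) f (act B g v) = act A g (inv_into (carrier A) f v)"
    if g: "g \<in> carrier G" for g
    using eq[OF A.act_closed[OF g m[OF v]]] kG_hom_act[OF f g m[OF v]] r v by simp
qed

lemma kG_isomorphic_sym: "kG_rep G A \<Longrightarrow> kG_isomorphic G A B \<Longrightarrow> kG_isomorphic G B A"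
  unfolding kG_isomorphic_def using kG_hom_inv_into bij_betw_inv_into by blast

text \<open>A retraction pair is the form in which summands enter compositions and trace ideals; the
  complement and its isomorphism are discarded.\<close>

lemma direct_summand_retract:
  fixes U :: "('g, 'k::field, 'u::ab_group_add) kG_mod" and M :: "('g, 'k, 'v::ab_group_add) kG_mod"
  assumes M: "kG_rep G M" and ds: "direct_summand G U M"
  obtains i q where "i \<in> kG_hom G U M" "q \<in> kG_hom G M U" "\<And>u. u \<in> carrier U \<Longrightarrow> q (i u) = u"
proof -
  obtain N :: "('g, 'k, 'v) kG_mod" and f where UN: "kG_module G U" "kG_module G N"
    and f: "f \<in> kG_hom G M (kG_sum U N)" and b: "bij_betw f (carrier M) (carrier (kG_sum U N))"
    using ds unfolding direct_summand_def kG_isomorphic_def by blast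
  interpret U: kG_module G U by fact
  interpret N: kG_module G N by fact
  let ?f' = "inv_into (carrier M) f"
  have f': "?f' \<in> kG_hom G (kG_sum U N) M" by (rule kG_hom_inv_into[OF M f b])
  have incl: "(\<lambda>u. (u, 0)) \<in> kG_hom G U (kG_sum U N)"
    by (rule kG_homI) (simp_all add: N.zero_mem N.act_zero)
  have proj: "fst \<in> kG_hom G (kG_sum U N) U" by (rule kG_homI) auto
  have "fst (f (?f' (u, 0))) = u" if "u \<in> carrier U" for u
  proof -
    have "(u, 0) \<in> f ` carrier M" using that N.zero_mem b by (simp add: bij_betw_def)
    then show ?thesis by (simp add: f_inv_into_f)
  qed
  then show ?thesis
    using that[OF kG_hom_comp[OF incl f'] kG_hom_comp[OF f proj]] by blast
qed

text \<open>The complement is the kernel of \<open>q\<close>, with m split as i(q m) + (m - i(q m)).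
  Being a submodule of \<open>M\<close>, it lives on the ambient type that
  \<open>direct_summand\<close> prescribes.\<close>

lemma retract_direct_summand:
  fixes U :: "('g, 'k::field, 'u::ab_group_add) kG_mod" and M :: "('g, 'k, 'v::ab_group_add) kG_mod"
  assumes fin: "finite (carrier G)" and U: "kG_module G U" and M: "kG_module G M"
    and i: "i \<in> kG_hom G U M" and q: "q \<in> kG_hom G M U" and qi: "\<And>u. u \<in> carrier U \<Longrightarrow> q (i u) = u"
  shows "direct_summand G U M"
proof -
  interpret U: kG_module G U by fact
  interpret M: kG_module G M by fact
  define N where "N = M\<lparr>carrier := {m \<in> carrier M. q m = 0}\<rparr>"
  have N: "kG_module G N" unfolding N_def by (rule kG_module_hom_kernel[OF fin M U.kG_rep_axioms q])
  define f where "f m = (q m, m - i (q m))" for m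
  have iq: "i (q m) \<in> carrier M" if "m \<in> carrier M" for m
    using that by (intro kG_hom_mem[OF i] kG_hom_mem[OF q])
  have qf: "q (m - i (q m)) = 0" if "m \<in> carrier M" for m
    using that by (simp add: kG_hom_diff[OF M.kG_rep_axioms q] iq qi kG_hom_mem[OF q])
  have "f \<in> kG_hom G M (kG_sum U N)"
  proof (rule kG_homI)
    fix m assume m: "m \<in> carrier M"
    show "f m \<in> carrier (kG_sum U N)"
      using m by (simp add: f_def N_def qf M.diff_mem iq kG_hom_mem[OF q])
    show "f (m + m') = f m + f m'" if "m' \<in> carrier M" for m'
      using m that by (simp add: f_def kG_hom_add[OF q] kG_hom_add[OF i] kG_hom_mem[OF q])
    show "f (scal M c m) = scal (kG_sum U N) c (f m)" for c
      using m by (simp add: f_def N_def kG_hom_scal[OF q] kG_hom_scal[OF i] kG_hom_mem[OF q]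
          M.scale_right_diff_distrib)
    show "f (act M g m) = act (kG_sum U N) g (f m)" if g: "g \<in> carrier G" for g
      using m g
      by (simp add: f_def N_def kG_hom_act[OF q] kG_hom_act[OF i] kG_hom_mem[OF q] M.act_diff iq)
  qed
  moreover have "bij_betw f (carrier M) (carrier (kG_sum U N))"
    unfolding bij_betw_def
  proof
    show "inj_on f (carrier M)" by (rule inj_onI) (auto simp: f_def)
    show "f ` carrier M = carrier (kG_sum U N)"
    proof
      show "f ` carrier M \<subseteq> carrier (kG_sum U N)"
        by (auto simp: f_def N_def qf M.diff_mem iq kG_hom_mem[OF q])
      show "carrier (kG_sum U N) \<subseteq> f ` carrier M"
      proof
        fix x assume "x \<in> carrier (kG_sum U N)"
        then obtain u n where x: "x = (u, n)" "u \<in> carrier U" "n \<in> carrier M" "q n = 0"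
          by (auto simp: N_def)
        have iu: "i u \<in> carrier M" using x by (intro kG_hom_mem[OF i])
        have "q (i u + n) = u" using x iu by (simp add: kG_hom_add[OF q] qi)
        then have "f (i u + n) = x" using x by (simp add: f_def)
        then show "x \<in> f ` carrier M" using M.add_mem[OF iu x(3)] by blast
      qed
    qed
  qed
  ultimately show ?thesis
    using N U unfolding direct_summand_def kG_isomorphic_def by blast
qed

lemma direct_summand_trans:
  fixes U :: "('g, 'k::field, 'u::ab_group_add) kG_mod" and M :: "('g, 'k, 'v::ab_group_add) kG_mod"
    and L :: "('g, 'k, 'w::ab_group_add) kG_mod"
  assumes fin: "finite (carrier G)" and M: "kG_module G M" and L: "kG_module G L"
    and ds1: "direct_summand G U M" and ds2: "direct_summand G M L"
  shows "direct_summand G U L"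
proof -
  have Mr: "kG_rep G M" and Lr: "kG_rep G L" using M L kG_module_iff[OF fin] by blast+
  obtain i q where iq: "i \<in> kG_hom G U M" "q \<in> kG_hom G M U" "\<And>u. u \<in> carrier U \<Longrightarrow> q (i u) = u"
    using direct_summand_retract[OF Mr ds1] by blast
  obtain j r where jr: "j \<in> kG_hom G M L" "r \<in> kG_hom G L M" "\<And>u. u \<in> carrier M \<Longrightarrow> r (j u) = u"
    using direct_summand_retract[OF Lr ds2] by blast
  show ?thesis
    by (rule retract_direct_summand[OF fin _ L kG_hom_comp[OF iq(1) jr(1)] kG_hom_comp[OF jr(2) iq(2)]])
      (use ds1 in \<open>simp_all add: direct_summand_def iq jr kG_hom_mem[OF iq(1)]\<close>)
qed

text \<open>\<open>indecomposable\<close> quantifies over external sums. Addition is an isomorphism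
  from the external sum of two complementary submodules onto M, so internal decompositions are
  covered as well.\<close>

lemma indecomposable_internal:
  fixes M :: "('g, 'k::field, 'v::ab_group_add) kG_mod"
  assumes fin: "finite (carrier G)" and M: "indecomposable G M"
    and A: "kG_module G (M\<lparr>carrier := A\<rparr>)" and B: "kG_module G (M\<lparr>carrier := B\<rparr>)"
    and AM: "A \<subseteq> carrier M" and BM: "B \<subseteq> carrier M"
    and int: "A \<inter> B \<subseteq> {0}" and sum: "\<And>m. m \<in> carrier M \<Longrightarrow> \<exists>a\<in>A. \<exists>b\<in>B. m = a + b"
  shows "A = {0} \<or> B = {0}"
proof -
  have "kG_module G M" using M unfolding indecomposable_def by blast
  then interpret M: kG_module G M .
  interpret A: kG_module G "M\<lparr>carrier := A\<rparr>" by fact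
  interpret B: kG_module G "M\<lparr>carrier := B\<rparr>" by fact
  let ?S = "kG_sum (M\<lparr>carrier := A\<rparr>) (M\<lparr>carrier := B\<rparr>)"
  have S: "kG_rep G ?S" by (rule kG_rep_sum[OF A.kG_rep_axioms B.kG_rep_axioms])
  have "(\<lambda>x. fst x + snd x) \<in> kG_hom G ?S M"
    by (rule kG_homI) (auto simp: M.add_mem M.act_add M.scale_right_distrib
        subsetD[OF AM] subsetD[OF BM] add_ac)
  moreover have "bij_betw (\<lambda>x. fst x + snd x) (carrier ?S) (carrier M)"
    unfolding bij_betw_def
  proof
    show "inj_on (\<lambda>x. fst x + snd x) (carrier ?S)"
    proof (rule inj_onI)
      fix x y assume x: "x \<in> carrier ?S" and y: "y \<in> carrier ?S" and e: "fst x + snd x = fst y + snd y"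
      then have d: "fst x - fst y = snd y - snd x" by (simp add: algebra_simps)
      moreover have "fst x - fst y \<in> A" using A.diff_mem x y by auto
      moreover have "snd y - snd x \<in> B" using B.diff_mem x y by auto
      ultimately have "fst x - fst y = 0" using int by auto
      then show "x = y" using d by (simp add: prod_eq_iff)
    qed
    show "(\<lambda>x. fst x + snd x) ` carrier ?S = carrier M"
    proof
      show "(\<lambda>x. fst x + snd x) ` carrier ?S \<subseteq> carrier M" using M.add_mem[OF subsetD[OF AM] subsetD[OF BM]] by auto
      show "carrier M \<subseteq> (\<lambda>x. fst x + snd x) ` carrier ?S"
        using sum by (fastforce simp: image_iff)
    qed
  qed
  ultimately have "kG_isomorphic G M ?S"
    using kG_isomorphic_sym[OF S] unfolding kG_isomorphic_def by blast
  then have "carrier (M\<lparr>carrier := A\<rparr>) = {0} \<or> carrier (M\<lparr>carrier := B\<rparr>) = {0}"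
    using M A B unfolding indecomposable_def by blast
  then show ?thesis by simp
qed

text \<open>An idempotent splits M into its image and its kernel, and one of the two must
  vanish.\<close>

lemma indecomposable_idempotent:
  fixes M :: "('g, 'k::field, 'v::ab_group_add) kG_mod"
  assumes fin: "finite (carrier G)" and M: "indecomposable G M"
    and e: "e \<in> kG_hom G M M" and idem: "\<And>m. m \<in> carrier M \<Longrightarrow> e (e m) = e m"
  shows "(\<forall>m\<in>carrier M. e m = 0) \<or> (\<forall>m\<in>carrier M. e m = m)"
proof -
  have "kG_module G M" using M unfolding indecomposable_def by blast
  then interpret M: kG_module G M .
  note ed = kG_hom_diff[OF M.kG_rep_axioms e] and em = kG_hom_mem[OF e]
  have "e ` carrier M = {0} \<or> {m \<in> carrier M. e m = 0} = {0}"
  proof (rule indecomposable_internal[OF fin M])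
    show "kG_module G (M\<lparr>carrier := e ` carrier M\<rparr>)"
      by (rule kG_module_hom_image[OF fin M.kG_rep_axioms M.kG_module_axioms e])
    show "kG_module G (M\<lparr>carrier := {m \<in> carrier M. e m = 0}\<rparr>)"
      by (rule kG_module_hom_kernel[OF fin M.kG_module_axioms M.kG_rep_axioms e])
    show "e ` carrier M \<inter> {m \<in> carrier M. e m = 0} \<subseteq> {0}" using idem by auto
    show "\<exists>a\<in>e ` carrier M. \<exists>b\<in>{m \<in> carrier M. e m = 0}. m = a + b" if m: "m \<in> carrier M" for m
      using m by (intro bexI[of _ "e m"] bexI[of _ "m - e m"]) (simp_all add: M.diff_mem em ed idem)
  qed (use em in auto)
  then show ?thesis
  proof
    assume "e ` carrier M = {0}"
    then show ?thesis by blast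
  next
    assume k: "{m \<in> carrier M. e m = 0} = {0}"
    have "e m = m" if m: "m \<in> carrier M" for m
    proof -
      have "e m - m \<in> {m \<in> carrier M. e m = 0}" using m by (simp add: M.diff_mem em ed idem)
      then show ?thesis unfolding k by simp
    qed
    then show ?thesis by blast
  qed
qed

text \<open>Project to the first summand of a nontrivial decomposition and transport the projection
  back to M. The two witnesses make e neither zero nor injective, so that both e and id - e have
  proper images.\<close>

lemma decomposable_idempotent:
  fixes M :: "('g, 'k::field, 'v::ab_group_add) kG_mod"
  assumes M: "kG_module G M" and "carrier M \<noteq> {0}" and "\<not> indecomposable G M"
  obtains e where "e \<in> kG_hom G M M" "\<And>m. m \<in> carrier M \<Longrightarrow> e (e m) = e m"
    "\<exists>m\<in>carrier M. e m \<noteq> 0" "\<exists>m\<in>carrier M. m \<noteq> 0 \<and> e m = 0"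
proof -
  interpret M: kG_module G M by fact
  obtain A :: "('g, 'k, 'v) kG_mod" and B :: "('g, 'k, 'v) kG_mod" and f
    where AB: "kG_module G A" "kG_module G B" "carrier A \<noteq> {0}" "carrier B \<noteq> {0}"
      and f: "f \<in> kG_hom G M (kG_sum A B)" and b: "bij_betw f (carrier M) (carrier (kG_sum A B))"
    using assms unfolding indecomposable_def kG_isomorphic_def by blast
  interpret A: kG_module G A by fact
  interpret B: kG_module G B by fact
  let ?f' = "inv_into (carrier M) f"
  have f': "?f' \<in> kG_hom G (kG_sum A B) M" by (rule kG_hom_inv_into[OF M.kG_rep_axioms f b])
  have ff': "f (?f' x) = x" if "x \<in> carrier (kG_sum A B)" for x
    using that b by (simp add: bij_betw_def f_inv_into_f)
  have pr: "(\<lambda>x. (fst x, 0)) \<in> kG_hom G (kG_sum A B) (kG_sum A B)"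
    by (rule kG_homI) (auto simp: B.zero_mem B.act_zero)
  define e where "e m = ?f' (fst (f m), 0)" for m
  have e: "e \<in> kG_hom G M M"
    unfolding e_def by (rule kG_hom_comp[OF kG_hom_comp[OF f pr] f'])
  have fe: "f (e m) = (fst (f m), 0)" if "m \<in> carrier M" for m
    unfolding e_def using kG_hom_mem[OF f that] B.zero_mem by (intro ff') auto
  show ?thesis
  proof (rule that[OF e])
    show "e (e m) = e m" if "m \<in> carrier M" for m
      using fe[OF that] by (simp add: e_def)
    obtain a where a: "a \<in> carrier A" "a \<noteq> 0" using AB(3) A.zero_mem by blast
    then have a': "(a, 0) \<in> carrier (kG_sum A B)" using B.zero_mem by simp
    have "f (e (?f' (a, 0))) = (a, 0)"
      using fe[OF kG_hom_mem[OF f' a']] ff'[OF a'] by simp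
    then have "e (?f' (a, 0)) \<noteq> 0"
      using a(2) kG_hom_0[OF M.kG_rep_axioms f] by (auto simp: zero_prod_def)
    then show "\<exists>m\<in>carrier M. e m \<noteq> 0" using kG_hom_mem[OF f' a'] by blast
    obtain c where c: "c \<in> carrier B" "c \<noteq> 0" using AB(4) B.zero_mem by blast
    then have c': "(0, c) \<in> carrier (kG_sum A B)" using A.zero_mem by simp
    have "?f' (0, c) \<noteq> 0"
      using ff'[OF c'] c(2) kG_hom_0[OF M.kG_rep_axioms f] by (auto simp: zero_prod_def)
    moreover have "e (?f' (0, c)) = 0"
      using ff'[OF c'] kG_hom_0[OF kG_rep_sum[OF A.kG_rep_axioms B.kG_rep_axioms] f']
      by (simp add: e_def zero_prod_def)
    ultimately show "\<exists>m\<in>carrier M. m \<noteq> 0 \<and> e m = 0" using kG_hom_mem[OF f' c'] by blast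
  qed
qed

section \<open>Endomorphisms of indecomposable modules\<close>

lemma kG_hom_funpow: "\<phi> \<in> kG_hom G M M \<Longrightarrow> \<phi> ^^ n \<in> kG_hom G M M"
proof (induction n)
  case 0
  then show ?case by (simp add: kG_hom_id id_def)
next
  case (Suc n)
  then show ?case using kG_hom_comp[OF Suc.IH[OF Suc.prems] Suc.prems] by (simp add: comp_def)
qed

text \<open>Kernels of powers increase and images decrease, so by finite dimension both become
  constant. For a stable exponent N, M is the direct sum of the image and the kernel of \<phi>^N,
  and indecomposability makes one of them zero.\<close>

lemma fitting:
  fixes M :: "('g, 'k::field, 'v::ab_group_add) kG_mod"
  assumes fin: "finite (carrier G)" and M: "indecomposable G M" and \<phi>: "\<phi> \<in> kG_hom G M M"
  shows "(\<exists>n. \<forall>m\<in>carrier M. (\<phi> ^^ n) m = 0) \<or> bij_betw \<phi> (carrier M) (carrier M)"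
proof -
  have "kG_module G M" using M unfolding indecomposable_def by blast
  then interpret M: kG_module G M .
  note Mr = M.kG_rep_axioms
  note pow = kG_hom_funpow[OF \<phi>]
  obtain T where T: "finite T" "carrier M \<subseteq> M.span T"
    using M.kG_module_axioms kG_module_iff[OF fin] unfolding fin_dim_def by blast
  define K where "K n = {m \<in> carrier M. (\<phi> ^^ n) m = 0}" for n
  define I where "I n = (\<phi> ^^ n) ` carrier M" for n
  have Ks: "M.subspace (K n)" for n unfolding K_def by (rule subspace_hom_kernel[OF Mr Mr pow])
  have Is: "M.subspace (I n)" for n unfolding I_def by (rule subspace_hom_image[OF Mr Mr pow])
  have KM: "K n \<subseteq> carrier M" and IM: "I n \<subseteq> carrier M" for n
    using kG_hom_mem[OF pow] unfolding K_def I_def by auto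
  have Kmono: "K n \<subseteq> K (n + j)" for n j
    unfolding K_def using kG_hom_0[OF Mr pow] by (auto simp: add.commute[of n j] funpow_add)
  have Imono: "I (n + j) \<subseteq> I n" for n j
    unfolding I_def using kG_hom_mem[OF pow] by (auto simp: funpow_add)
  have "\<forall>n. M.dim (K n) < Suc (card T)"
    using M.dim_le_card[OF _ T(1)] KM T(2) by (meson le_imp_less_Suc order_trans)
  \<comment> \<open>The kernels are constant from an exponent of maximal kernel dimension on, which
    exists because dimensions are bounded by \<open>card T\<close>; the images from one of minimal
    image dimension on.\<close>
  then obtain n1 where n1: "\<And>n. M.dim (K n) \<le> M.dim (K n1)"
    using ex_has_greatest_nat[of "\<lambda>n. True" 0 "\<lambda>n. M.dim (K n)" "Suc (card T)"] by auto
  obtain n2 where n2: "\<And>n. M.dim (I n2) \<le> M.dim (I n)"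
    using ex_has_least_nat[of "\<lambda>n. True" 0 "\<lambda>n. M.dim (I n)"] by auto
  have Keq: "K (n1 + j) = K n1" for j
    using M.subspace_eq_of_dim[OF Ks Ks Kmono _ T(1) n1] KM T(2) by blast
  have Ieq: "I (n2 + j) = I n2" for j
    using M.subspace_eq_of_dim[OF Is Is Imono _ T(1) n2] IM T(2) by blast
  \<comment> \<open>The successor makes N positive, so that one factor \<phi> can be split off
    \<phi>^N on either side when injectivity and surjectivity of \<phi> are derived.\<close>
  define N where "N = Suc (n1 + n2)"
  have KN: "K (N + N) = K N"
    using Keq[of "Suc n2"] Keq[of "Suc n2 + N"] unfolding N_def by (simp add: add_ac)
  have IN: "I (N + N) = I N"
    using Ieq[of "Suc n1"] Ieq[of "Suc n1 + N"] unfolding N_def by (simp add: add_ac)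
  have "I N = {0} \<or> K N = {0}"
  proof (rule indecomposable_internal[OF fin M])
    show "kG_module G (M\<lparr>carrier := I N\<rparr>)"
      unfolding I_def by (rule kG_module_hom_image[OF fin Mr M.kG_module_axioms pow])
    show "kG_module G (M\<lparr>carrier := K N\<rparr>)"
      unfolding K_def by (rule kG_module_hom_kernel[OF fin M.kG_module_axioms Mr pow])
    show "I N \<inter> K N \<subseteq> {0}"
    proof
      fix a assume a: "a \<in> I N \<inter> K N"
      then obtain m where m: "m \<in> carrier M" "a = (\<phi> ^^ N) m" unfolding I_def by blast
      then have "m \<in> K (N + N)" using a unfolding K_def by (simp add: funpow_add)
      then show "a \<in> {0}" using m(2) unfolding KN by (simp add: K_def)
    qed
    fix m assume m: "m \<in> carrier M"
    then have "(\<phi> ^^ N) m \<in> I N" unfolding I_def by blast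
    then have "(\<phi> ^^ N) m \<in> I (N + N)" unfolding IN .
    then obtain w where w: "w \<in> carrier M" "(\<phi> ^^ N) m = (\<phi> ^^ N) ((\<phi> ^^ N) w)"
      unfolding I_def by (auto simp: funpow_add)
    have pw: "(\<phi> ^^ N) w \<in> carrier M" using kG_hom_mem[OF pow w(1)] .
    have "m - (\<phi> ^^ N) w \<in> K N"
      using w m pw by (simp add: K_def M.diff_mem kG_hom_diff[OF Mr pow])
    then show "\<exists>a\<in>I N. \<exists>b\<in>K N. m = a + b"
      using w(1) unfolding I_def by (intro bexI[of _ "(\<phi> ^^ N) w"] bexI[of _ "m - (\<phi> ^^ N) w"]) auto
  qed (rule IM KM)+
  then show ?thesis
  proof
    assume "I N = {0}"
    then have "\<forall>m\<in>carrier M. (\<phi> ^^ N) m = 0" unfolding I_def by blast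
    then show ?thesis by blast
  next
    assume K0: "K N = {0}"
    have inj: "x = y" if x: "x \<in> carrier M" and y: "y \<in> carrier M" and e: "\<phi> x = \<phi> y" for x y
    proof -
      have "\<phi> (x - y) = 0" using e by (simp add: kG_hom_diff[OF Mr \<phi> x y])
      then have "(\<phi> ^^ N) (x - y) = 0"
        using kG_hom_0[OF Mr pow] unfolding N_def by (simp add: funpow_swap1[symmetric] del: funpow.simps(2) add: funpow_Suc_right)
      then have "x - y \<in> K N" using x y unfolding K_def by (simp add: M.diff_mem)
      then show ?thesis using K0 by simp
    qed
    have "m \<in> \<phi> ` carrier M" if m: "m \<in> carrier M" for m
    proof -
      have "(\<phi> ^^ N) m \<in> I N" using m unfolding I_def by blast
      then have "(\<phi> ^^ N) m \<in> I (N + N)" unfolding IN .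
      then obtain w where w: "w \<in> carrier M" "(\<phi> ^^ N) m = (\<phi> ^^ N) ((\<phi> ^^ N) w)"
        unfolding I_def by (auto simp: funpow_add)
      have pw: "(\<phi> ^^ N) w \<in> carrier M" using kG_hom_mem[OF pow w(1)] .
      have "m - (\<phi> ^^ N) w \<in> K N"
        using w m pw by (simp add: K_def M.diff_mem kG_hom_diff[OF Mr pow])
      then have "m = (\<phi> ^^ N) w" using K0 by simp
      then have "m = \<phi> ((\<phi> ^^ (n1 + n2)) w)" unfolding N_def by simp
      then show ?thesis using kG_hom_mem[OF pow w(1)] by blast
    qed
    then have "bij_betw \<phi> (carrier M) (carrier M)"
      using inj kG_hom_mem[OF \<phi>] unfolding bij_betw_def inj_on_def by blast
    then show ?thesis ..
  qed
qed

lemma bij_betw_left_cancel: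
  assumes "bij_betw s B C" "bij_betw (\<lambda>x. s (f x)) A C" "f ` A \<subseteq> B"
  shows "bij_betw f A B"
proof -
  have s: "inj_on s B" "s ` B = C" and sf: "inj_on (\<lambda>x. s (f x)) A" "(\<lambda>x. s (f x)) ` A = C"
    using assms(1,2) unfolding bij_betw_def by blast+
  have "inj_on f A" using sf(1) unfolding inj_on_def by metis
  moreover have "b \<in> f ` A" if b: "b \<in> B" for b
  proof -
    have "s b \<in> (\<lambda>x. s (f x)) ` A" using s(2) sf(2) b by blast
    then obtain a where "a \<in> A" "s b = s (f a)" by blast
    then show ?thesis using s(1) b assms(3) unfolding inj_on_def by blast
  qed
  ultimately show ?thesis using assms(3) unfolding bij_betw_def by blast
qed

text \<open>This is locality of the endomorphism ring. After composing with the inverse s of the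
  sum, s \<phi> + s \<psi> = id. If neither term were bijective, both would be nilpotent by
  \<open>fitting\<close>; but a nonzero vector killed by one is fixed by the other.\<close>

lemma bij_of_bij_add:
  fixes M :: "('g, 'k::field, 'v::ab_group_add) kG_mod"
  assumes fin: "finite (carrier G)" and M: "indecomposable G M"
    and \<phi>: "\<phi> \<in> kG_hom G M M" and \<psi>: "\<psi> \<in> kG_hom G M M"
    and b: "bij_betw (\<lambda>x. \<phi> x + \<psi> x) (carrier M) (carrier M)"
  shows "bij_betw \<phi> (carrier M) (carrier M) \<or> bij_betw \<psi> (carrier M) (carrier M)"
proof -
  have "kG_module G M" and M0: "carrier M \<noteq> {0}" using M unfolding indecomposable_def by blast+
  then interpret M: kG_module G M by blast
  note Mr = M.kG_rep_axioms
  define s where "s = inv_into (carrier M) (\<lambda>x. \<phi> x + \<psi> x)"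
  have s: "s \<in> kG_hom G M M"
    unfolding s_def by (rule kG_hom_inv_into[OF Mr kG_hom_add_map[OF Mr \<phi> \<psi>] b])
  have sb: "bij_betw s (carrier M) (carrier M)" unfolding s_def by (rule bij_betw_inv_into[OF b])
  have one: "s (\<phi> x) + s (\<psi> x) = x" if x: "x \<in> carrier M" for x
  proof -
    have "s (\<phi> x + \<psi> x) = x" unfolding s_def
      using b x unfolding bij_betw_def by (intro inv_into_f_f[where f = "\<lambda>x. \<phi> x + \<psi> x"]) auto
    then show ?thesis using kG_hom_add[OF s kG_hom_mem[OF \<phi> x] kG_hom_mem[OF \<psi> x]] by simp
  qed
  have \<alpha>: "(\<lambda>x. s (\<phi> x)) \<in> kG_hom G M M" and \<beta>: "(\<lambda>x. s (\<psi> x)) \<in> kG_hom G M M"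
    using kG_hom_comp[OF \<phi> s] kG_hom_comp[OF \<psi> s] .
  have "bij_betw (\<lambda>x. s (\<phi> x)) (carrier M) (carrier M) \<or> bij_betw (\<lambda>x. s (\<psi> x)) (carrier M) (carrier M)"
  proof (rule ccontr)
    assume nb: "\<not> ?thesis"
    obtain n where n: "\<forall>m\<in>carrier M. ((\<lambda>x. s (\<phi> x)) ^^ n) m = 0"
      using fitting[OF fin M \<alpha>] nb by blast
    obtain k where k: "\<forall>m\<in>carrier M. ((\<lambda>x. s (\<psi> x)) ^^ k) m = 0"
      using fitting[OF fin M \<beta>] nb by blast
    obtain v where v: "v \<in> carrier M" "v \<noteq> 0" using M0 M.zero_mem by blast
    \<comment> \<open>The last nonzero iterate of v under s \<phi> is a nonzero vector of the
      kernel.\<close>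
    have "\<exists>w\<in>carrier M. w \<noteq> 0 \<and> s (\<phi> w) = 0" if "((\<lambda>x. s (\<phi> x)) ^^ j) v = 0" for j
      using that
    proof (induction j)
      case 0
      then show ?case using v by simp
    next
      case (Suc j)
      then show ?case
        using kG_hom_mem[OF kG_hom_funpow[OF \<alpha>] v(1), of j] by (cases "((\<lambda>x. s (\<phi> x)) ^^ j) v = 0") auto
    qed
    then obtain w where w: "w \<in> carrier M" "w \<noteq> 0" "s (\<phi> w) = 0" using n v(1) by blast
    have "s (\<psi> w) = w" using one[OF w(1)] w(3) by simp
    then have "((\<lambda>x. s (\<psi> x)) ^^ j) w = w" for j by (induction j) simp_all
    then show False using k w(1,2) by metis
  qed
  then show ?thesis
    using bij_betw_left_cancel[OF sb, of \<phi> "carrier M"] bij_betw_left_cancel[OF sb, of \<psi> "carrier M"]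
      kG_hom_mem[OF \<phi>] kG_hom_mem[OF \<psi>] by blast
qed

lemma bij_of_bij_sum:
  fixes M :: "('g, 'k::field, 'v::ab_group_add) kG_mod"
  assumes fin: "finite (carrier G)" and M: "indecomposable G M"
    and "finite I" and "\<And>i. i \<in> I \<Longrightarrow> \<phi> i \<in> kG_hom G M M"
    and "bij_betw (\<lambda>x. \<Sum>i\<in>I. \<phi> i x) (carrier M) (carrier M)"
  shows "\<exists>i\<in>I. bij_betw (\<phi> i) (carrier M) (carrier M)"
  using assms(3-5)
proof (induction I)
  case empty
  have "kG_module G M" and M0: "carrier M \<noteq> {0}" using M unfolding indecomposable_def by blast+
  then interpret M: kG_module G M by blast
  \<comment> \<open>The empty sum is the zero map, which is bijective only on the zero
    module.\<close>
  have "carrier M = (\<lambda>x. 0) ` carrier M" using empty(2) unfolding bij_betw_def by simp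
  then show ?case using M0 M.zero_mem by blast
next
  case (insert i I)
  have "kG_module G M" using M unfolding indecomposable_def by blast
  then interpret M: kG_module G M .
  have i: "\<phi> i \<in> kG_hom G M M" and s: "(\<lambda>x. \<Sum>i\<in>I. \<phi> i x) \<in> kG_hom G M M"
    using insert.prems(1) by (auto intro: kG_hom_sum_map[OF M.kG_rep_axioms])
  have "bij_betw (\<lambda>x. \<phi> i x + (\<Sum>i\<in>I. \<phi> i x)) (carrier M) (carrier M)"
    using insert.prems(2) insert.hyps by simp
  then show ?case using bij_of_bij_add[OF fin M i s] insert.IH insert.prems(1) by blast
qed

text \<open>By locality one of the traces that add up to the identity is bijective. Its inverse s is
  a \<open>G\<close>-homomorphism and is absorbed into \<theta>, because s composed with the trace
  of \<theta> is the trace of s \<theta>.\<close>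

lemma indecomposable_single_trace:
  fixes U :: "('g, 'k::field, 'v::ab_group_add) kG_mod"
  assumes fin: "finite (carrier G)" and U: "indecomposable G U"
    and F: "\<And>Q. Q \<in> F \<Longrightarrow> subgroup Q G" "finite F"
    and id: "(\<lambda>x. x) \<in> trace_ideal G F U U"
  shows "\<exists>Q\<in>F. \<exists>\<theta>\<in>kG_hom (G\<lparr>carrier := Q\<rparr>) U U. \<forall>u\<in>carrier U. rel_trace G Q U U \<theta> u = u"
proof -
  have "kG_module G U" using U unfolding indecomposable_def by blast
  then interpret U: kG_module G U .
  note Ur = U.kG_rep_axioms
  obtain \<theta> where \<theta>: "\<And>Q. Q \<in> F \<Longrightarrow> \<theta> Q \<in> kG_hom (G\<lparr>carrier := Q\<rparr>) U U"
    and id: "\<And>x. x \<in> carrier U \<Longrightarrow> x = (\<Sum>Q\<in>F. rel_trace G Q U U (\<theta> Q) x)"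
    using id unfolding trace_ideal_def by blast
  have hom: "rel_trace G Q U U (\<theta> Q) \<in> kG_hom G U U" if "Q \<in> F" for Q
    by (rule rel_trace_hom[OF Ur Ur F(1)[OF that] \<theta>[OF that]])
  have "bij_betw (\<lambda>x. x) (carrier U) (carrier U)" by (simp add: bij_betw_def)
  then have bs: "bij_betw (\<lambda>x. \<Sum>Q\<in>F. rel_trace G Q U U (\<theta> Q) x) (carrier U) (carrier U)"
    by (rule bij_betw_cong[THEN iffD1, rotated]) (rule id)
  obtain Q where Q: "Q \<in> F" and b: "bij_betw (rel_trace G Q U U (\<theta> Q)) (carrier U) (carrier U)"
    using bij_of_bij_sum[where \<phi> = "\<lambda>Q. rel_trace G Q U U (\<theta> Q)", OF fin U F(2) hom bs] by blast
  define s where "s = inv_into (carrier U) (rel_trace G Q U U (\<theta> Q))"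
  have s: "s \<in> kG_hom G U U" unfolding s_def by (rule kG_hom_inv_into[OF Ur hom[OF Q] b])
  have sQ: "s \<in> kG_hom (G\<lparr>carrier := Q\<rparr>) U U"
    by (rule kG_hom_restrict[OF s subgroup.subset[OF F(1)[OF Q]]])
  have "rel_trace G Q U U (\<lambda>x. s (\<theta> Q x)) u = u" if u: "u \<in> carrier U" for u
  proof -
    have "rel_trace G Q U U (\<lambda>x. s (\<theta> Q x)) u = s (rel_trace G Q U U (\<theta> Q) u)"
      using rel_trace_comp[OF Ur Ur F(1)[OF Q] \<theta>[OF Q] kG_hom_id s u] by simp
    also have "\<dots> = u" unfolding s_def using b u by (simp add: bij_betw_def)
    finally show ?thesis .
  qed
  then show ?thesis using kG_hom_comp[OF \<theta>[OF Q] sQ] Q by blast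
qed

text \<open>Induction on the dimension. If an idempotent e splits W, then e and id - e factor
  through their images, which are smaller summands of W and whose components are components of W.
  Both maps thus lie in the trace ideal, and so does their sum.\<close>

lemma trace_ideal_of_components:
  fixes W :: "('g, 'k::field, 'v::ab_group_add) kG_mod"
  assumes fin: "finite (carrier G)" and F: "\<And>Q. Q \<in> F \<Longrightarrow> subgroup Q G"
    and "kG_module G W"
    and "\<And>C :: ('g, 'k, 'v) kG_mod. component G C W \<Longrightarrow> (\<lambda>x. x) \<in> trace_ideal G F C C"
  shows "(\<lambda>x. x) \<in> trace_ideal G F W W"
  using assms(3,4)
proof (induction "vector_space.dim (scal W) (carrier W)" arbitrary: W rule: less_induct)
  case less
  interpret W: kG_module G W by (rule less.prems(1))
  note Wr = W.kG_rep_axioms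
  consider "carrier W = {0}" | "indecomposable G W" | "carrier W \<noteq> {0}" "\<not> indecomposable G W" by blast
  then show ?case
  proof cases
    case 1
    then show ?thesis by (intro trace_ideal_cong[OF trace_ideal_zero[OF Wr Wr F]]) auto
  next
    case 2
    have "direct_summand G W W"
      by (rule retract_direct_summand[OF fin less.prems(1) less.prems(1) kG_hom_id kG_hom_id]) simp
    then show ?thesis using 2 less.prems(2) unfolding component_def by blast
  next
    case 3
    obtain e where e: "e \<in> kG_hom G W W" and idem: "\<And>m. m \<in> carrier W \<Longrightarrow> e (e m) = e m"
      and ne: "\<exists>m\<in>carrier W. e m \<noteq> 0" "\<exists>m\<in>carrier W. m \<noteq> 0 \<and> e m = 0"
      using decomposable_idempotent[OF less.prems(1) 3] by blast
    note ed = kG_hom_diff[OF Wr e] and em = kG_hom_mem[OF e]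
    \<comment> \<open>Stated for any noninjective idempotent c, so that it serves for e and for id -
      e. A nonzero kernel makes the image of c a proper subspace, to which the induction hypothesis
      applies.\<close>
    have part: "(\<lambda>x. c x) \<in> trace_ideal G F W W"
      if c: "c \<in> kG_hom G W W" and cc: "\<And>m. m \<in> carrier W \<Longrightarrow> c (c m) = c m"
        and ker: "\<exists>m\<in>carrier W. m \<noteq> 0 \<and> c m = 0" for c
    proof -
      define N where "N = W\<lparr>carrier := c ` carrier W\<rparr>"
      have N: "kG_module G N"
        unfolding N_def by (rule kG_module_hom_image[OF fin Wr less.prems(1) c])
      then interpret N: kG_module G N .
      have cW: "c ` carrier W \<subseteq> carrier W" using kG_hom_mem[OF c] by blast
      obtain m where m: "m \<in> carrier W" "m \<noteq> 0" "c m = 0" using ker by blast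
      then have "m \<notin> c ` carrier W" using cc by auto
      then have ps: "c ` carrier W \<subset> carrier W" using cW m(1) by blast
      obtain T where T: "finite T" "carrier W \<subseteq> W.span T"
        using less.prems(1) kG_module_iff[OF fin] unfolding fin_dim_def by blast
      have "W.dim (c ` carrier W) < W.dim (carrier W)"
        by (rule W.dim_less_of_psubset[OF subspace_hom_image[OF Wr Wr c] W.carrier_subspace ps T(2,1)])
      then have dim: "vector_space.dim (scal N) (carrier N) < W.dim (carrier W)" by (simp add: N_def)
      have cN: "c \<in> kG_hom G W N" using kG_homD[OF c] by (intro kG_homI) (auto simp: N_def)
      have iN: "(\<lambda>x. x) \<in> kG_hom G N W" using cW by (intro kG_homI) (auto simp: N_def)
      have ds: "direct_summand G N W"
        by (rule retract_direct_summand[OF fin N less.prems(1) iN cN]) (auto simp: N_def cc)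
      have "(\<lambda>x. x) \<in> trace_ideal G F C C" if "component G C N" for C :: "('g, 'k, 'v) kG_mod"
        using that direct_summand_trans[OF fin N less.prems(1) _ ds] less.prems(2)
        unfolding component_def by blast
      then have "(\<lambda>x. x) \<in> trace_ideal G F N N" using less.hyps[OF dim N] by blast
      from trace_ideal_comp[OF N.kG_rep_axioms N.kG_rep_axioms F this cN iN] show ?thesis by simp
    qed
    have 1: "e \<in> trace_ideal G F W W" using part[OF e idem ne(2)] .
    have "(\<lambda>x. x - e x) \<in> kG_hom G W W"
      using kG_hom_add_map[OF Wr kG_hom_id kG_hom_scal_map[OF Wr e, of "-1"]] by simp
    \<comment> \<open>Any nonzero vector of the image of e is killed by id - e.\<close>
    moreover have "\<exists>m\<in>carrier W. m \<noteq> 0 \<and> m - e m = 0" using ne(1) em idem by force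
    ultimately have 2: "(\<lambda>x. x - e x) \<in> trace_ideal G F W W"
      using idem by (intro part) (auto simp: ed em)
    show ?thesis using trace_ideal_add[OF Wr Wr F 1 2] by simp
  qed
qed

section \<open>Higman's criterion\<close>

text \<open>\<open>relatively_projective\<close> asks for a module on
  \<open>nat \<Rightarrow> 'k\<close>. Coordinates with respect to an enumerated basis provide one,
  with the action transported along \<open>j\<close> and \<open>j'\<close>.\<close>

lemma kG_module_coordinates:
  fixes U :: "('g, 'k::field, 'v::ab_group_add) kG_mod"
  assumes fin: "finite (carrier G)" and U: "kG_module G U"
  obtains V :: "('g, 'k, nat \<Rightarrow> 'k) kG_mod" and j j'
  where "kG_module G V" "j \<in> kG_hom G U V" "j' \<in> kG_hom G V U" "\<And>u. u \<in> carrier U \<Longrightarrow> j' (j u) = u"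
proof -
  interpret U: kG_module G U by fact
  obtain T where T: "finite T" "carrier U \<subseteq> U.span T"
    using U kG_module_iff[OF fin] unfolding fin_dim_def by blast
  obtain B where B: "B \<subseteq> carrier U" "finite B" "U.independent B" "U.span B = carrier U"
    using U.finite_basis_within[OF U.carrier_subspace T(2,1) U.independent_empty empty_subsetI] by blast
  define d where "d = card B"
  obtain h where h: "bij_betw h {..<d} B"
    using ex_bij_betw_nat_finite[OF B(2)] unfolding d_def lessThan_atLeast0 by blast
  have hB: "h i \<in> B" if "i < d" for i using h that unfolding bij_betw_def by blast
  have hU: "h i \<in> carrier U" if "i < d" for i using hB[OF that] B(1) by blast
  define j where "j u = (\<lambda>i. if i < d then U.representation B u (h i) else 0)" for u
  define j' where "j' f = (\<Sum>i<d. scal U (f i) (h i))" for f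
  define V where "V = \<lparr>carrier = {f :: nat \<Rightarrow> 'k. \<forall>i\<ge>d. f i = 0}, scal = (\<lambda>c f i. c * f i),
      act = (\<lambda>g f. j (act U g (j' f)))\<rparr>"
  have Vsel: "carrier V = {f. \<forall>i\<ge>d. f i = 0}" "\<And>c f. scal V c f = (\<lambda>i. c * f i)"
    "\<And>g f. act V g f = j (act U g (j' f))" by (simp_all add: V_def)
  have jV: "j u \<in> carrier V" for u by (simp add: Vsel j_def)
  have j'U: "j' f \<in> carrier U" for f unfolding j'_def using hU by (intro U.sum_mem U.scal_mem) auto
  have j'j: "j' (j u) = u" if u: "u \<in> carrier U" for u
  proof -
    have "j' (j u) = (\<Sum>i<d. scal U (U.representation B u (h i)) (h i))"
      unfolding j'_def j_def by (intro sum.cong) auto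
    also have "\<dots> = (\<Sum>b\<in>B. scal U (U.representation B u b) b)"
      by (rule sum.reindex_bij_betw[OF h, where g = "\<lambda>b. scal U (U.representation B u b) b"])
    also have "\<dots> = u" using U.sum_representation_eq[OF B(3) _ B(2) order_refl] u B(4) by blast
    finally show ?thesis .
  qed
  have jadd: "j (u + v) = j u + j v" if "u \<in> carrier U" "v \<in> carrier U" for u v
    using that B(4) by (auto simp: j_def fun_eq_iff U.representation_add[OF B(3)])
  have jscal: "j (scal U c u) = scal V c (j u)" if "u \<in> carrier U" for u c
    using that B(4) by (auto simp: j_def fun_eq_iff Vsel U.representation_scale[OF B(3)])
  have j'add: "j' (f + f') = j' f + j' f'" for f f'
    by (simp add: j'_def U.scale_left_distrib sum.distrib)
  have j'scal: "j' (scal V c f) = scal U c (j' f)" for c f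
    by (simp add: j'_def Vsel U.scale_sum_right)
  have jj': "j (j' f) = f" if f: "f \<in> carrier V" for f
  proof
    fix i
    show "j (j' f) i = f i"
    proof (cases "i < d")
      case True
      \<comment> \<open>The coefficients are reindexed along the enumeration h, so that uniqueness
        of the representation over B gives them back.\<close>
      have "j' f = (\<Sum>b\<in>B. scal U (f (the_inv_into {..<d} h b)) b)"
      proof -
        have "(\<Sum>b\<in>B. scal U (f (the_inv_into {..<d} h b)) b) =
            (\<Sum>i<d. scal U (f (the_inv_into {..<d} h (h i))) (h i))"
          by (rule sum.reindex_bij_betw[OF h, symmetric])
        also have "\<dots> = j' f"
          unfolding j'_def using h by (intro sum.cong refl) (simp add: the_inv_into_f_f bij_betw_def)
        finally show ?thesis by simp
      qed
      moreover have "U.representation B (\<Sum>b\<in>B. scal U (f (the_inv_into {..<d} h b)) b) (h i) =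
          f (the_inv_into {..<d} h (h i))"
      proof -
        have "U.representation B (\<Sum>b\<in>B. scal U (f (the_inv_into {..<d} h b)) b) (h i) =
            (\<Sum>b\<in>B. f (the_inv_into {..<d} h b) * U.representation B b (h i))"
          by (subst U.representation_sum[OF B(3)])
            (simp_all add: U.representation_scale[OF B(3)] U.span_base U.span_scale)
        also have "\<dots> = (\<Sum>b\<in>B. if b = h i then f (the_inv_into {..<d} h b) else 0)"
          by (intro sum.cong refl) (simp add: U.representation_basis[OF B(3)])
        finally show ?thesis using hB[OF True] B(2) by simp
      qed
      ultimately show ?thesis using True h by (simp add: j_def the_inv_into_f_f bij_betw_def)
    next
      case False
      then show ?thesis using f by (simp add: j_def Vsel)
    qed
  qed
  have vs: "vector_space (scal V)"
    by unfold_locales (simp_all add: Vsel fun_eq_iff algebra_simps)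
  have "module.subspace (scal V) (carrier V)"
    unfolding module.subspace_def[OF vs[folded module_iff_vector_space]] by (simp add: Vsel)
  then have Vr: "kG_rep G V"
    unfolding kG_rep_def kG_rep_axioms_def
    using U.is_group vs
    by (auto simp: Vsel(3) jV j'add U.act_add j'U jadd U.act_closed j'scal U.act_scal jscal U.act_one jj'
        U.act_mult j'j)
  interpret V: kG_rep G V by (rule Vr)
  have "carrier V \<subseteq> V.span ((\<lambda>i m. if m = i then 1 else 0) ` {..<d})"
  proof
    fix f assume f: "f \<in> carrier V"
    have "f = (\<Sum>i<d. scal V (f i) (\<lambda>m. if m = i then 1 else 0))"
    proof
      fix m
      have "(\<Sum>i<d. scal V (f i) (\<lambda>m. if m = i then 1 else 0)) m = (\<Sum>i<d. if m = i then f i else 0)"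
        unfolding sum_fun_apply Vsel by (intro sum.cong) auto
      then show "f m = (\<Sum>i<d. scal V (f i) (\<lambda>m. if m = i then 1 else 0)) m"
        using f by (simp add: Vsel)
    qed
    also have "\<dots> \<in> V.span ((\<lambda>i m. if m = i then 1 else 0) ` {..<d})"
      by (intro V.span_sum V.span_scale V.span_base) auto
    finally show "f \<in> V.span ((\<lambda>i m. if m = i then 1 else 0) ` {..<d})" .
  qed
  then have "fin_dim V" unfolding fin_dim_def by blast
  then have "kG_module G V" using Vr kG_module_iff[OF fin] by blast
  moreover have "j \<in> kG_hom G U V"
    by (rule kG_homI) (simp_all add: jV jadd jscal Vsel(3) j'j)
  moreover have "j' \<in> kG_hom G V U"
    by (rule kG_homI) (simp_all add: j'U j'add j'scal Vsel(3) j'j U.act_closed)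
  ultimately show ?thesis using that j'j by blast
qed

section \<open>Induced modules and the two halves of Higman's criterion\<close>

lemma induced_sel:
  "carrier (induced G H V) = {f. (\<forall>x\<in>carrier G. f x \<in> carrier V) \<and> (\<forall>x. x \<notin> carrier G \<longrightarrow> f x = 0) \<and>
       (\<forall>x\<in>carrier G. \<forall>h\<in>H. f (x \<otimes>\<^bsub>G\<^esub> h) = act V (inv\<^bsub>G\<^esub> h) (f x))}"
  "scal (induced G H V) c f = (\<lambda>x. scal V c (f x))"
  "act (induced G H V) g f = (\<lambda>x. if x \<in> carrier G then f (inv\<^bsub>G\<^esub> g \<otimes>\<^bsub>G\<^esub> x) else 0)"
  by (simp_all add: induced_def)

lemma kG_module_induced:
  assumes fin: "finite (carrier G)" and G: "group G" and H: "subgroup H G"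
    and V: "kG_module (G\<lparr>carrier := H\<rparr>) V"
  shows "kG_module G (induced G H V)"
proof -
  interpret G: group G by fact
  interpret V: kG_module "G\<lparr>carrier := H\<rparr>" V by fact
  have HG: "H \<subseteq> carrier G" using H by (rule subgroup.subset)
  then have Hc: "h \<in> carrier G" "inv\<^bsub>G\<^esub> h \<in> H" if "h \<in> H" for h
    using that subgroup.m_inv_closed[OF H] by blast+
  have finH: "finite (carrier (G\<lparr>carrier := H\<rparr>))" using fin HG finite_subset by simp
  note ac = V.act_add[simplified] V.act_scal[simplified] V.act_zero[simplified] Hc(2)
  let ?I = "induced G H V"
  have vs: "vector_space (scal ?I)"
    by unfold_locales (simp_all add: induced_sel fun_eq_iff V.scale_right_distrib V.scale_left_distrib)
  have sub: "module.subspace (scal ?I) (carrier ?I)"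
    unfolding module.subspace_def[OF vs[folded module_iff_vector_space]]
    by (simp add: induced_sel V.zero_mem V.add_mem V.scal_mem ac)
  have cl: "act ?I g f \<in> carrier ?I" if g: "g \<in> carrier G" and f: "f \<in> carrier ?I" for g f
    using that Hc by (simp add: induced_sel G.m_assoc[symmetric])
  have mult: "act ?I (g \<otimes>\<^bsub>G\<^esub> h) f = act ?I g (act ?I h f)"
    if "g \<in> carrier G" "h \<in> carrier G" for g h f
    using that by (auto simp: induced_sel fun_eq_iff G.inv_mult_group G.m_assoc)
  have Ir: "kG_rep G ?I"
    unfolding kG_rep_def kG_rep_axioms_def
    using G vs sub cl mult by (auto simp: induced_sel fun_eq_iff)
  interpret I: kG_rep G ?I by (rule Ir)
  obtain T where T: "finite T" "carrier V \<subseteq> V.span T"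
    using V kG_module_iff[OF finH] unfolding fin_dim_def by blast
  \<comment> \<open>The functions \<delta> x v need not lie in the induced module;
    \<open>fin_dim\<close> only requires the carrier to be contained in a finite span of the ambient
    space.\<close>
  define \<delta> where "\<delta> x v = (\<lambda>y :: 'a. if y = x then v else 0)" for x and v :: 'b
  let ?T = "(\<lambda>(x, t). \<delta> x t) ` (carrier G \<times> T)"
  have \<delta>: "\<delta> x v \<in> I.span ?T" if x: "x \<in> carrier G" and v: "v \<in> V.span T" for x v
    using v
  proof (induction rule: V.span_induct_alt)
    case base
    have "\<delta> x 0 = 0" by (auto simp: \<delta>_def)
    then show ?case using I.span_zero by (simp only:)
  next
    case (step c t w)
    have "\<delta> x (scal V c t + w) = scal ?I c (\<delta> x t) + \<delta> x w"
      by (auto simp: \<delta>_def induced_sel fun_eq_iff)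
    moreover have "\<delta> x t \<in> I.span ?T" using x step by (intro I.span_base) auto
    ultimately show ?case using I.span_add[OF I.span_scale step(2)] by (simp only:)
  qed
  have "carrier ?I \<subseteq> I.span ?T"
  proof
    fix f assume f: "f \<in> carrier ?I"
    have "f = (\<Sum>x\<in>carrier G. \<delta> x (f x))"
    proof
      fix y
      have "(\<Sum>x\<in>carrier G. \<delta> x (f x)) y = (\<Sum>x\<in>carrier G. if y = x then f x else 0)"
        by (simp add: sum_fun_apply \<delta>_def)
      then show "f y = (\<Sum>x\<in>carrier G. \<delta> x (f x)) y"
        using fin f by (simp add: induced_sel)
    qed
    also have "\<dots> \<in> I.span ?T"
      using f T(2) by (intro I.span_sum \<delta>) (auto simp: induced_sel)
    finally show "f \<in> I.span ?T" .
  qed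
  moreover have "finite ?T" using fin T(1) by simp
  ultimately have "fin_dim ?I" unfolding fin_dim_def by blast
  then show ?thesis using Ir kG_module_iff[OF fin] by blast
qed

text \<open>Restricting functions to \<open>H\<close> is the projection of the induced module onto
  its summand 1 \<otimes> V, an \<open>H\<close>-homomorphism. Its conjugate by t restricts
  functions to the coset tH, and the cosets partition \<open>G\<close>, so the trace is the
  identity.\<close>

lemma induced_trace:
  assumes fin: "finite (carrier G)" and G: "group G" and H: "subgroup H G"
    and V: "kG_module (G\<lparr>carrier := H\<rparr>) V"
  defines "\<theta> \<equiv> \<lambda>f x. if x \<in> H then f x else 0"
  shows "\<theta> \<in> kG_hom (G\<lparr>carrier := H\<rparr>) (induced G H V) (induced G H V)"
    and "f \<in> carrier (induced G H V) \<Longrightarrow> rel_trace G H (induced G H V) (induced G H V) \<theta> f = f"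
proof -
  interpret G: group G by fact
  interpret V: kG_module "G\<lparr>carrier := H\<rparr>" V by fact
  let ?I = "induced G H V"
  interpret I: kG_module G ?I by (rule kG_module_induced[OF fin G H V])
  have HG: "H \<subseteq> carrier G" using H by (rule subgroup.subset)
  then have Hc: "h \<in> carrier G" "inv\<^bsub>G\<^esub> h \<in> H" if "h \<in> H" for h
    using that subgroup.m_inv_closed[OF H] by blast+
  have mH: "x \<otimes>\<^bsub>G\<^esub> h \<in> H \<longleftrightarrow> x \<in> H" if "x \<in> carrier G" "h \<in> H" for x h
  proof
    assume "x \<otimes>\<^bsub>G\<^esub> h \<in> H"
    then have "x \<otimes>\<^bsub>G\<^esub> h \<otimes>\<^bsub>G\<^esub> inv\<^bsub>G\<^esub> h \<in> H" using subgroup.m_closed[OF H] Hc(2)[OF that(2)] by blast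
    then show "x \<in> H" using that Hc[OF that(2)] by (simp add: G.m_assoc)
  qed (use subgroup.m_closed[OF H] that in blast)
  have Hm: "inv\<^bsub>G\<^esub> h \<otimes>\<^bsub>G\<^esub> x \<in> H \<longleftrightarrow> x \<in> H" if "x \<in> carrier G" "h \<in> H" for x h
  proof
    assume "inv\<^bsub>G\<^esub> h \<otimes>\<^bsub>G\<^esub> x \<in> H"
    then have "h \<otimes>\<^bsub>G\<^esub> (inv\<^bsub>G\<^esub> h \<otimes>\<^bsub>G\<^esub> x) \<in> H" using subgroup.m_closed[OF H] that(2) by blast
    then show "x \<in> H" using that Hc[OF that(2)] by (simp add: G.m_assoc[symmetric])
  qed (use subgroup.m_closed[OF H] that Hc(2) in blast)
  show \<theta>: "\<theta> \<in> kG_hom (G\<lparr>carrier := H\<rparr>) ?I ?I"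
  proof (rule kG_homI)
    fix f assume f: "f \<in> carrier ?I"
    show "\<theta> f \<in> carrier ?I"
      using f HG V.zero_mem V.act_zero Hc(2) by (auto simp: \<theta>_def induced_sel mH)
    show "\<theta> (f + f') = \<theta> f + \<theta> f'" for f' by (auto simp: \<theta>_def fun_eq_iff)
    show "\<theta> (scal ?I c f) = scal ?I c (\<theta> f)" for c by (auto simp: \<theta>_def fun_eq_iff induced_sel)
    show "\<theta> (act ?I g f) = act ?I g (\<theta> f)" if "g \<in> carrier (G\<lparr>carrier := H\<rparr>)" for g
      using that HG by (auto simp: \<theta>_def fun_eq_iff induced_sel Hm)
  qed
  assume f: "f \<in> carrier ?I"
  show "rel_trace G H ?I ?I \<theta> f = f"
  proof
    fix y
    show "rel_trace G H ?I ?I \<theta> f y = f y"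
    proof (cases "y \<in> carrier G")
      case True
      have *: "act ?I t (\<theta> (act ?I (inv\<^bsub>G\<^esub> t) f)) y = (if t <#\<^bsub>G\<^esub> H = y <#\<^bsub>G\<^esub> H then f y else 0)"
        if t: "t \<in> carrier G" for t
      proof -
        have "inv\<^bsub>G\<^esub> t \<otimes>\<^bsub>G\<^esub> y \<in> H \<longleftrightarrow> t <#\<^bsub>G\<^esub> H = y <#\<^bsub>G\<^esub> H"
        proof
          assume h: "inv\<^bsub>G\<^esub> t \<otimes>\<^bsub>G\<^esub> y \<in> H"
          have "y = t \<otimes>\<^bsub>G\<^esub> (inv\<^bsub>G\<^esub> t \<otimes>\<^bsub>G\<^esub> y)" using t True by (simp add: G.m_assoc[symmetric])
          then have "y \<in> t <#\<^bsub>G\<^esub> H" unfolding l_coset_def using h by blast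
          then show "t <#\<^bsub>G\<^esub> H = y <#\<^bsub>G\<^esub> H" using G.l_repr_independence[OF _ t H] by blast
        next
          assume "t <#\<^bsub>G\<^esub> H = y <#\<^bsub>G\<^esub> H"
          moreover have "y \<otimes>\<^bsub>G\<^esub> \<one>\<^bsub>G\<^esub> \<in> y <#\<^bsub>G\<^esub> H"
            unfolding l_coset_def using subgroup.one_closed[OF H] by blast
          ultimately obtain h where "h \<in> H" "y = t \<otimes>\<^bsub>G\<^esub> h" unfolding l_coset_def using True by auto
          then show "inv\<^bsub>G\<^esub> t \<otimes>\<^bsub>G\<^esub> y \<in> H" using t Hc by (simp add: G.m_assoc[symmetric])
        qed
        then show ?thesis
          using t True by (simp add: induced_sel(3) \<theta>_def G.m_assoc[symmetric])
      qed
      have "rel_trace G H ?I ?I \<theta> f y =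
          coset_sum G H (\<lambda>t. if t <#\<^bsub>G\<^esub> H = y <#\<^bsub>G\<^esub> H then f y else 0)"
        unfolding rel_trace_def coset_sum_fun_apply by (rule G.coset_sum_cong[OF H *])
      also have "\<dots> = (\<Sum>C\<in>(\<lambda>x. x <#\<^bsub>G\<^esub> H) ` carrier G. if C = y <#\<^bsub>G\<^esub> H then f y else 0)"
        unfolding coset_sum_def
      proof (intro sum.cong refl)
        fix C assume "C \<in> (\<lambda>x. x <#\<^bsub>G\<^esub> H) ` carrier G"
        then obtain x where x: "x \<in> carrier G" "C = x <#\<^bsub>G\<^esub> H" by blast
        obtain h where h: "h \<in> H" "(SOME x. x \<in> C) = x \<otimes>\<^bsub>G\<^esub> h"
          using G.some_in_coset[OF H x(1)] x(2) by blast
        have "(SOME x. x \<in> C) \<in> C" unfolding h(2) unfolding x(2) l_coset_def using h(1) by blast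
        then have "(SOME x. x \<in> C) <#\<^bsub>G\<^esub> H = C" using G.l_repr_independence[OF _ x(1) H] x(2) by blast
        then show "(if (SOME x. x \<in> C) <#\<^bsub>G\<^esub> H = y <#\<^bsub>G\<^esub> H then f y else 0) =
            (if C = y <#\<^bsub>G\<^esub> H then f y else 0)" by simp
      qed
      also have "\<dots> = f y" using fin True by simp
      finally show ?thesis .
    next
      case False
      then have "f y = 0" using f by (simp add: induced_sel)
      then show ?thesis
        using False unfolding rel_trace_def coset_sum_def by (simp add: sum_fun_apply induced_sel(3))
    qed
  qed
qed

text \<open>From projectivity to a trace: the identity of the induced module is a trace by
  \<open>induced_trace\<close>, and composing \<theta> with the inclusion and the retraction
  compresses this to the summand.\<close>

lemma relatively_projective_trace:
  fixes M :: "('g, 'k::field, 'v::ab_group_add) kG_mod"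
  assumes fin: "finite (carrier G)" and G: "group G" and H: "subgroup H G"
    and rp: "relatively_projective G H M"
  shows "\<exists>\<theta>\<in>kG_hom (G\<lparr>carrier := H\<rparr>) M M. \<forall>m\<in>carrier M. rel_trace G H M M \<theta> m = m"
proof -
  obtain V :: "('g, 'k, nat \<Rightarrow> 'k) kG_mod" where V: "kG_module (G\<lparr>carrier := H\<rparr>) V"
    and ds: "direct_summand G M (induced G H V)"
    using rp unfolding relatively_projective_def by blast
  let ?I = "induced G H V"
  interpret I: kG_module G ?I by (rule kG_module_induced[OF fin G H V])
  note Ir = I.kG_rep_axioms
  obtain i q where i: "i \<in> kG_hom G M ?I" and q: "q \<in> kG_hom G ?I M"
    and qi: "\<And>u. u \<in> carrier M \<Longrightarrow> q (i u) = u"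
    using direct_summand_retract[OF Ir ds] by blast
  obtain \<theta> where \<theta>: "\<theta> \<in> kG_hom (G\<lparr>carrier := H\<rparr>) ?I ?I"
    and tr: "\<And>f. f \<in> carrier ?I \<Longrightarrow> rel_trace G H ?I ?I \<theta> f = f"
    using induced_trace[OF fin G H V] by blast
  note HG = subgroup.subset[OF H]
  have "rel_trace G H M M (\<lambda>x. q (\<theta> (i x))) m = m" if m: "m \<in> carrier M" for m
    using rel_trace_comp[OF Ir Ir H \<theta> i q m] tr[OF kG_hom_mem[OF i m]] qi[OF m] by simp
  moreover have "(\<lambda>x. q (\<theta> (i x))) \<in> kG_hom (G\<lparr>carrier := H\<rparr>) M M"
    by (rule kG_hom_comp[OF kG_hom_comp[OF kG_hom_restrict[OF i HG] \<theta>] kG_hom_restrict[OF q HG]])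
  ultimately show ?thesis by blast
qed

text \<open>From a trace to projectivity: in tensor notation \<open>\<alpha>\<close> sends u to the
  sum of x \<otimes> \<theta>(x^-1 u) and \<open>\<beta>\<close> sends x \<otimes> v to x v, so that
  \<beta> \<alpha> is the relative trace of \<theta>. The maps \<open>j\<close> and
  \<open>j'\<close> only pass to a copy of U on \<open>nat \<Rightarrow> 'k\<close>.\<close>

lemma trace_relatively_projective:
  fixes U :: "('g, 'k::field, 'v::ab_group_add) kG_mod"
  assumes fin: "finite (carrier G)" and U: "kG_module G U" and H: "subgroup H G"
    and \<theta>: "\<theta> \<in> kG_hom (G\<lparr>carrier := H\<rparr>) U U"
    and tr: "\<And>u. u \<in> carrier U \<Longrightarrow> rel_trace G H U U \<theta> u = u"
  shows "relatively_projective G H U"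
proof -
  interpret U: kG_module G U by fact
  have HG: "H \<subseteq> carrier G" using H by (rule subgroup.subset)
  then have Hc: "h \<in> carrier G" "inv\<^bsub>G\<^esub> h \<in> H" if "h \<in> H" for h
    using that subgroup.m_inv_closed[OF H] by blast+
  have finH: "finite (carrier (G\<lparr>carrier := H\<rparr>))" using fin HG finite_subset by simp
  have "kG_module (G\<lparr>carrier := H\<rparr>) U"
    using U.kG_rep_restrict[OF H] U kG_module_iff[OF fin] kG_module_iff[OF finH] by blast
  then obtain V :: "('g, 'k, nat \<Rightarrow> 'k) kG_mod" and j j' where V: "kG_module (G\<lparr>carrier := H\<rparr>) V"
    and j: "j \<in> kG_hom (G\<lparr>carrier := H\<rparr>) U V" and j': "j' \<in> kG_hom (G\<lparr>carrier := H\<rparr>) V U"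
    and j'j: "\<And>u. u \<in> carrier U \<Longrightarrow> j' (j u) = u"
    using kG_module_coordinates[OF finH] by blast
  interpret V: kG_module "G\<lparr>carrier := H\<rparr>" V by fact
  let ?I = "induced G H V"
  interpret I: kG_module G ?I by (rule kG_module_induced[OF fin U.is_group H V])
  define \<alpha> where "\<alpha> u = (\<lambda>x. if x \<in> carrier G then j (\<theta> (act U (inv\<^bsub>G\<^esub> x) u)) else 0)" for u
  define \<beta> where "\<beta> f = coset_sum G H (\<lambda>x. act U x (j' (f x)))" for f
  have ic: "act U (inv\<^bsub>G\<^esub> x) u \<in> carrier U" if "x \<in> carrier G" "u \<in> carrier U" for x u
    using that by (simp add: U.act_closed)
  note jh = kG_homD[OF j, simplified] and jh' = kG_homD[OF j', simplified]
    and \<theta>h = kG_homD[OF \<theta>, simplified]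
  have \<alpha>: "\<alpha> \<in> kG_hom G U ?I"
  proof (rule kG_homI)
    fix u assume u: "u \<in> carrier U"
    have "j (\<theta> (act U (inv\<^bsub>G\<^esub> (x \<otimes>\<^bsub>G\<^esub> h)) u)) = act V (inv\<^bsub>G\<^esub> h) (j (\<theta> (act U (inv\<^bsub>G\<^esub> x) u)))"
      if "x \<in> carrier G" "h \<in> H" for x h
      using that Hc[OF that(2)] u by (simp add: U.inv_mult_group U.act_mult ic jh \<theta>h)
    then show "\<alpha> u \<in> carrier ?I"
      using u Hc by (simp add: induced_sel \<alpha>_def jh \<theta>h ic)
    show "\<alpha> (u + v) = \<alpha> u + \<alpha> v" if "v \<in> carrier U" for v
      using u that by (simp add: fun_eq_iff \<alpha>_def U.act_add ic jh \<theta>h)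
    show "\<alpha> (scal U c u) = scal ?I c (\<alpha> u)" for c
      using u by (simp add: fun_eq_iff \<alpha>_def U.act_scal ic jh \<theta>h induced_sel)
    show "\<alpha> (act U g u) = act ?I g (\<alpha> u)" if "g \<in> carrier G" for g
      using u that by (simp add: fun_eq_iff \<alpha>_def induced_sel U.inv_mult_group U.act_mult)
  qed
  have fV: "f x \<in> carrier V" if "f \<in> carrier ?I" "x \<in> carrier G" for f x
    using that by (simp add: induced_sel)
  have \<beta>: "\<beta> \<in> kG_hom G ?I U"
  proof (rule kG_homI)
    fix f assume f: "f \<in> carrier ?I"
    note fV = fV[OF f]
    show "\<beta> f \<in> carrier U"
      unfolding \<beta>_def by (intro U.coset_sum_mem[OF H] U.act_closed jh' fV)
    show "\<beta> (f + f') = \<beta> f + \<beta> f'" if f': "f' \<in> carrier ?I" for f'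
    proof -
      have "\<beta> (f + f') = coset_sum G H (\<lambda>x. act U x (j' (f x)) + act U x (j' (f' x)))"
        unfolding \<beta>_def using f f'
        by (intro U.coset_sum_cong[OF H]) (simp add: jh' U.act_add induced_sel)
      then show ?thesis unfolding \<beta>_def coset_sum_def by (simp add: sum.distrib)
    qed
    show "\<beta> (scal ?I c f) = scal U c (\<beta> f)" for c
    proof -
      have "\<beta> (scal ?I c f) = coset_sum G H (\<lambda>x. scal U c (act U x (j' (f x))))"
        unfolding \<beta>_def using fV
        by (intro U.coset_sum_cong[OF H]) (simp add: jh' U.act_scal induced_sel)
      then show ?thesis unfolding \<beta>_def coset_sum_def by (simp add: U.scale_sum_right)
    qed
    fix g assume g: "g \<in> carrier G"
    have gf: "act ?I g f \<in> carrier ?I" by (rule I.act_closed[OF g f])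
    \<comment> \<open>The defining relation f(xh) = h^-1 f(x) of the induced module makes the sum in
      \<beta> independent of representatives, which the translation by g requires.\<close>
    have inv: "coset_invariant G H (\<lambda>x. act U x (j' (act ?I g f x)))"
      unfolding coset_invariant_def
    proof (intro ballI)
      fix x h assume x: "x \<in> carrier G" and h: "h \<in> H"
      have "act ?I g f (x \<otimes>\<^bsub>G\<^esub> h) = act V (inv\<^bsub>G\<^esub> h) (act ?I g f x)"
        using gf x h unfolding induced_sel(1) by blast
      moreover have "act ?I g f x \<in> carrier V" using gf x by (simp add: induced_sel(1))
      ultimately show "act U (x \<otimes>\<^bsub>G\<^esub> h) (j' (act ?I g f (x \<otimes>\<^bsub>G\<^esub> h))) = act U x (j' (act ?I g f x))"
        using x h Hc[OF h] by (simp add: jh' U.act_mult U.act_closed U.act_inv_cancel)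
    qed
    have "\<beta> (act ?I g f) = coset_sum G H (\<lambda>x. act U (g \<otimes>\<^bsub>G\<^esub> x) (j' (act ?I g f (g \<otimes>\<^bsub>G\<^esub> x))))"
      unfolding \<beta>_def by (rule U.coset_sum_translate[OF H inv g, symmetric])
    also have "\<dots> = coset_sum G H (\<lambda>x. act U g (act U x (j' (f x))))"
      using g fV by (intro U.coset_sum_cong[OF H])
        (simp add: induced_sel U.m_assoc[symmetric] U.act_mult jh')
    also have "\<dots> = act U g (\<beta> f)"
      unfolding \<beta>_def coset_sum_def
      by (rule U.act_sum[symmetric, OF g])
        (auto intro!: U.act_closed jh' fV U.some_coset_closed[OF H])
    finally show "\<beta> (act ?I g f) = act U g (\<beta> f)" .
  qed
  have "\<beta> (\<alpha> u) = u" if u: "u \<in> carrier U" for u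
  proof -
    have "\<beta> (\<alpha> u) = rel_trace G H U U \<theta> u"
      unfolding \<beta>_def rel_trace_def
      by (rule U.coset_sum_cong[OF H]) (simp add: \<alpha>_def j'j \<theta>h ic u)
    then show ?thesis using tr[OF u] by simp
  qed
  then have "direct_summand G U ?I"
    by (rule retract_direct_summand[OF fin U I.kG_module_axioms \<alpha> \<beta>])
  then show ?thesis using V unfolding relatively_projective_def by blast
qed

section \<open>Conjugating \<open>p\<close>-subgroups into a Sylow subgroup\<close>

context group
begin

text \<open>The inverse turns right multiplication into a left action. The restricted abstraction is
  there because \<open>Bij\<close> consists of extensional functions.\<close>

lemma rcosets_action:
  assumes P: "subgroup P G" and Q: "subgroup Q G"
  shows "group_action (G\<lparr>carrier := Q\<rparr>) (rcosets P) (\<lambda>q. \<lambda>C\<in>rcosets P. C #> inv q)"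
    (is "group_action ?Q ?E ?\<phi>")
proof -
  have PG: "P \<subseteq> carrier G" and QG: "Q \<subseteq> carrier G"
    using P Q subgroup.subset by blast+
  have Q': "inv q \<in> carrier G" "q \<in> carrier G" if "q \<in> Q" for q using that QG by auto
  have cl: "C #> g \<in> ?E" if C: "C \<in> ?E" and g: "g \<in> carrier G" for C g
  proof -
    obtain x where "x \<in> carrier G" "C = P #> x" using C by (auto simp: RCOSETS_def)
    then show ?thesis using g PG rcosetsI[OF PG, of "x \<otimes> g"] by (simp add: coset_mult_assoc)
  qed
  have sub: "C \<subseteq> carrier G" if "C \<in> ?E" for C
    using that rcosets_part_G[OF P] by blast
  have Bij: "?\<phi> q \<in> Bij ?E" if q: "q \<in> Q" for q
  proof -
    have "bij_betw (\<lambda>C. C #> inv q) ?E ?E"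
      using q Q' cl sub coset_mult_assoc
      by (intro bij_betwI[where g = "\<lambda>C. C #> q"]) (auto simp: coset_mult_assoc)
    then have "bij_betw (?\<phi> q) ?E ?E" by (simp cong: bij_betw_cong)
    then show ?thesis by (simp add: Bij_def)
  qed
  have "?\<phi> (a \<otimes> b) = compose ?E (?\<phi> a) (?\<phi> b)" if "a \<in> Q" "b \<in> Q" for a b
  proof
    fix C
    show "?\<phi> (a \<otimes> b) C = compose ?E (?\<phi> a) (?\<phi> b) C"
      using that Q' cl sub
      by (cases "C \<in> ?E") (simp_all add: compose_def coset_mult_assoc inv_mult_group)
  qed
  then have "?\<phi> \<in> hom ?Q (BijGroup ?E)"
    using Bij by (intro homI) (simp_all add: BijGroup_def)
  moreover have "Group.group ?Q" using Q subgroup.subgroup_is_group is_group by blast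
  ultimately show ?thesis
    unfolding group_action_def group_hom_def group_hom_axioms_def using group_BijGroup by blast
qed

end

text \<open>Q acts on the right cosets of P, whose number is prime to p, with orbits of p-power
  length. So some coset Px is fixed, and Pxq = Px for all q in Q says that x Q x^-1 lies in
  P.\<close>

lemma p_subgroup_conj_into_sylow:
  fixes G :: "'g monoid"
  assumes G: "group G" and fin: "finite (carrier G)" and p: "prime p"
    and P: "sylow_subgroup G p P" and Q: "p_subgroup G p Q"
  shows "\<exists>g\<in>carrier G. (\<lambda>h. g \<otimes>\<^bsub>G\<^esub> h \<otimes>\<^bsub>G\<^esub> inv\<^bsub>G\<^esub> g) ` Q \<subseteq> P"
proof -
  interpret group G by fact
  have Ps: "subgroup P G" and Pc: "card P = p ^ multiplicity p (card (carrier G))"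
    using P unfolding sylow_subgroup_def by blast+
  obtain n where Qs: "subgroup Q G" and Qc: "card Q = p ^ n" using Q unfolding p_subgroup_def by blast
  have PG: "P \<subseteq> carrier G" and QG: "Q \<subseteq> carrier G"
    using Ps Qs subgroup.subset by blast+
  define E where "E = rcosets\<^bsub>G\<^esub> P"
  define \<phi> where "\<phi> = (\<lambda>q. \<lambda>C\<in>E. C #>\<^bsub>G\<^esub> inv\<^bsub>G\<^esub> q)"
  interpret A: group_action "G\<lparr>carrier := Q\<rparr>" E \<phi>
    unfolding E_def \<phi>_def by (rule rcosets_action[OF Ps Qs])
  have finE: "finite E" unfolding E_def RCOSETS_def using fin by auto
  have cG: "card (carrier G) \<noteq> 0" using fin one_closed by (auto simp: card_eq_0_iff)
  have "card E * card P = card (carrier G)"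
    using lagrange[OF Ps] unfolding E_def order_def .
  \<comment> \<open>\<open>card P\<close> is the full p-part of the group order, so a factor p in
    the index would give one power of p too many.\<close>
  then have npE: "\<not> p dvd card E"
  proof (intro notI)
    assume e: "card E * card P = card (carrier G)" and "p dvd card E"
    then have "p * card P dvd card E * card P" by (intro mult_dvd_mono) simp_all
    then have "p ^ Suc (multiplicity p (card (carrier G))) dvd card (carrier G)"
      by (simp add: e) (simp add: Pc)
    moreover have "\<not> p ^ Suc (multiplicity p (card (carrier G))) dvd card (carrier G)"
      using cG p by (subst power_dvd_iff_le_multiplicity) auto
    ultimately show False by blast
  qed
  have "\<exists>C\<in>E. card (orbit (G\<lparr>carrier := Q\<rparr>) \<phi> C) = 1"
  proof (rule ccontr)
    assume no: "\<not> ?thesis"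
    have "p dvd card (orbit (G\<lparr>carrier := Q\<rparr>) \<phi> C)" if C: "C \<in> E" for C
    proof -
      have "card (orbit (G\<lparr>carrier := Q\<rparr>) \<phi> C) dvd p ^ n"
        using A.orbit_stabilizer_theorem[OF C] Qc by (simp add: order_def) (metis dvd_triv_left)
      then obtain k where k: "card (orbit (G\<lparr>carrier := Q\<rparr>) \<phi> C) = p ^ k"
        using divides_primepow_nat[OF p] by blast
      moreover have "k \<noteq> 0" using no C k by force
      ultimately show ?thesis by simp
    qed
    then have "p dvd card orb" if "orb \<in> orbits (G\<lparr>carrier := Q\<rparr>) E \<phi>" for orb
      using that unfolding orbits_def by blast
    then have "p dvd (\<Sum>orb\<in>orbits (G\<lparr>carrier := Q\<rparr>) E \<phi>. card orb)" by (intro dvd_sum)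
    also have "(\<Sum>orb\<in>orbits (G\<lparr>carrier := Q\<rparr>) E \<phi>. card orb) = card E"
      using A.disjoint_sum[OF finE, of "\<lambda>x. 1::nat"] by simp
    finally show False using npE by blast
  qed
  then obtain C where C: "C \<in> E" and c1: "card (orbit (G\<lparr>carrier := Q\<rparr>) \<phi> C) = 1" by blast
  obtain x where x: "x \<in> carrier G" "C = P #>\<^bsub>G\<^esub> x" using C unfolding E_def RCOSETS_def by blast
  have "x \<otimes>\<^bsub>G\<^esub> q \<otimes>\<^bsub>G\<^esub> inv\<^bsub>G\<^esub> x \<in> P" if q: "q \<in> Q" for q
  proof -
    have qc: "q \<in> carrier G" and iq: "inv\<^bsub>G\<^esub> q \<in> Q" using q QG subgroup.m_inv_closed[OF Qs] by blast+
    have "C \<in> orbit (G\<lparr>carrier := Q\<rparr>) \<phi> C" using A.orbit_refl[OF C] .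
    moreover have "\<phi> (inv\<^bsub>G\<^esub> q) C \<in> orbit (G\<lparr>carrier := Q\<rparr>) \<phi> C" using iq unfolding orbit_def by auto
    ultimately have "\<phi> (inv\<^bsub>G\<^esub> q) C = C" using c1 by (metis card_1_singletonE singletonD)
    then have "P #>\<^bsub>G\<^esub> x #>\<^bsub>G\<^esub> q = P #>\<^bsub>G\<^esub> x" using C qc x unfolding \<phi>_def by simp
    then have "P #>\<^bsub>G\<^esub> (x \<otimes>\<^bsub>G\<^esub> q) #>\<^bsub>G\<^esub> inv\<^bsub>G\<^esub> x = P #>\<^bsub>G\<^esub> x #>\<^bsub>G\<^esub> inv\<^bsub>G\<^esub> x" using x qc PG by (simp add: coset_mult_assoc)
    then have "P #>\<^bsub>G\<^esub> (x \<otimes>\<^bsub>G\<^esub> q \<otimes>\<^bsub>G\<^esub> inv\<^bsub>G\<^esub> x) = P" using x qc PG by (simp add: coset_mult_assoc)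
    then show ?thesis using coset_join1[OF _ _ Ps] x qc PG by simp
  qed
  then show ?thesis using x(1) by blast
qed

text \<open>R is the conjugate of Q inside P; it is proper because equality of orders would make Q a
  Sylow subgroup. Moving the trace from Q to R contradicts the minimality in
  \<open>is_vertex\<close>.\<close>

lemma vertex_not_smaller_trace:
  fixes U :: "('g, 'k::field, 'v::ab_group_add) kG_mod"
  assumes G: "group G" and fin: "finite (carrier G)" and p: "prime p"
    and v: "is_vertex G U P" and P: "sylow_subgroup G p P"
    and F: "F = {Q. p_subgroup G p Q \<and> \<not> sylow_subgroup G p Q}"
  shows "(\<lambda>x. x) \<notin> trace_ideal G F U U"
proof
  assume id: "(\<lambda>x. x) \<in> trace_ideal G F U U"
  interpret G: group G by fact
  have ind: "indecomposable G U" using v unfolding is_vertex_def by blast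
  then have "kG_module G U" unfolding indecomposable_def by blast
  then interpret U: kG_module G U .
  have Fs: "\<And>Q. Q \<in> F \<Longrightarrow> subgroup Q G" unfolding F p_subgroup_def by blast
  have "F \<subseteq> Pow (carrier G)" using Fs subgroup.subset by blast
  then have Ff: "finite F" using fin finite_subset by blast
  obtain Q \<theta> where Q: "Q \<in> F" and \<theta>: "\<theta> \<in> kG_hom (G\<lparr>carrier := Q\<rparr>) U U"
    and tr: "\<forall>u\<in>carrier U. rel_trace G Q U U \<theta> u = u"
    using indecomposable_single_trace[OF fin ind Fs Ff id] by blast
  have Qp: "p_subgroup G p Q" "\<not> sylow_subgroup G p Q" using Q F by blast+
  obtain g where g: "g \<in> carrier G" and sub: "(\<lambda>h. g \<otimes>\<^bsub>G\<^esub> h \<otimes>\<^bsub>G\<^esub> inv\<^bsub>G\<^esub> g) ` Q \<subseteq> P"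
    using p_subgroup_conj_into_sylow[OF G fin p P Qp(1)] by blast
  define R where "R = (\<lambda>h. g \<otimes>\<^bsub>G\<^esub> h \<otimes>\<^bsub>G\<^esub> inv\<^bsub>G\<^esub> g) ` Q"
  have R: "subgroup R G" unfolding R_def by (rule G.conj_subgroup[OF Fs[OF Q] g])
  have QG: "Q \<subseteq> carrier G" using Fs[OF Q] by (rule subgroup.subset)
  have "inj_on (\<lambda>h. g \<otimes>\<^bsub>G\<^esub> h \<otimes>\<^bsub>G\<^esub> inv\<^bsub>G\<^esub> g) Q"
    using QG g by (intro inj_onI) (auto simp: subset_iff)
  then have "card R = card Q" unfolding R_def by (rule card_image)
  moreover have "card Q \<noteq> card P"
    using Qp Fs[OF Q] P unfolding sylow_subgroup_def by auto
  ultimately have "R \<subset> P" using sub unfolding R_def by auto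
  moreover have "relatively_projective G R U"
  proof -
    obtain \<eta> where "\<eta> \<in> kG_hom (G\<lparr>carrier := R\<rparr>) U U"
      "\<forall>a\<in>carrier U. rel_trace G R U U \<eta> a = rel_trace G Q U U \<theta> a"
      using rel_trace_conj[OF U.kG_rep_axioms Fs[OF Q] g \<theta>] unfolding R_def by blast
    then show ?thesis
      using trace_relatively_projective[OF fin U.kG_module_axioms R, of \<eta>] tr by simp
  qed
  ultimately show False using v R unfolding is_vertex_def by blast
qed

section \<open>Duality\<close>

text \<open>The trivial module on the field itself, so that a linear map into it is literally a
  functional and a \<open>G\<close>-homomorphism into it an invariant one.\<close>

definition trivial_line :: "('g, 'k::field, 'k) kG_mod" where
  "trivial_line = \<lparr>carrier = UNIV, scal = (*), act = (\<lambda>g v. v)\<rparr>"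

lemma trivial_line_sel [simp]:
  "carrier trivial_line = UNIV" "scal trivial_line = (*)" "act trivial_line g v = v"
  by (simp_all add: trivial_line_def)

lemma kG_rep_trivial_line:
  fixes G :: "'g monoid"
  assumes "group G" shows "kG_rep G (trivial_line :: ('g, 'k::field, 'k) kG_mod)"
proof -
  have vs: "vector_space (scal (trivial_line :: ('g, 'k, 'k) kG_mod))"
    by unfold_locales (simp_all add: algebra_simps)
  then show ?thesis
    unfolding kG_rep_def kG_rep_axioms_def
    using assms module.subspace_UNIV[OF vs[folded module_iff_vector_space]] by simp
qed

abbreviation dual_mod :: "'g monoid \<Rightarrow> ('g, 'k::field, 'v::ab_group_add) kG_mod \<Rightarrow> ('g, 'k, 'v \<Rightarrow> 'k) kG_mod" where
  "dual_mod G U \<equiv> Hom_mod G U trivial_line"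

lemma dual_mod_dest:
  assumes "\<xi> \<in> carrier (dual_mod G U)"
  shows dual_mod_add: "\<lbrakk>u \<in> carrier U; v \<in> carrier U\<rbrakk> \<Longrightarrow> \<xi> (u + v) = \<xi> u + \<xi> v"
    and dual_mod_scal: "u \<in> carrier U \<Longrightarrow> \<xi> (scal U c u) = c * \<xi> u"
  using kG_homD[OF Hom_mod_hom[OF assms]] by simp_all

definition basis_of :: "('g, 'k::field, 'v::ab_group_add) kG_mod \<Rightarrow> 'v set \<Rightarrow> bool" where
  "basis_of U B \<longleftrightarrow> finite B \<and> B \<subseteq> carrier U \<and> \<not> module.dependent (scal U) B \<and>
     module.span (scal U) B = carrier U"

text \<open>For b in B these form the dual basis, extended by zero in order to be elements of
  \<open>dual_mod G U\<close>.\<close>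

definition coord :: "('g, 'k::field, 'v::ab_group_add) kG_mod \<Rightarrow> 'v set \<Rightarrow> 'v \<Rightarrow> 'v \<Rightarrow> 'k" where
  "coord U B b = zero_ext U (\<lambda>u. module.representation (scal U) B u b)"

lemma coord_dual:
  assumes U: "kG_rep G U" and B: "basis_of U B"
  shows "coord U B b \<in> carrier (dual_mod G U)"
proof -
  interpret U: kG_rep G U by fact
  have "(\<lambda>u. U.representation B u b) \<in> kG_hom (G\<lparr>carrier := {}\<rparr>) U trivial_line"
    using B unfolding basis_of_def
    by (intro kG_homI) (simp_all add: U.representation_add U.representation_scale)
  then show ?thesis unfolding coord_def by (rule zero_ext_mem_Hom_mod[OF U])
qed

lemma coord_sum:
  assumes U: "kG_rep G U" and B: "basis_of U B" and u: "u \<in> carrier U"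
  shows "(\<Sum>b\<in>B. scal U (coord U B b u) b) = u"
proof -
  interpret U: kG_rep G U by fact
  show ?thesis
    using B u U.sum_representation_eq[of B u B] unfolding basis_of_def by (simp add: coord_def)
qed

lemma ex_basis_of:
  assumes "finite (carrier G)" and U: "kG_module G U"
  obtains B where "basis_of U B"
proof -
  interpret U: kG_module G U by fact
  obtain T where T: "finite T" "carrier U \<subseteq> U.span T"
    using U kG_module_iff[OF assms(1)] unfolding fin_dim_def by blast
  show ?thesis
    using U.finite_basis_within[OF U.carrier_subspace T(2,1) U.independent_empty empty_subsetI] that
    unfolding basis_of_def by blast
qed

lemma dual_separates:
  assumes fin: "finite (carrier G)" and U: "kG_module G U"
    and u: "u \<in> carrier U" "v \<in> carrier U" and eq: "\<And>\<xi>. \<xi> \<in> carrier (dual_mod G U) \<Longrightarrow> \<xi> u = \<xi> v"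
  shows "u = v"
proof -
  interpret U: kG_module G U by fact
  obtain B where B: "basis_of U B" using ex_basis_of[OF fin U] by blast
  have "u = (\<Sum>b\<in>B. scal U (coord U B b u) b)" using coord_sum[OF U.kG_rep_axioms B u(1)] by simp
  also have "\<dots> = (\<Sum>b\<in>B. scal U (coord U B b v) b)"
    using eq[OF coord_dual[OF U.kG_rep_axioms B]] by simp
  also have "\<dots> = v" using coord_sum[OF U.kG_rep_axioms B u(2)] by simp
  finally show ?thesis .
qed

text \<open>Surjectivity of the map into the bidual, by finite dimension: u is the vector whose
  coordinates are the values of \<phi> on the dual basis.\<close>

lemma dual_reflexive:
  assumes fin: "finite (carrier G)" and U: "kG_module G U"
    and \<phi>: "\<phi> \<in> kG_hom L (dual_mod G U) trivial_line"
  shows "\<exists>u\<in>carrier U. \<forall>\<xi>\<in>carrier (dual_mod G U). \<xi> u = \<phi> \<xi>"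
proof -
  interpret U: kG_module G U by fact
  have D: "kG_rep G (dual_mod G U)"
    by (rule kG_rep_Hom_mod[OF U.kG_rep_axioms kG_rep_trivial_line[OF U.is_group]])
  interpret D: kG_rep G "dual_mod G U" by (rule D)
  obtain B where B: "basis_of U B" using ex_basis_of[OF fin U] by blast
  have BU: "b \<in> carrier U" if "b \<in> B" for b using B that unfolding basis_of_def by blast
  define u where "u = (\<Sum>b\<in>B. scal U (\<phi> (coord U B b)) b)"
  have "\<xi> u = \<phi> \<xi>" if \<xi>: "\<xi> \<in> carrier (dual_mod G U)" for \<xi>
  proof -
    note c = coord_dual[OF U.kG_rep_axioms B]
    \<comment> \<open>Expansion of \<xi> in the dual basis; its coefficients are the values of \<xi>
      on B.\<close>
    have "\<xi> = (\<Sum>b\<in>B. scal (dual_mod G U) (\<xi> b) (coord U B b))"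
    proof (rule Hom_mod_eqI[OF \<xi>])
      show "(\<Sum>b\<in>B. scal (dual_mod G U) (\<xi> b) (coord U B b)) \<in> carrier (dual_mod G U)"
        by (intro D.sum_mem D.scal_mem c)
      fix v assume v: "v \<in> carrier U"
      have "\<xi> v = \<xi> (\<Sum>b\<in>B. scal U (coord U B b v) b)" using coord_sum[OF U.kG_rep_axioms B v] by simp
      also have "\<dots> = (\<Sum>b\<in>B. \<xi> (scal U (coord U B b v) b))"
        by (rule kG_hom_sum[OF U.kG_rep_axioms Hom_mod_hom[OF \<xi>]]) (simp add: BU U.scal_mem)
      also have "\<dots> = (\<Sum>b\<in>B. scal (dual_mod G U) (\<xi> b) (coord U B b)) v"
        unfolding sum_fun_apply by (intro sum.cong refl) (simp add: dual_mod_scal[OF \<xi>] BU mult.commute)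
      finally show "\<xi> v = (\<Sum>b\<in>B. scal (dual_mod G U) (\<xi> b) (coord U B b)) v" .
    qed
    then have "\<phi> \<xi> = \<phi> (\<Sum>b\<in>B. scal (dual_mod G U) (\<xi> b) (coord U B b))" by simp
    also have "\<dots> = (\<Sum>b\<in>B. \<phi> (scal (dual_mod G U) (\<xi> b) (coord U B b)))"
      by (rule kG_hom_sum[OF D \<phi>]) (rule D.scal_mem[OF c])
    also have "\<dots> = (\<Sum>b\<in>B. \<xi> b * \<phi> (coord U B b))"
      using kG_hom_scal[OF \<phi> c] by (simp del: Hom_mod_sel)
    also have "\<dots> = (\<Sum>b\<in>B. \<xi> (scal U (\<phi> (coord U B b)) b))"
      by (intro sum.cong refl) (simp add: dual_mod_scal[OF \<xi>] BU mult.commute)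
    also have "\<dots> = \<xi> u"
      unfolding u_def by (rule kG_hom_sum[OF U.kG_rep_axioms Hom_mod_hom[OF \<xi>], symmetric])
        (simp add: BU U.scal_mem)
    finally show ?thesis by simp
  qed
  moreover have "u \<in> carrier U" unfolding u_def by (intro U.sum_mem U.scal_mem BU)
  ultimately show ?thesis by blast
qed

text \<open>A map into U is constructed by prescribing every functional on its values:
  \<open>\<phi> y\<close> lies in the bidual, hence is evaluation at a vector \<open>h y\<close>.
  Functionals separate points, so linearity and equivariance of h reduce to those of \<phi>;
  \<open>act\<close> is equivariance in contragredient form.\<close>

lemma hom_from_dual_pairing:
  assumes fin: "finite (carrier G)" and U: "kG_module G U" and Y: "kG_rep G Y"
    and \<phi>: "\<And>y. y \<in> carrier Y \<Longrightarrow> \<phi> y \<in> kG_hom (G\<lparr>carrier := {}\<rparr>) (dual_mod G U) trivial_line"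
    and add: "\<And>y z \<xi>. \<lbrakk>y \<in> carrier Y; z \<in> carrier Y; \<xi> \<in> carrier (dual_mod G U)\<rbrakk> \<Longrightarrow>
      \<phi> (y + z) \<xi> = \<phi> y \<xi> + \<phi> z \<xi>"
    and scal: "\<And>c y \<xi>. \<lbrakk>y \<in> carrier Y; \<xi> \<in> carrier (dual_mod G U)\<rbrakk> \<Longrightarrow> \<phi> (scal Y c y) \<xi> = c * \<phi> y \<xi>"
    and act: "\<And>g y \<xi>. \<lbrakk>g \<in> carrier G; y \<in> carrier Y; \<xi> \<in> carrier (dual_mod G U)\<rbrakk> \<Longrightarrow>
      \<phi> (act Y g y) \<xi> = \<phi> y (act (dual_mod G U) (inv\<^bsub>G\<^esub> g) \<xi>)"
  shows "\<exists>h\<in>kG_hom G Y U. \<forall>y\<in>carrier Y. \<forall>\<xi>\<in>carrier (dual_mod G U). \<xi> (h y) = \<phi> y \<xi>"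
proof -
  interpret U: kG_module G U by fact
  interpret Y: kG_rep G Y by fact
  have D: "kG_rep G (dual_mod G U)"
    by (rule kG_rep_Hom_mod[OF U.kG_rep_axioms kG_rep_trivial_line[OF U.is_group]])
  interpret D: kG_rep G "dual_mod G U" by (rule D)
  have "\<forall>y\<in>carrier Y. \<exists>u. u \<in> carrier U \<and> (\<forall>\<xi>\<in>carrier (dual_mod G U). \<xi> u = \<phi> y \<xi>)"
    using dual_reflexive[OF fin U \<phi>] unfolding Bex_def by simp
  from bchoice[OF this] obtain h where "\<forall>y\<in>carrier Y. h y \<in> carrier U \<and> (\<forall>\<xi>\<in>carrier (dual_mod G U). \<xi> (h y) = \<phi> y \<xi>)"
    by blast
  then have h: "\<And>y. y \<in> carrier Y \<Longrightarrow> h y \<in> carrier U"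
    and hp: "\<And>y \<xi>. \<lbrakk>y \<in> carrier Y; \<xi> \<in> carrier (dual_mod G U)\<rbrakk> \<Longrightarrow> \<xi> (h y) = \<phi> y \<xi>"
    by blast+
  note sep = dual_separates[OF fin U]
  have "h \<in> kG_hom G Y U"
  proof (rule kG_homI)
    fix y assume y: "y \<in> carrier Y"
    show "h y \<in> carrier U" using h[OF y] .
    show "h (y + z) = h y + h z" if z: "z \<in> carrier Y" for z
      by (rule sep)
        (simp_all add: y z h hp U.add_mem Y.add_mem dual_mod_add add del: plus_fun_apply)
    show "h (scal Y c y) = scal U c (h y)" for c
      by (rule sep) (simp_all add: y h hp U.scal_mem Y.scal_mem dual_mod_scal scal)
    fix g assume g: "g \<in> carrier G"
    show "h (act Y g y) = act U g (h y)"
    proof (rule sep)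
      show "h (act Y g y) \<in> carrier U" "act U g (h y) \<in> carrier U"
        using g y h by (simp_all add: U.act_closed Y.act_closed)
      fix \<xi> assume \<xi>: "\<xi> \<in> carrier (dual_mod G U)"
      have "\<xi> (h (act Y g y)) = \<phi> (act Y g y) \<xi>" by (rule hp[OF Y.act_closed[OF g y] \<xi>])
      also have "\<dots> = \<phi> y (act (dual_mod G U) (inv\<^bsub>G\<^esub> g) \<xi>)" by (rule act[OF g y \<xi>])
      also have "\<dots> = act (dual_mod G U) (inv\<^bsub>G\<^esub> g) \<xi> (h y)"
        using g by (intro hp[symmetric] y D.act_closed \<xi>) simp
      also have "\<dots> = \<xi> (act U g (h y))" using g h[OF y] by simp
      finally show "\<xi> (h (act Y g y)) = \<xi> (act U g (h y))" .
    qed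
  qed
  then show ?thesis using hp by blast
qed

section \<open>Rank-one maps \<xi> \<otimes> v, and the dual of Hom(U, V)\<close>

definition rank_one :: "('g, 'k::field, 'v::ab_group_add) kG_mod \<Rightarrow> ('g, 'k, 'w::ab_group_add) kG_mod \<Rightarrow>
    ('v \<Rightarrow> 'k) \<Rightarrow> 'w \<Rightarrow> 'v \<Rightarrow> 'w" where
  "rank_one U V \<xi> v = zero_ext U (\<lambda>u. scal V (\<xi> u) v)"

context
  fixes G :: "'g monoid" and U :: "('g, 'k::field, 'u::ab_group_add) kG_mod"
    and V :: "('g, 'k, 'v::ab_group_add) kG_mod"
  assumes U: "kG_rep G U" and V: "kG_rep G V"
begin

interpretation U: kG_rep G U by (rule U)
interpretation V: kG_rep G V by (rule V)

lemma rank_one_mem: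
  assumes \<xi>: "\<xi> \<in> carrier (dual_mod G U)" and v: "v \<in> carrier V"
  shows "rank_one U V \<xi> v \<in> carrier (Hom_mod G U V)"
proof -
  have "(\<lambda>u. scal V (\<xi> u) v) \<in> kG_hom (G\<lparr>carrier := {}\<rparr>) U V"
    using v by (intro kG_homI)
      (simp_all add: V.scal_mem dual_mod_add[OF \<xi>] dual_mod_scal[OF \<xi>] V.scale_left_distrib)
  then show ?thesis unfolding rank_one_def by (rule zero_ext_mem_Hom_mod[OF U])
qed

lemma rank_one_linear:
  "rank_one U V (\<xi> + \<eta>) v = rank_one U V \<xi> v + rank_one U V \<eta> v"
  "rank_one U V \<xi> (v + w) = rank_one U V \<xi> v + rank_one U V \<xi> w"
  "rank_one U V (scal (dual_mod G U) c \<xi>) v = scal (Hom_mod G U V) c (rank_one U V \<xi> v)"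
  "rank_one U V \<xi> (scal V c v) = scal (Hom_mod G U V) c (rank_one U V \<xi> v)"
  by (auto simp: rank_one_def zero_ext_def fun_eq_iff V.scale_left_distrib V.scale_right_distrib mult.commute)

lemma rank_one_act:
  assumes "v \<in> carrier V" and g: "g \<in> carrier G"
  shows "act (Hom_mod G U V) g (rank_one U V \<xi> v) =
    rank_one U V (act (dual_mod G U) g \<xi>) (act V g v)"
  using assms U.act_closed[of "inv\<^bsub>G\<^esub> g"]
  by (auto simp: rank_one_def zero_ext_def fun_eq_iff V.act_scal)

lemma rank_one_hom_right:
  assumes \<xi>: "\<xi> \<in> carrier (dual_mod G U)"
  shows "rank_one U V \<xi> \<in> kG_hom (G\<lparr>carrier := {}\<rparr>) V (Hom_mod G U V)"
  by (rule kG_homI) (simp_all only: rank_one_mem[OF \<xi>] rank_one_linear, simp)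

lemma rank_one_hom_left:
  assumes v: "v \<in> carrier V"
  shows "(\<lambda>\<xi>. rank_one U V \<xi> v) \<in> kG_hom (G\<lparr>carrier := {}\<rparr>) (dual_mod G U) (Hom_mod G U V)"
  by (rule kG_homI) (simp_all only: rank_one_mem[OF _ v] rank_one_linear, simp)

text \<open>The action on the vector is traded for the inverse action on the functional, up to the
  action on the whole map, which an invariant l ignores. This is the shape of equivariance that
  \<open>hom_from_dual_pairing\<close> asks for.\<close>

lemma rank_one_act_shift:
  assumes \<xi>: "\<xi> \<in> carrier (dual_mod G U)" and v: "v \<in> carrier V" and g: "g \<in> carrier G"
  shows "rank_one U V \<xi> (act V g v) =
    act (Hom_mod G U V) g (rank_one U V (act (dual_mod G U) (inv\<^bsub>G\<^esub> g) \<xi>) v)"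
proof -
  interpret D: kG_rep G "dual_mod G U"
    by (rule kG_rep_Hom_mod[OF U kG_rep_trivial_line[OF U.is_group]])
  show ?thesis unfolding rank_one_act[OF v g] D.act_inv_cancel(2)[OF g \<xi>] ..
qed

text \<open>Rank-one maps therefore span Hom(U, V), and a functional on it is computed from its
  values on them.\<close>

lemma hom_coord_expansion:
  assumes f: "f \<in> kG_hom L U V" and B: "basis_of U B"
  shows "zero_ext U f = (\<Sum>b\<in>B. rank_one U V (coord U B b) (f b))"
proof
  fix u
  have BU: "b \<in> carrier U" if "b \<in> B" for b using B that unfolding basis_of_def by blast
  show "zero_ext U f u = (\<Sum>b\<in>B. rank_one U V (coord U B b) (f b)) u"
  proof (cases "u \<in> carrier U")
    case True
    have "f u = f (\<Sum>b\<in>B. scal U (coord U B b u) b)" using coord_sum[OF U B True] by simp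
    also have "\<dots> = (\<Sum>b\<in>B. f (scal U (coord U B b u) b))"
      by (rule kG_hom_sum[OF U f]) (simp add: BU U.scal_mem)
    also have "\<dots> = (\<Sum>b\<in>B. rank_one U V (coord U B b) (f b) u)"
      by (intro sum.cong refl) (simp add: rank_one_def True kG_hom_scal[OF f] BU)
    finally show ?thesis using True by (simp add: sum_fun_apply)
  qed (simp add: sum_fun_apply rank_one_def)
qed

text \<open>The trace of h composed with \<xi> \<otimes> v is \<xi>(h v), so this h is the one for
  which l is f \<mapsto> tr(h f). Invariance of l becomes equivariance of h.\<close>

lemma dual_of_hom_space:
  assumes fin: "finite (carrier G)" and Um: "kG_module G U"
    and l: "l \<in> kG_hom G (Hom_mod G U V) trivial_line"
  shows "\<exists>h\<in>kG_hom G V U. \<forall>v\<in>carrier V. \<forall>\<xi>\<in>carrier (dual_mod G U). \<xi> (h v) = l (rank_one U V \<xi> v)"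
proof (rule hom_from_dual_pairing[OF fin Um V])
  have l0: "l \<in> kG_hom (G\<lparr>carrier := {}\<rparr>) (Hom_mod G U V) trivial_line"
    by (rule kG_hom_restrict[OF l]) simp
  interpret D: kG_rep G "dual_mod G U"
    by (rule kG_rep_Hom_mod[OF U kG_rep_trivial_line[OF U.is_group]])
  show "(\<lambda>\<xi>. l (rank_one U V \<xi> v)) \<in> kG_hom (G\<lparr>carrier := {}\<rparr>) (dual_mod G U) trivial_line"
    if "v \<in> carrier V" for v
    by (rule kG_hom_comp[OF rank_one_hom_left[OF that] l0])
  fix \<xi> assume \<xi>: "\<xi> \<in> carrier (dual_mod G U)"
  have lr: "(\<lambda>v. l (rank_one U V \<xi> v)) \<in> kG_hom (G\<lparr>carrier := {}\<rparr>) V trivial_line"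
    by (rule kG_hom_comp[OF rank_one_hom_right[OF \<xi>] l0])
  fix v assume v: "v \<in> carrier V"
  show "l (rank_one U V \<xi> (v + w)) = l (rank_one U V \<xi> v) + l (rank_one U V \<xi> w)"
    if "w \<in> carrier V" for w by (rule kG_hom_add[OF lr v that])
  show "l (rank_one U V \<xi> (scal V c v)) = c * l (rank_one U V \<xi> v)" for c
    using kG_hom_scal[OF lr v] by simp
  fix g assume g: "g \<in> carrier G"
  have ig: "inv\<^bsub>G\<^esub> g \<in> carrier G" using g by simp
  have "l (rank_one U V \<xi> (act V g v)) =
      l (act (Hom_mod G U V) g (rank_one U V (act (dual_mod G U) (inv\<^bsub>G\<^esub> g) \<xi>) v))"
    unfolding rank_one_act_shift[OF \<xi> v g] ..
  also have "\<dots> = l (rank_one U V (act (dual_mod G U) (inv\<^bsub>G\<^esub> g) \<xi>) v)"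
    using kG_hom_act[OF l g rank_one_mem[OF D.act_closed[OF ig \<xi>] v]] unfolding trivial_line_sel .
  finally show "l (rank_one U V \<xi> (act V g v)) =
      l (rank_one U V (act (dual_mod G U) (inv\<^bsub>G\<^esub> g) \<xi>) v)" .
qed

end

text \<open>Extending bases along \<open>ker N \<subseteq> ker N\<^sup>2 \<subseteq> \<dots>\<close> makes the matrix of a nilpotent \<open>N\<close> strictly triangular.\<close>

lemma nilpotent_basis:
  assumes fin: "finite (carrier G)" and U: "kG_module G U"
    and N: "N \<in> kG_hom G U U" and nil: "\<And>u. u \<in> carrier U \<Longrightarrow> (N ^^ n) u = 0"
  obtains B where "basis_of U B" "\<And>b. b \<in> B \<Longrightarrow> coord U B b (N b) = 0"
proof -
  interpret U: kG_module G U by fact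
  note Ur = U.kG_rep_axioms
  obtain T where T: "finite T" "carrier U \<subseteq> U.span T"
    using U kG_module_iff[OF fin] unfolding fin_dim_def by blast
  define K where "K i = {u \<in> carrier U. (N ^^ i) u = 0}" for i
  have Ks: "U.subspace (K i)" for i
    unfolding K_def by (rule subspace_hom_kernel[OF Ur Ur kG_hom_funpow[OF N]])
  have KT: "K i \<subseteq> U.span T" for i using T(2) unfolding K_def by blast
  have "\<exists>B. finite B \<and> U.independent B \<and> U.span B = K i \<and> (\<forall>b\<in>B. U.representation B (N b) b = 0)" for i
  proof (induction i)
    case 0
    have "U.span {} = K 0" using U.zero_mem by (auto simp: K_def)
    then show ?case using U.independent_empty by blast
  next
    case (Suc i)
    then obtain B where B: "finite B" "U.independent B" "U.span B = K i"
      "\<forall>b\<in>B. U.representation B (N b) b = 0" by blast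
    have mono: "K i \<subseteq> K (Suc i)" unfolding K_def using kG_hom_0[OF Ur N] by auto
    have "B \<subseteq> K i" using U.span_superset[of B] B(3) by blast
    then have BK: "B \<subseteq> K (Suc i)" using mono by blast
    obtain C where C: "B \<subseteq> C" "C \<subseteq> K (Suc i)" "finite C" "U.independent C" "U.span C = K (Suc i)"
      using U.finite_basis_within[OF Ks KT T(1) B(2) BK] by blast
    have "U.representation C (N b) b = 0" if b: "b \<in> C" for b
    proof -
      \<comment> \<open>N lowers the filtration, so N b is a combination of the old basis B. Its
        coefficient at b vanishes by induction if b is old, and because b does not occur in B if b
        is new.\<close>
      have "N b \<in> K i"
        using b C(2) kG_hom_mem[OF N] unfolding K_def by (auto simp: funpow_swap1)
      then have e: "U.representation C (N b) = U.representation B (N b)"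
        using U.representation_extend[OF C(4) _ C(1)] B(3) by blast
      show ?thesis
      proof (cases "b \<in> B")
        case True
        then show ?thesis using B(4) e by simp
      next
        case False
        then show ?thesis using U.representation_ne_zero[of B "N b" b] e by auto
      qed
    qed
    then show ?case using C by blast
  qed
  from this[of n] obtain B where B: "finite B" "U.independent B" "U.span B = K n"
    "\<forall>b\<in>B. U.representation B (N b) b = 0" by blast
  have Kn: "K n = carrier U" using nil unfolding K_def by blast
  have "B \<subseteq> carrier U" using U.span_superset[of B] B(3) Kn by blast
  then have "basis_of U B" "\<And>b. b \<in> B \<Longrightarrow> coord U B b (N b) = 0"
    using B Kn kG_hom_mem[OF N] unfolding basis_of_def coord_def by (auto simp: subset_iff)
  then show ?thesis using that by blast
qed

text \<open>With \<open>h\<close> dual to \<open>l\<close>, \<open>l f\<close> is the trace of \<open>h f\<close>, so \<open>h f\<close> is not nilpotent.\<close>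

lemma isomorphic_of_trivial_summand:
  fixes U :: "('g, 'k::field, 'u::ab_group_add) kG_mod" and V :: "('g, 'k, 'v::ab_group_add) kG_mod"
  assumes fin: "finite (carrier G)" and U: "indecomposable G U" and V: "indecomposable G V"
    and l: "l \<in> kG_hom G (Hom_mod G U V) trivial_line" and f: "f \<in> kG_hom G U V"
    and nz: "l (zero_ext U f) \<noteq> 0"
  shows "kG_isomorphic G U V"
proof -
  have Um: "kG_module G U" and U0: "carrier U \<noteq> {0}" and Vm: "kG_module G V"
    using U V unfolding indecomposable_def by blast+
  interpret U: kG_module G U by fact
  interpret V: kG_module G V by fact
  note Ur = U.kG_rep_axioms and Vr = V.kG_rep_axioms
  obtain h where h: "h \<in> kG_hom G V U"
    and hp: "\<And>v \<xi>. \<lbrakk>v \<in> carrier V; \<xi> \<in> carrier (dual_mod G U)\<rbrakk> \<Longrightarrow> \<xi> (h v) = l (rank_one U V \<xi> v)"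
    using dual_of_hom_space[OF Ur Vr fin Um l] by blast
  define N where "N u = h (f u)" for u
  have N: "N \<in> kG_hom G U U" unfolding N_def by (rule kG_hom_comp[OF f h])
  have "\<not> (\<exists>n. \<forall>u\<in>carrier U. (N ^^ n) u = 0)"
  proof
    assume "\<exists>n. \<forall>u\<in>carrier U. (N ^^ n) u = 0"
    then obtain n where "\<And>u. u \<in> carrier U \<Longrightarrow> (N ^^ n) u = 0" by blast
    then obtain B where B: "basis_of U B" and z: "\<And>b. b \<in> B \<Longrightarrow> coord U B b (N b) = 0"
      using nilpotent_basis[OF fin Um N] by blast
    have BU: "b \<in> carrier U" if "b \<in> B" for b using B that unfolding basis_of_def by blast
    \<comment> \<open>Expanding f in rank-one maps turns l(f) into the sum of the diagonal entries
      of N in the basis B, all of which are zero.\<close>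
    have "l (zero_ext U f) = (\<Sum>b\<in>B. l (rank_one U V (coord U B b) (f b)))"
      unfolding hom_coord_expansion[OF Ur Vr f B]
      by (rule kG_hom_sum[OF kG_rep_Hom_mod[OF Ur Vr] l])
        (rule rank_one_mem[OF Ur Vr coord_dual[OF Ur B] kG_hom_mem[OF f BU]])
    also have "\<dots> = (\<Sum>b\<in>B. coord U B b (N b))"
      unfolding N_def by (intro sum.cong refl hp[symmetric] kG_hom_mem[OF f BU] coord_dual[OF Ur B])
    also have "\<dots> = 0" using z by simp
    finally show False using nz by simp
  qed
  then have Nb: "bij_betw N (carrier U) (carrier U)" using fitting[OF fin U N] by blast
  define s where "s = inv_into (carrier U) N"
  have s: "s \<in> kG_hom G U U" unfolding s_def by (rule kG_hom_inv_into[OF Ur N Nb])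
  have sN: "s (N u) = u" if "u \<in> carrier U" for u
    unfolding s_def using Nb that by (simp add: bij_betw_def)
  \<comment> \<open>Since s h f = id on U, the map f s h is an idempotent of V. It is nonzero
    because f is injective and U is not zero, so it is the identity and f is onto.\<close>
  have e: "(\<lambda>v. f (s (h v))) \<in> kG_hom G V V" by (rule kG_hom_comp[OF kG_hom_comp[OF h s] f])
  have idem: "f (s (h (f (s (h v))))) = f (s (h v))" if "v \<in> carrier V" for v
    using sN[OF kG_hom_mem[OF s kG_hom_mem[OF h that]]] by (simp add: N_def)
  have inj: "inj_on f (carrier U)"
    using sN unfolding N_def inj_on_def by metis
  have "f ` carrier U = carrier V"
    using indecomposable_idempotent[OF fin V e idem]
  proof
    assume z: "\<forall>v\<in>carrier V. f (s (h v)) = 0"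
    obtain u where u: "u \<in> carrier U" "u \<noteq> 0" using U0 U.zero_mem by blast
    have "f u = 0" using z kG_hom_mem[OF f u(1)] sN[OF u(1)] unfolding N_def by force
    then have "u = 0" using inj u(1) U.zero_mem kG_hom_0[OF Ur f] unfolding inj_on_def by metis
    then show ?thesis using u(2) by simp
  next
    assume z: "\<forall>v\<in>carrier V. f (s (h v)) = v"
    show ?thesis
    proof
      show "f ` carrier U \<subseteq> carrier V" using kG_hom_mem[OF f] by blast
      show "carrier V \<subseteq> f ` carrier U"
      proof
        fix v assume v: "v \<in> carrier V"
        then have "v = f (s (h v))" using z by simp
        then show "v \<in> f ` carrier U" using kG_hom_mem[OF s kG_hom_mem[OF h v]] by blast
      qed
    qed
  qed
  then show ?thesis using f inj unfolding kG_isomorphic_def bij_betw_def by blast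
qed

text \<open>
  Once \<open>End(V)\<close> has a trivial summand, \<open>U\<close> is a summand of \<open>Hom(Hom(U, V), V)\<close>.
\<close>

lemma trace_ideal_of_hom_space:
  fixes U :: "('g, 'k::field, 'u::ab_group_add) kG_mod" and V :: "('g, 'k, 'v::ab_group_add) kG_mod"
  assumes fin: "finite (carrier G)" and Um: "kG_module G U" and Vr: "kG_rep G V"
    and F: "\<And>Q. Q \<in> F \<Longrightarrow> subgroup Q G"
    and l: "l \<in> kG_hom G (Hom_mod G V V) trivial_line" and f: "f \<in> kG_hom G V V"
    and nz: "l (zero_ext V f) \<noteq> 0"
    and id: "(\<lambda>x. x) \<in> trace_ideal G F (Hom_mod G U V) (Hom_mod G U V)"
  shows "(\<lambda>x. x) \<in> trace_ideal G F U U"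
proof -
  interpret U: kG_module G U by fact
  interpret V: kG_rep G V by fact
  note Ur = U.kG_rep_axioms
  define X where "X = Hom_mod G U V"
  define Z where "Z = Hom_mod G X V"
  have Xr: "kG_rep G X" unfolding X_def by (rule kG_rep_Hom_mod[OF Ur Vr])
  have Zr: "kG_rep G Z" unfolding Z_def by (rule kG_rep_Hom_mod[OF Xr Vr])
  have Er: "kG_rep G (Hom_mod G V V)" by (rule kG_rep_Hom_mod[OF Vr Vr])
  interpret X: kG_rep G X by (rule Xr)
  interpret D: kG_rep G "dual_mod G U"
    by (rule kG_rep_Hom_mod[OF Ur kG_rep_trivial_line[OF U.is_group]])
  have idZ: "(\<lambda>z. z) \<in> trace_ideal G F Z Z"
    unfolding Z_def by (rule trace_ideal_Hom_mod[OF Xr Vr F id[folded X_def]])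
  have xh: "x \<in> kG_hom (G\<lparr>carrier := {}\<rparr>) U V" if "x \<in> carrier X" for x
    using that Hom_mod_hom unfolding X_def by blast
  \<comment> \<open>Evaluation at u, followed by f: this is the embedding of U into Z. Equivariance
    uses that f commutes with \<open>G\<close>, although the elements x of X need not.\<close>
  define \<alpha> where "\<alpha> u = zero_ext X (\<lambda>x. f (x u))" for u
  have \<alpha>: "\<alpha> \<in> kG_hom G U Z"
  proof (rule kG_homI)
    fix u assume u: "u \<in> carrier U"
    have "(\<lambda>x. f (x u)) \<in> kG_hom (G\<lparr>carrier := {}\<rparr>) X V"
      using u by (intro kG_homI)
        (simp_all add: kG_hom_mem[OF f] kG_hom_mem[OF xh] kG_hom_add[OF f] kG_hom_scal[OF f], simp add: X_def kG_hom_scal[OF f] kG_hom_mem[OF Hom_mod_hom])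
    then show "\<alpha> u \<in> carrier Z"
      unfolding \<alpha>_def Z_def by (rule zero_ext_mem_Hom_mod[OF Xr])
    show "\<alpha> (u + w) = \<alpha> u + \<alpha> w" if w: "w \<in> carrier U" for w
    proof
      fix x show "\<alpha> (u + w) x = (\<alpha> u + \<alpha> w) x"
        by (cases "x \<in> carrier X")
          (simp_all add: \<alpha>_def u w kG_hom_add[OF xh] kG_hom_add[OF f] kG_hom_mem[OF xh])
    qed
    show "\<alpha> (scal U c u) = scal Z c (\<alpha> u)" for c
    proof
      fix x show "\<alpha> (scal U c u) x = scal Z c (\<alpha> u) x"
        by (cases "x \<in> carrier X")
          (simp_all add: \<alpha>_def Z_def u kG_hom_scal[OF xh] kG_hom_scal[OF f] kG_hom_mem[OF xh])
    qed
    fix g assume g: "g \<in> carrier G"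
    have ig: "inv\<^bsub>G\<^esub> g \<in> carrier G" using g by simp
    show "\<alpha> (act U g u) = act Z g (\<alpha> u)"
    proof
      fix x
      show "\<alpha> (act U g u) x = act Z g (\<alpha> u) x"
      proof (cases "x \<in> carrier X")
        case True
        have "act X (inv\<^bsub>G\<^esub> g) x \<in> carrier X" by (rule X.act_closed[OF ig True])
        then have "act Z g (\<alpha> u) x = act V g (f (act X (inv\<^bsub>G\<^esub> g) x u))"
          using True by (simp add: Z_def \<alpha>_def)
        also have "\<dots> = act V g (f (act V (inv\<^bsub>G\<^esub> g) (x (act U g u))))"
          using u g by (simp add: X_def)
        also have "\<dots> = f (x (act U g u))"
          using kG_hom_mem[OF xh[OF True] U.act_closed[OF g u]] g ig
          by (simp add: kG_hom_act[OF f] V.act_inv_cancel kG_hom_mem[OF f])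
        finally show ?thesis using True by (simp add: \<alpha>_def)
      qed (simp add: \<alpha>_def Z_def)
    qed
  qed
  have zh: "z \<in> kG_hom (G\<lparr>carrier := {}\<rparr>) X V" if "z \<in> carrier Z" for z
    using that Hom_mod_hom unfolding Z_def by blast
  have l0: "l \<in> kG_hom (G\<lparr>carrier := {}\<rparr>) (Hom_mod G V V) trivial_line"
    by (rule kG_hom_restrict[OF l]) simp
  \<comment> \<open>Restricting z to the maps \<xi> \<otimes> w with \<xi> fixed gives an
    endomorphism of V, to which l applies. As \<xi> varies, the values l(\<psi> z \<xi>) are those
    of all functionals on one vector of U, which defines the map back from Z.\<close>
  define \<psi> where "\<psi> z \<xi> = zero_ext V (\<lambda>w. z (rank_one U V \<xi> w))" 
    for z :: "('u \<Rightarrow> 'v) \<Rightarrow> 'v" and \<xi> :: "'u \<Rightarrow> 'k"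
  have rX: "rank_one U V \<xi> w \<in> carrier X" if "\<xi> \<in> carrier (dual_mod G U)" "w \<in> carrier V" for \<xi> w
    unfolding X_def by (rule rank_one_mem[OF Ur Vr that])
  have \<psi>E: "\<psi> z \<xi> \<in> carrier (Hom_mod G V V)"
    if "z \<in> carrier Z" "\<xi> \<in> carrier (dual_mod G U)" for z \<xi>
    unfolding \<psi>_def
    by (rule zero_ext_mem_Hom_mod[OF Vr kG_hom_comp[OF rank_one_hom_right[OF Ur Vr that(2), folded X_def] zh[OF that(1)]]])
  have "\<exists>h\<in>kG_hom G Z U. \<forall>z\<in>carrier Z. \<forall>\<xi>\<in>carrier (dual_mod G U). \<xi> (h z) = l (\<psi> z \<xi>)"
  proof (rule hom_from_dual_pairing[OF fin Um Zr])
    fix z assume z: "z \<in> carrier Z"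
    have "\<psi> z \<in> kG_hom (G\<lparr>carrier := {}\<rparr>) (dual_mod G U) (Hom_mod G V V)"
    proof (rule kG_homI)
      fix \<xi> assume \<xi>: "\<xi> \<in> carrier (dual_mod G U)"
      show "\<psi> z \<xi> \<in> carrier (Hom_mod G V V)" by (rule \<psi>E[OF z \<xi>])
      show "\<psi> z (\<xi> + \<eta>) = \<psi> z \<xi> + \<psi> z \<eta>" if \<eta>: "\<eta> \<in> carrier (dual_mod G U)" for \<eta>
      proof
        fix w show "\<psi> z (\<xi> + \<eta>) w = (\<psi> z \<xi> + \<psi> z \<eta>) w"
          by (cases "w \<in> carrier V")
            (simp_all add: \<psi>_def rank_one_linear(1)[OF Ur Vr] kG_hom_add[OF zh[OF z]] rX \<xi> \<eta> del: plus_fun_apply, simp_all add: \<psi>_def)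
      qed
      show "\<psi> z (scal (dual_mod G U) c \<xi>) = scal (Hom_mod G V V) c (\<psi> z \<xi>)" for c
      proof
        fix w show "\<psi> z (scal (dual_mod G U) c \<xi>) w = scal (Hom_mod G V V) c (\<psi> z \<xi>) w"
          using kG_hom_scal[OF zh[OF z] rX[OF \<xi>], of w c]
          unfolding \<psi>_def rank_one_linear(3)[OF Ur Vr] X_def[symmetric]
          by (cases "w \<in> carrier V") simp_all
      qed
    qed simp
    then show "(\<lambda>\<xi>. l (\<psi> z \<xi>)) \<in> kG_hom (G\<lparr>carrier := {}\<rparr>) (dual_mod G U) trivial_line"
      by (rule kG_hom_comp[OF _ l0])
    fix \<xi> assume \<xi>: "\<xi> \<in> carrier (dual_mod G U)"
    show "l (\<psi> (z + y) \<xi>) = l (\<psi> z \<xi>) + l (\<psi> y \<xi>)" if y: "y \<in> carrier Z" for y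
    proof -
      have "\<psi> (z + y) \<xi> = \<psi> z \<xi> + \<psi> y \<xi>" by (auto simp: \<psi>_def zero_ext_def fun_eq_iff)
      then show ?thesis using kG_hom_add[OF l \<psi>E[OF z \<xi>] \<psi>E[OF y \<xi>]] by (simp only:)
    qed
    show "l (\<psi> (scal Z c z) \<xi>) = c * l (\<psi> z \<xi>)" for c
    proof -
      have "\<psi> (scal Z c z) \<xi> = scal (Hom_mod G V V) c (\<psi> z \<xi>)"
        by (auto simp: \<psi>_def zero_ext_def fun_eq_iff Z_def)
      then show ?thesis using kG_hom_scal[OF l \<psi>E[OF z \<xi>]] by (simp only: trivial_line_sel)
    qed
    fix g assume g: "g \<in> carrier G"
    have ig: "inv\<^bsub>G\<^esub> g \<in> carrier G" using g by simp
    let ?\<xi> = "act (dual_mod G U) (inv\<^bsub>G\<^esub> g) \<xi>"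
    have \<xi>': "?\<xi> \<in> carrier (dual_mod G U)" by (rule D.act_closed[OF ig \<xi>])
    \<comment> \<open>The inverse of g acts on both factors of \<xi> \<otimes> w: on \<xi> it gives
      the twisted functional, and on w it is the inner half of the conjugation action on the
      endomorphisms of V.\<close>
    have "\<psi> (act Z g z) \<xi> = act (Hom_mod G V V) g (\<psi> z ?\<xi>)"
    proof
      fix w
      show "\<psi> (act Z g z) \<xi> w = act (Hom_mod G V V) g (\<psi> z ?\<xi>) w"
      proof (cases "w \<in> carrier V")
        case True
        have w': "act V (inv\<^bsub>G\<^esub> g) w \<in> carrier V" by (rule V.act_closed[OF ig True])
        have "\<psi> (act Z g z) \<xi> w = act V g (z (act X (inv\<^bsub>G\<^esub> g) (rank_one U V \<xi> w)))"
          using True rX[OF \<xi> True] by (simp add: \<psi>_def Z_def)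
        also have "act X (inv\<^bsub>G\<^esub> g) (rank_one U V \<xi> w) = rank_one U V ?\<xi> (act V (inv\<^bsub>G\<^esub> g) w)"
          unfolding X_def by (rule rank_one_act[OF Ur Vr True ig])
        also have "act V g (z (rank_one U V ?\<xi> (act V (inv\<^bsub>G\<^esub> g) w))) = act (Hom_mod G V V) g (\<psi> z ?\<xi>) w"
          unfolding Hom_mod_sel(2)[of G V V] \<psi>_def zero_ext_apply(1)[OF True] zero_ext_apply(1)[OF w'] ..
        finally show ?thesis .
      next
        case False
        then show ?thesis unfolding \<psi>_def Hom_mod_sel(2)[of G V V] by simp
      qed
    qed
    then show "l (\<psi> (act Z g z) \<xi>) = l (\<psi> z ?\<xi>)"
      using kG_hom_act[OF l g \<psi>E[OF z \<xi>']] by (simp only: trivial_line_sel)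
  qed
  then obtain h where h: "h \<in> kG_hom G Z U"
    and hp: "\<And>z \<xi>. \<lbrakk>z \<in> carrier Z; \<xi> \<in> carrier (dual_mod G U)\<rbrakk> \<Longrightarrow> \<xi> (h z) = l (\<psi> z \<xi>)" by blast
  let ?c = "l (zero_ext V f)"
  have fE: "zero_ext V f \<in> carrier (Hom_mod G V V)" by (rule zero_ext_mem_Hom_mod[OF Vr f])
  \<comment> \<open>At \<xi> \<otimes> w the element \<alpha> u takes the value f(\<xi>(u) w), so
    \<psi>(\<alpha> u) \<xi> is \<xi>(u) times f. Hence h \<alpha> is multiplication by the nonzero
    constant l(f), and dividing by it makes U a retract of Z.\<close>
  have h\<alpha>: "h (\<alpha> u) = scal U ?c u" if u: "u \<in> carrier U" for u
  proof (rule dual_separates[OF fin Um kG_hom_mem[OF h kG_hom_mem[OF \<alpha> u]] U.scal_mem[OF u]])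
    fix \<xi> assume \<xi>: "\<xi> \<in> carrier (dual_mod G U)"
    have "\<psi> (\<alpha> u) \<xi> = scal (Hom_mod G V V) (\<xi> u) (zero_ext V f)"
    proof
      fix w show "\<psi> (\<alpha> u) \<xi> w = scal (Hom_mod G V V) (\<xi> u) (zero_ext V f) w"
        using rX[OF \<xi>, of w] u
        by (cases "w \<in> carrier V") (simp_all add: \<psi>_def \<alpha>_def, simp add: rank_one_def kG_hom_scal[OF f])
    qed
    then have "l (\<psi> (\<alpha> u) \<xi>) = \<xi> u * ?c" using kG_hom_scal[OF l fE] by (simp only: trivial_line_sel)
    then show "\<xi> (h (\<alpha> u)) = \<xi> (scal U ?c u)"
      using hp[OF kG_hom_mem[OF \<alpha> u] \<xi>] by (simp add: dual_mod_scal[OF \<xi> u] mult.commute)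
  qed
  have "(\<lambda>x. scal U (inverse ?c) (h (\<alpha> x))) \<in> trace_ideal G F U U"
    by (rule trace_ideal_comp[OF Zr Zr F idZ \<alpha> kG_hom_scal_map[OF Ur h]])
  then show ?thesis
    by (rule trace_ideal_cong) (simp add: h\<alpha> nz)
qed

section \<open>Dade modules\<close>

text \<open>
  Write \<open>id = N + j\<close> on a retract \<open>X\<close> of \<open>E\<close>, with \<open>N\<close> factoring through a trivial module and \<open>j\<close>
  in the trace ideal.  Without a trivial summand \<open>N\<^sup>2 = 0\<close>, so \<open>id = (id - N) (id + N) = j (id + N)\<close>.
\<close>

lemma trivial_summand_or_trace_ideal:
  fixes X :: "('g, 'k::field, 'x::ab_group_add) kG_mod" and E :: "('g, 'k, 'e::ab_group_add) kG_mod"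
    and n :: nat
  assumes X: "kG_rep G X" and E: "kG_rep G E" and F: "\<And>Q. Q \<in> F \<Longrightarrow> subgroup Q G"
    and \<iota>: "\<iota> \<in> kG_hom G X E" and \<pi>: "\<pi> \<in> kG_hom G E X" and \<pi>\<iota>: "\<And>x. x \<in> carrier X \<Longrightarrow> \<pi> (\<iota> x) = x"
    and \<alpha>: "\<And>i. i < n \<Longrightarrow> \<alpha> i \<in> kG_hom G E trivial_line"
    and a: "\<And>i. i < n \<Longrightarrow> a i \<in> carrier E"
    and fixed: "\<And>i g. \<lbrakk>i < n; g \<in> carrier G\<rbrakk> \<Longrightarrow> act E g (a i) = a i"
    and j: "j \<in> trace_ideal G F E E"
    and dec: "\<And>e. e \<in> carrier E \<Longrightarrow> e = (\<Sum>i<n. scal E (\<alpha> i e) (a i)) + j e"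
  shows "(\<exists>l\<in>kG_hom G X trivial_line. \<exists>f\<in>carrier X. (\<forall>g\<in>carrier G. act X g f = f) \<and> l f \<noteq> 0) \<or>
    (\<lambda>x. x) \<in> trace_ideal G F X X"
proof (rule disjCI)
  assume "(\<lambda>x. x) \<notin> trace_ideal G F X X"
  interpret X: kG_rep G X by fact
  interpret E: kG_rep G E by fact
  define l where "l i x = \<alpha> i (\<iota> x)" for i x
  define f where "f i = \<pi> (a i)" for i
  have l: "l i \<in> kG_hom G X trivial_line" if "i < n" for i
    unfolding l_def by (rule kG_hom_comp[OF \<iota> \<alpha>[OF that]])
  have f: "f i \<in> carrier X" if "i < n" for i
    unfolding f_def by (rule kG_hom_mem[OF \<pi> a[OF that]])
  have ff: "act X g (f i) = f i" if "i < n" "g \<in> carrier G" for i g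
    unfolding f_def using kG_hom_act[OF \<pi> that(2) a[OF that(1)]] fixed[OF that] by simp
  show "\<exists>l\<in>kG_hom G X trivial_line. \<exists>f\<in>carrier X. (\<forall>g\<in>carrier G. act X g f = f) \<and> l f \<noteq> 0"
  proof (rule ccontr)
    assume no: "\<not> ?thesis"
    \<comment> \<open>All pairs of indices count, not only the diagonal ones: the alternative fails
      for every invariant functional and every fixed vector, and the square of N involves all
      products.\<close>
    then have lf: "l i (f i') = 0" if "i < n" "i' < n" for i i'
      using l[OF that(1)] f[OF that(2)] ff[OF that(2)] by blast
    define N where "N x = (\<Sum>i<n. scal X (l i x) (f i))" for x
    have "(\<lambda>x. \<Sum>i\<in>{..<n}. scal X (l i x) (f i)) \<in> kG_hom G X X"
    proof (rule kG_hom_sum_map[OF X])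
      fix i assume "i \<in> {..<n}"
      then have i: "i < n" by simp
      show "(\<lambda>x. scal X (l i x) (f i)) \<in> kG_hom G X X"
        using f[OF i] by (intro kG_homI)
          (simp_all add: kG_homD[OF l[OF i]] X.scal_mem X.scale_left_distrib X.act_scal ff[OF i])
    qed
    then have N: "N \<in> kG_hom G X X" unfolding N_def by simp
    have NN: "N (N x) = 0" if x: "x \<in> carrier X" for x
    proof -
      have "l i (N x) = 0" if i: "i < n" for i
      proof -
        have "l i (N x) = (\<Sum>i'<n. l i (scal X (l i' x) (f i')))"
          unfolding N_def by (rule kG_hom_sum[OF X l[OF i]]) (simp add: f X.scal_mem)
        also have "\<dots> = 0"
          by (intro sum.neutral ballI) (simp add: kG_hom_scal[OF l[OF i]] f lf[OF i])
        finally show ?thesis .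
      qed
      then show ?thesis unfolding N_def[of "N x"] by simp
    qed
    have jE: "j e \<in> carrier E" if e: "e \<in> carrier E" for e
    proof -
      have "j e = e - (\<Sum>i<n. scal E (\<alpha> i e) (a i))" using dec[OF e] by (simp add: algebra_simps)
      also have "\<dots> \<in> carrier E" using a by (intro E.diff_mem e E.sum_mem E.scal_mem) simp
      finally show ?thesis .
    qed
    have dX: "\<pi> (j (\<iota> x)) = x - N x" if x: "x \<in> carrier X" for x
    proof -
      have ix: "\<iota> x \<in> carrier E" by (rule kG_hom_mem[OF \<iota> x])
      have s: "(\<Sum>i<n. scal E (\<alpha> i (\<iota> x)) (a i)) \<in> carrier E" using a by (intro E.sum_mem E.scal_mem) simp
      have "x = \<pi> ((\<Sum>i<n. scal E (\<alpha> i (\<iota> x)) (a i)) + j (\<iota> x))"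
        using \<pi>\<iota>[OF x] dec[OF ix] by simp
      also have "\<dots> = \<pi> (\<Sum>i<n. scal E (\<alpha> i (\<iota> x)) (a i)) + \<pi> (j (\<iota> x))"
        by (rule kG_hom_add[OF \<pi> s jE[OF ix]])
      also have "\<pi> (\<Sum>i<n. scal E (\<alpha> i (\<iota> x)) (a i)) = (\<Sum>i<n. \<pi> (scal E (\<alpha> i (\<iota> x)) (a i)))"
        by (rule kG_hom_sum[OF E \<pi>]) (simp add: a E.scal_mem)
      also have "\<dots> = N x"
        unfolding N_def l_def f_def by (intro sum.cong refl) (simp add: kG_hom_scal[OF \<pi>] a)
      finally show ?thesis by (simp add: algebra_simps)
    qed
    have N1: "(\<lambda>x. x + N x) \<in> kG_hom G X X" by (rule kG_hom_add_map[OF X kG_hom_id N])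
    have "(\<lambda>x. \<pi> (j (\<iota> (x + N x)))) \<in> trace_ideal G F X X"
      by (rule trace_ideal_comp[OF E E F j kG_hom_comp[OF N1 \<iota>] \<pi>])
    moreover have "x = \<pi> (j (\<iota> (x + N x)))" if x: "x \<in> carrier X" for x
      using dX[OF kG_hom_mem[OF N1 x]] kG_hom_add[OF N x kG_hom_mem[OF N x]] NN[OF x] by simp
    ultimately have "(\<lambda>x. x) \<in> trace_ideal G F X X" by (rule trace_ideal_cong)
    then show False using \<open>(\<lambda>x. x) \<notin> trace_ideal G F X X\<close> by blast
  qed
qed

text \<open>Hom is contravariant in the first argument and covariant in the second. Applied to the
  inclusions and projections of two summands of M, this exhibits Hom(U, V) as a retract of
  End(M).\<close>

lemma Hom_mod_map:
  assumes A': "kG_rep G A'" and A: "kG_rep G A"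
    and p: "p \<in> kG_hom G A' A" and q: "q \<in> kG_hom G B B'" and B: "kG_rep G B" and B': "kG_rep G B'"
  shows "(\<lambda>f. zero_ext A' (\<lambda>v. q (f (p v)))) \<in> kG_hom G (Hom_mod G A B) (Hom_mod G A' B')"
proof (rule kG_homI)
  interpret A': kG_rep G A' by fact
  interpret A: kG_rep G A by fact
  interpret B: kG_rep G B by fact
  interpret B': kG_rep G B' by fact
  fix f assume f: "f \<in> carrier (Hom_mod G A B)"
  note fh = Hom_mod_hom[OF f]
  have p0: "p \<in> kG_hom (G\<lparr>carrier := {}\<rparr>) A' A" and q0: "q \<in> kG_hom (G\<lparr>carrier := {}\<rparr>) B B'"
    by (rule kG_hom_restrict[OF p], simp) (rule kG_hom_restrict[OF q], simp)
  show "zero_ext A' (\<lambda>v. q (f (p v))) \<in> carrier (Hom_mod G A' B')"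
    by (rule zero_ext_mem_Hom_mod[OF A' kG_hom_comp[OF kG_hom_comp[OF p0 fh] q0]])
  have m: "f (p v) \<in> carrier B" if "v \<in> carrier A'" for v
    by (rule kG_hom_mem[OF fh kG_hom_mem[OF p that]])
  show "zero_ext A' (\<lambda>v. q ((f + f') (p v))) = zero_ext A' (\<lambda>v. q (f (p v))) + zero_ext A' (\<lambda>v. q (f' (p v)))"
    if f': "f' \<in> carrier (Hom_mod G A B)" for f'
    using kG_hom_mem[OF Hom_mod_hom[OF f'] kG_hom_mem[OF p]]
    by (auto simp: fun_eq_iff zero_ext_def m kG_hom_add[OF q])
  show "zero_ext A' (\<lambda>v. q (scal (Hom_mod G A B) c f (p v))) =
      scal (Hom_mod G A' B') c (zero_ext A' (\<lambda>v. q (f (p v))))" for c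
    by (auto simp: fun_eq_iff zero_ext_def m kG_hom_scal[OF q])
  show "zero_ext A' (\<lambda>v. q (act (Hom_mod G A B) g f (p v))) =
      act (Hom_mod G A' B') g (zero_ext A' (\<lambda>v. q (f (p v))))" if g: "g \<in> carrier G" for g
  proof
    fix v
    have ig: "inv\<^bsub>G\<^esub> g \<in> carrier G" using g by simp
    show "zero_ext A' (\<lambda>v. q (act (Hom_mod G A B) g f (p v))) v =
        act (Hom_mod G A' B') g (zero_ext A' (\<lambda>v. q (f (p v)))) v"
    proof (cases "v \<in> carrier A'")
      case True
      have "f (act A (inv\<^bsub>G\<^esub> g) (p v)) \<in> carrier B"
        by (rule kG_hom_mem[OF fh A.act_closed[OF ig kG_hom_mem[OF p True]]])
      then show ?thesis
        using True g ig by (simp add: kG_hom_mem[OF p] kG_hom_act[OF q] kG_hom_act[OF p] A'.act_closed)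
    qed simp
  qed
qed

lemma kG_rep_trivial_power:
  fixes G :: "'g monoid"
  assumes "group G" shows "kG_rep G (trivial_power n :: ('g, 'k::field, nat \<Rightarrow> 'k) kG_mod)"
proof -
  have vs: "vector_space (scal (trivial_power n :: ('g, 'k, nat \<Rightarrow> 'k) kG_mod))"
    by unfold_locales (simp_all add: trivial_power_def fun_eq_iff algebra_simps)
  have "module.subspace (scal (trivial_power n :: ('g, 'k, nat \<Rightarrow> 'k) kG_mod)) (carrier (trivial_power n))"
    unfolding module.subspace_def[OF vs[folded module_iff_vector_space]] by (simp add: trivial_power_def)
  then show ?thesis
    unfolding kG_rep_def kG_rep_axioms_def using assms vs by (simp add: trivial_power_def)
qed

text \<open>The isomorphism of End(M) with the sum of \<open>trivial_power n\<close> and W is read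
  in coordinates: \<open>\<alpha> i\<close> is the i-th coordinate, \<open>a i\<close> the preimage
  of the i-th unit vector, and j the projection to W. The identity of W, and with it j, lies in the
  trace ideal because every component of W is relatively projective to its vertex, a member of
  \<open>F\<close> by hypothesis.\<close>

lemma dade_module_decomposition:
  fixes M :: "('g, 'k::field, 'v::ab_group_add) kG_mod"
  assumes fin: "finite (carrier G)" and G: "group G" and M: "dade_module G p M"
    and F: "F = {Q. p_subgroup G p Q \<and> \<not> sylow_subgroup G p Q}"
  defines "E \<equiv> End_mod G M"
  shows "\<exists>(n :: nat) \<alpha> a. \<exists>j\<in>trace_ideal G F E E.
    (\<forall>i<n. \<alpha> i \<in> kG_hom G E trivial_line \<and> a i \<in> carrier E \<and> (\<forall>g\<in>carrier G. act E g (a i) = a i)) \<and>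
    (\<forall>e\<in>carrier E. e = (\<Sum>i<n. scal E (\<alpha> i e) (a i)) + j e)"
proof -
  have Fs: "\<And>Q. Q \<in> F \<Longrightarrow> subgroup Q G" unfolding F p_subgroup_def by blast
  have "F \<subseteq> Pow (carrier G)" using Fs subgroup.subset by blast
  then have Ff: "finite F" using fin finite_subset by blast
  have Mm: "kG_module G M" using M unfolding dade_module_def by blast
  then interpret M: kG_module G M .
  interpret E: kG_rep G E
    unfolding E_def End_mod_eq_Hom_mod by (rule kG_rep_Hom_mod[OF M.kG_rep_axioms M.kG_rep_axioms])
  obtain n and W :: "('g, 'k, nat \<Rightarrow> 'k) kG_mod" and t where
    W: "p_permutation_module G W"
    and C: "\<And>C :: ('g, 'k, nat \<Rightarrow> 'k) kG_mod. component G C W \<Longrightarrow>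
       \<exists>Q. is_vertex G C Q \<and> p_subgroup G p Q \<and> \<not> sylow_subgroup G p Q"
    and t: "t \<in> kG_hom G E (kG_sum (trivial_power n) W)"
    and b: "bij_betw t (carrier E) (carrier (kG_sum (trivial_power n :: ('g, 'k, nat \<Rightarrow> 'k) kG_mod) W))"
    using M unfolding dade_module_def kG_isomorphic_def E_def by blast
  let ?K = "trivial_power n :: ('g, 'k, nat \<Rightarrow> 'k) kG_mod"
  let ?S = "kG_sum ?K W"
  have Wm: "kG_module G W" using W unfolding p_permutation_module_def direct_summand_def by blast
  interpret W: kG_module G W by fact
  interpret K: kG_rep G ?K by (rule kG_rep_trivial_power[OF G])
  have Sr: "kG_rep G ?S" by (rule kG_rep_sum[OF K.kG_rep_axioms W.kG_rep_axioms])
  have "(\<lambda>x. x) \<in> trace_ideal G F C C" if c: "component G C W" for C :: "('g, 'k, nat \<Rightarrow> 'k) kG_mod"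
  proof -
    have "kG_module G C" using c unfolding component_def direct_summand_def by blast
    then interpret C: kG_module G C .
    obtain Q where Q: "is_vertex G C Q" "Q \<in> F" using C[OF c] F by blast
    then have "relatively_projective G Q C" unfolding is_vertex_def by blast
    then obtain \<theta> where \<theta>: "\<theta> \<in> kG_hom (G\<lparr>carrier := Q\<rparr>) C C"
      and tr: "\<forall>m\<in>carrier C. rel_trace G Q C C \<theta> m = m"
      using relatively_projective_trace[OF fin G Fs[OF Q(2)]] by blast
    show ?thesis
      by (rule trace_ideal_cong[OF rel_trace_mem_trace_ideal[OF C.kG_rep_axioms C.kG_rep_axioms Fs Ff Q(2) \<theta>]])
        (simp_all add: tr)
  qed
  then have idW: "(\<lambda>x. x) \<in> trace_ideal G F W W" using trace_ideal_of_components[OF fin Fs Wm] by simp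
  define t' where "t' = inv_into (carrier E) t"
  have t': "t' \<in> kG_hom G ?S E" unfolding t'_def by (rule kG_hom_inv_into[OF E.kG_rep_axioms t b])
  have t't: "t' (t e) = e" if "e \<in> carrier E" for e
    unfolding t'_def using b that by (simp add: bij_betw_def)
  define \<alpha> where "\<alpha> i e = fst (t e) i" for i e
  define \<delta> where "\<delta> i = (\<lambda>m. if m = i then 1 else 0 :: 'k)" for i :: nat
  define a where "a i = t' (\<delta> i, 0)" for i
  define j where "j e = t' (0, snd (t e))" for e
  have \<delta>: "(\<delta> i, 0) \<in> carrier ?S" if "i < n" for i
    using that W.zero_mem by (simp add: trivial_power_def \<delta>_def)
  have "\<alpha> i \<in> kG_hom G E trivial_line" for i
    unfolding \<alpha>_def by (rule kG_homI) (simp_all add: kG_homD[OF t] trivial_power_def)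
  moreover have "a i \<in> carrier E" if "i < n" for i
    unfolding a_def by (rule kG_hom_mem[OF t' \<delta>[OF that]])
  moreover have "act E g (a i) = a i" if "i < n" "g \<in> carrier G" for i g
    using kG_hom_act[OF t' that(2) \<delta>[OF that(1)]] that(2) W.act_zero
    by (simp add: a_def trivial_power_def)
  moreover have "j \<in> trace_ideal G F E E"
  proof -
    have pr: "snd \<in> kG_hom G ?S W" by (rule kG_homI) auto
    have "(\<lambda>w. (0, w)) \<in> kG_hom G W ?S"
      by (rule kG_homI) (simp_all add: K.zero_mem K.act_zero)
    from trace_ideal_comp[OF W.kG_rep_axioms W.kG_rep_axioms Fs idW kG_hom_comp[OF t pr] kG_hom_comp[OF this t']]
    show ?thesis unfolding j_def .
  qed
  moreover have "e = (\<Sum>i<n. scal E (\<alpha> i e) (a i)) + j e" if e: "e \<in> carrier E" for e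
  proof -
    have te: "t e \<in> carrier ?S" by (rule kG_hom_mem[OF t e])
    have "fst (t e) = (\<Sum>i<n. scal ?K (\<alpha> i e) (\<delta> i))"
    proof
      fix m
      have "(\<Sum>i<n. scal ?K (\<alpha> i e) (\<delta> i)) m = (\<Sum>i<n. if m = i then \<alpha> i e else 0)"
        unfolding sum_fun_apply by (intro sum.cong refl) (simp add: trivial_power_def \<delta>_def)
      also have "\<dots> = fst (t e) m" using te by (cases "t e") (simp add: \<alpha>_def trivial_power_def)
      finally show "fst (t e) m = (\<Sum>i<n. scal ?K (\<alpha> i e) (\<delta> i)) m" by simp
    qed
    moreover have "(\<Sum>i<n. scal ?S (\<alpha> i e) (\<delta> i, 0)) = (\<Sum>i<n. scal ?K (\<alpha> i e) (\<delta> i), 0)"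
      by (simp add: prod_eq_iff fst_sum snd_sum)
    ultimately have "t e = (\<Sum>i<n. scal ?S (\<alpha> i e) (\<delta> i, 0)) + (0, snd (t e))"
      by (simp add: prod_eq_iff)
    then have "e = t' ((\<Sum>i<n. scal ?S (\<alpha> i e) (\<delta> i, 0)) + (0, snd (t e)))"
      using t't[OF e] by (simp only:)
    also have "\<dots> = t' (\<Sum>i<n. scal ?S (\<alpha> i e) (\<delta> i, 0)) + t' (0, snd (t e))"
    proof (rule kG_hom_add[OF t'])
      show "(\<Sum>i<n. scal ?S (\<alpha> i e) (\<delta> i, 0)) \<in> carrier ?S"
        by (intro kG_rep.sum_mem[OF Sr] kG_rep.scal_mem[OF Sr] \<delta>) simp
      show "(0, snd (t e)) \<in> carrier ?S" using te K.zero_mem by auto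
    qed
    also have "t' (\<Sum>i<n. scal ?S (\<alpha> i e) (\<delta> i, 0)) = (\<Sum>i<n. t' (scal ?S (\<alpha> i e) (\<delta> i, 0)))"
      by (intro kG_hom_sum[OF Sr t'] kG_rep.scal_mem[OF Sr] \<delta>) simp
    also have "\<dots> = (\<Sum>i<n. scal E (\<alpha> i e) (a i))"
      unfolding a_def by (intro sum.cong refl kG_hom_scal[OF t'] \<delta>) simp
    finally show ?thesis unfolding j_def .
  qed
  ultimately show ?thesis
    by blast
qed

text \<open>The decomposition of End(M) is passed to its retract Hom(U, V), and a fixed vector of
  Hom(U, V) is then read as a homomorphism from U to V.\<close>

lemma hom_space_trivial_summand_or_trace_ideal:
  fixes M :: "('g, 'k::field, 'v::ab_group_add) kG_mod"
    and U :: "('g, 'k, 'u::ab_group_add) kG_mod" and V :: "('g, 'k, 'w::ab_group_add) kG_mod"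
  assumes fin: "finite (carrier G)" and G: "group G" and M: "dade_module G p M"
    and F: "F = {Q. p_subgroup G p Q \<and> \<not> sylow_subgroup G p Q}"
    and U: "direct_summand G U M" and V: "direct_summand G V M"
  shows "(\<exists>l\<in>kG_hom G (Hom_mod G U V) trivial_line. \<exists>f\<in>kG_hom G U V. l (zero_ext U f) \<noteq> 0) \<or>
    (\<lambda>x. x) \<in> trace_ideal G F (Hom_mod G U V) (Hom_mod G U V)"
proof -
  have Fs: "\<And>Q. Q \<in> F \<Longrightarrow> subgroup Q G" unfolding F p_subgroup_def by blast
  have "kG_module G M" "kG_module G U" "kG_module G V"
    using M U V unfolding dade_module_def direct_summand_def by blast+
  then have Mr: "kG_rep G M" and Ur: "kG_rep G U" and Vr: "kG_rep G V"
    using kG_module_iff[OF fin] by blast+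
  obtain iU qU where iU: "iU \<in> kG_hom G U M" and qU: "qU \<in> kG_hom G M U"
    and U1: "\<And>u. u \<in> carrier U \<Longrightarrow> qU (iU u) = u"
    using direct_summand_retract[OF Mr U] by blast
  obtain iV qV where iV: "iV \<in> kG_hom G V M" and qV: "qV \<in> kG_hom G M V"
    and V1: "\<And>u. u \<in> carrier V \<Longrightarrow> qV (iV u) = u"
    using direct_summand_retract[OF Mr V] by blast
  let ?X = "Hom_mod G U V" and ?E = "Hom_mod G M M"
  have Xr: "kG_rep G ?X" and Er: "kG_rep G ?E"
    by (rule kG_rep_Hom_mod[OF Ur Vr], rule kG_rep_Hom_mod[OF Mr Mr])
  obtain n :: nat and \<alpha> a j where j: "j \<in> trace_ideal G F ?E ?E"
    and d: "\<forall>i<n. \<alpha> i \<in> kG_hom G ?E trivial_line \<and> a i \<in> carrier ?E \<and> (\<forall>g\<in>carrier G. act ?E g (a i) = a i)"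
    and e: "\<forall>e\<in>carrier ?E. e = (\<Sum>i<n. scal ?E (\<alpha> i e) (a i)) + j e"
    using dade_module_decomposition[OF fin G M F] unfolding End_mod_eq_Hom_mod by blast
  have retr: "zero_ext U (\<lambda>u. qV (zero_ext M (\<lambda>m. iV (x (qU m))) (iU u))) = x"
    if x: "x \<in> carrier ?X" for x
  proof
    fix u show "zero_ext U (\<lambda>u. qV (zero_ext M (\<lambda>m. iV (x (qU m))) (iU u))) u = x u"
      using Hom_mod_outside[OF x] kG_hom_mem[OF Hom_mod_hom[OF x]]
      by (cases "u \<in> carrier U") (simp_all add: U1 V1 kG_hom_mem[OF iU])
  qed
  have "(\<exists>l\<in>kG_hom G ?X trivial_line. \<exists>f\<in>carrier ?X. (\<forall>g\<in>carrier G. act ?X g f = f) \<and> l f \<noteq> 0) \<or>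
    (\<lambda>x. x) \<in> trace_ideal G F ?X ?X"
  proof (rule trivial_summand_or_trace_ideal[OF Xr Er Fs Hom_mod_map[OF Mr Ur qU iV Vr Mr]
        Hom_mod_map[OF Ur Mr iU qV Mr Vr]])
    show "zero_ext U (\<lambda>u. qV (zero_ext M (\<lambda>m. iV (x (qU m))) (iU u))) = x" if "x \<in> carrier ?X" for x
      by (rule retr[OF that])
    show "\<alpha> i \<in> kG_hom G ?E trivial_line" "a i \<in> carrier ?E" if "i < n" for i
      using d that by blast+
    show "act ?E g (a i) = a i" if "i < n" "g \<in> carrier G" for i g
      using d that by blast
    show "e = (\<Sum>i<n. scal ?E (\<alpha> i e) (a i)) + j e" if "e \<in> carrier ?E" for e
      using e that by blast
  qed (use j in simp_all)
  \<comment> \<open>Elements of the Hom space already vanish outside U, so a fixed point serves as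
    the homomorphism itself.\<close>
  moreover have "f \<in> kG_hom G U V \<and> zero_ext U f = f"
    if "f \<in> carrier ?X" "\<forall>g\<in>carrier G. act ?X g f = f" for f
    using that Hom_mod_fixed_hom[OF Ur Vr that(1), of G] Hom_mod_outside[OF that(1)]
    by (auto simp: fun_eq_iff zero_ext_def simp del: Hom_mod_sel)
  ultimately show ?thesis by (metis (no_types, lifting))
qed

theorem proposition3p4:
  fixes G :: "'g monoid" and p :: nat and S P Q :: "'g set"
    and M :: "('g, 'k::alg_closed_field, 'v::ab_group_add) kG_mod"
    and U :: "('g, 'k, 'u::ab_group_add) kG_mod"
    and V :: "('g, 'k, 'w::ab_group_add) kG_mod"
  assumes "group G" and "finite (carrier G)"
    and "prime p" and "CHAR('k) = p"
    and "sylow_subgroup G p S"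
    and "dade_module G p M" and "capped G S M"
    and "component G U M" and "is_vertex G U P" and "sylow_subgroup G p P"
    and "component G V M" and "is_vertex G V Q" and "sylow_subgroup G p Q"
  shows "kG_isomorphic G U V"
proof -
  note G = assms(1) and fin = assms(2) and p = assms(3) and M = assms(6)
  \<comment> \<open>This family depends only on G and p, so it is the same for the two vertices P
    and Q.\<close>
  define F where "F = {Q. p_subgroup G p Q \<and> \<not> sylow_subgroup G p Q}"
  have Fs: "\<And>Q. Q \<in> F \<Longrightarrow> subgroup Q G" unfolding F_def p_subgroup_def by blast
  have Ud: "direct_summand G U M" and Ui: "indecomposable G U"
    and Vd: "direct_summand G V M" and Vi: "indecomposable G V"
    using assms(8,11) unfolding component_def by blast+
  have Um: "kG_module G U" and Vm: "kG_module G V"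
    using Ui Vi unfolding indecomposable_def by blast+
  then have Ur: "kG_rep G U" and Vr: "kG_rep G V" using kG_module_iff[OF fin] by blast+
  have noU: "(\<lambda>x. x) \<notin> trace_ideal G F U U"
    by (rule vertex_not_smaller_trace[OF G fin p assms(9,10) F_def])
  have noV: "(\<lambda>x. x) \<notin> trace_ideal G F V V"
    by (rule vertex_not_smaller_trace[OF G fin p assms(12,13) F_def])
  have "(\<lambda>x. x) \<notin> trace_ideal G F (Hom_mod G V V) (Hom_mod G V V)"
    using trace_ideal_of_fixed[OF Vr Vr Fs _ kG_hom_id] noV by blast
  then obtain m f where mf: "m \<in> kG_hom G (Hom_mod G V V) trivial_line" "f \<in> kG_hom G V V"
    "m (zero_ext V f) \<noteq> 0"
    using hom_space_trivial_summand_or_trace_ideal[OF fin G M F_def Vd Vd] by blast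
  have "(\<lambda>x. x) \<notin> trace_ideal G F (Hom_mod G U V) (Hom_mod G U V)"
    using trace_ideal_of_hom_space[OF fin Um Vr Fs mf] noU by blast
  then obtain l f' where "l \<in> kG_hom G (Hom_mod G U V) trivial_line" "f' \<in> kG_hom G U V"
    "l (zero_ext U f') \<noteq> 0"
    using hom_space_trivial_summand_or_trace_ideal[OF fin G M F_def Ud Vd] by blast
  then show ?thesis by (rule isomorphic_of_trivial_summand[OF fin Ui Vi])
qed

end
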